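(* Let $\mathbb G$ be a grid diagram representing a Legendrian link $\Lambda$. There is an injection $$\widehat{GH}_{\mathrm{big}}(\mathbb G)\to\widetilde{GH}_{\mathrm{big}}(\mathbb G)$$ that sends $\widehat\lambda^+_{\mathrm{big}}(\mathbb G)$ to $\widetilde\lambda^+_{\mathrm{big}}(\mathbb G)$ and $\widehat\lambda^-_{\mathrm{big}}(\mathbb G)$ to $\widetilde\lambda^-_{\mathrm{big}}(\mathbb G)$. In particular, for each sign, $\widehat\lambda^\pm_{\mathrm{big}}(\Lambda)=\widehat\lambda^\pm_{\mathrm{big}}(\mathbb G)$ is zero if and only if $\widetilde\lambda^\pm_{\mathrm{big}}(\mathbb G)$ is zero.
   Context: Grid diagrams. A grid diagram $\mathbb G$ of size $n$ is an $n\times n$ grid of unit squares in $[0,n]\times[0,n]$ with two sets of markings $\mathbb X=\{X_1,\dots,X_n\}$, $\mathbb O=\{O_1,\dots,O_n\}$ placed at centers of squares, such that every row and every column contains exactly one $X$ and exactly one $O$, and no square contains more than one marking. It specifies an oriented link $L(\mathbb G)\subset\mathbb R^3$: draw horizontal segments from the $O$'s to the $X$'s, vertical segments from the $X$'s to the $O$'s, with vertical segments passing over horizontal ones. Let $\ell$ be its number of components. It also specifies an oriented Legendrian link $\Lambda(\mathbb G)$ in $(\mathbb R^3,\xi_{\mathrm{std}})$, $\xi_{\mathrm{std}}=\ker(dz-y\,dx)$, given by its front projection (to the $xz$-plane): in the projection of $L(\mathbb G)$, smooth all northwest and southeast corners, turn northeast and southwest corners into cusps, rotate $45$ degrees clockwise,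 and flip all crossings. $\mathbb G$ represents $\Lambda$ if $\Lambda(\mathbb G)$ is Legendrian isotopic to $\Lambda$. Grid states and rectangles. Identify opposite sides of the grid to get a torus; the grid lines become horizontal circles $\boldsymbol\alpha=\{\alpha_1,\dots,\alpha_n\}$ and vertical circles $\boldsymbol\beta=\{\beta_1,\dots,\beta_n\}$. A grid state is an $n$-tuple $\mathbf x$ of points of the torus with exactly one point on each horizontal circle and one on each vertical circle; $S(\mathbb G)$ is the set of grid states. For $\mathbf x,\mathbf y\in S(\mathbb G)$, $\mathrm{Rect}(\mathbf x,\mathbf y)$ is empty unless $\mathbf x,\mathbf y$ agree in exactly $n-2$ points, in which case it is the set of rectangles $r$ embedded in the torus with $\partial r$ contained in the union of the horizontal and vertical circles, with vertices exactly $\mathbf x\triangle\mathbf y$, and with $\partial(\partial r\cap\boldsymbol\beta)=\mathbf x-\mathbf y$ in the induced orientation. $O_i(r)\in\{0,1\}$ is $1$ iff $O_i\in r$. Complexes. $\mathbb F=\mathbb Z/2$. $GC^-_{\mathrm{big}}(\mathbb G)$ is the free $\mathbb F[V_1,\dots,V_n,v]$-module on $S(\mathbb G)$ with $$\partial(\mathbf x)=\sum_{\mathbf y\in S(\mathbb G)}\ \sum_{r\in\mathrm{Rect}(\mathbf x,\mathbf y),\, r\cap\mathbb X=\emptyset}V_1^{O_1(r)}\cdots V_n^{O_n(r)}\,v^{\#(\mathrm{Int}(r)\cap\mathbf x)}\,\mathbf y.$$ Fix, for each $i=1,\dots,\ell$, an index $k_i$ such that $O_{k_i}$ lies on the $i$-th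 link component. $\widehat{GH}_{\mathrm{big}}(\mathbb G)$ is the homology of $\widehat{GC}_{\mathrm{big}}(\mathbb G)=GC^-_{\mathrm{big}}(\mathbb G)/(V_{k_1},\dots,V_{k_\ell})$. $\widetilde{GH}_{\mathrm{big}}(\mathbb G)$ is the homology of $\widetilde{GC}_{\mathrm{big}}(\mathbb G)=GC^-_{\mathrm{big}}(\mathbb G)/(V_1,\dots,V_n)$, i.e. of the free $\mathbb F[v]$-module on $S(\mathbb G)$ with differential $\mathbf x\mapsto\sum_{\mathbf y}\sum_{r\in\mathrm{Rect}(\mathbf x,\mathbf y),\ r\cap\mathbb X=\emptyset=r\cap\mathbb O}v^{\#(\mathrm{Int}(r)\cap\mathbf x)}\mathbf y$. Both homologies are $\mathbb F[v]$-modules, and "injection" means an injective homomorphism. Canonical classes. $\mathbf x^+(\mathbb G)$ (resp. $\mathbf x^-(\mathbb G)$) is the grid state consisting of the northeast (resp. southwest) corners of the squares containing $X$ markings. These are cycles; $\widehat\lambda^\pm_{\mathrm{big}}(\mathbb G)$ and $\widetilde\lambda^\pm_{\mathrm{big}}(\mathbb G)$ denote the homology classes of $\mathbf x^\pm(\mathbb G)$ in $\widehat{GH}_{\mathrm{big}}(\mathbb G)$ and $\widetilde{GH}_{\mathrm{big}}(\mathbb G)$, respectively. $\widehat\lambda^\pm_{\mathrm{big}}(\Lambda)$ is notation for $\widehat\lambda^\pm_{\mathrm{big}}(\mathbb G)$ when $\mathbb G$ represents $\Lambda$ (this class is an invariant of $\Lambda$ up to isomorphism). *)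

theory Defs
  imports "HOL-Algebra.Module" "HOL-Algebra.AbelCoset" "HOL-Library.Poly_Mapping" "HOL-Library.Z2"
begin

section \<open>Modules: quotients, homomorphisms, homology\<close>

definition quotient_module :: "('r, 'm) module \<Rightarrow> 'm set \<Rightarrow> ('r, 'm set) module" where
  "quotient_module M N =
     \<lparr>carrier = a_rcosets\<^bsub>M\<^esub> N, monoid.mult = undefined, one = undefined,
      zero = N, add = set_add M, smult = (\<lambda>a X. \<Union>x\<in>X. N +>\<^bsub>M\<^esub> (a \<odot>\<^bsub>M\<^esub> x))\<rparr>"

text \<open>The submodule \<open>(A) M\<close> of \<open>M\<close>, where \<open>(A)\<close> is the ideal generated by the set \<open>A\<close> of scalars.\<close>

definition ideal_submodule :: "'r ring \<Rightarrow> 'r set \<Rightarrow> ('r, 'm) module \<Rightarrow> 'm set" where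
  "ideal_submodule R A M =
     \<Inter> {N. submodule N R M \<and> (\<forall>a\<in>A. \<forall>m\<in>carrier M. a \<odot>\<^bsub>M\<^esub> m \<in> N)}"

definition induced_map :: "('r, 'm) module \<Rightarrow> 'm set \<Rightarrow> ('m \<Rightarrow> 'm) \<Rightarrow> 'm set \<Rightarrow> 'm set" where
  "induced_map M N d X = (\<Union>x\<in>X. N +>\<^bsub>M\<^esub> d x)"

definition module_homs ::
    "'r ring \<Rightarrow> ('r, 'm) module \<Rightarrow> ('r, 'k) module \<Rightarrow> ('m \<Rightarrow> 'k) set" where
  "module_homs R M N =
     {f. f \<in> carrier M \<rightarrow> carrier N \<and>
         (\<forall>x\<in>carrier M. \<forall>y\<in>carrier M. f (x \<oplus>\<^bsub>M\<^esub> y) = f x \<oplus>\<^bsub>N\<^esub> f y) \<and>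
         (\<forall>a\<in>carrier R. \<forall>x\<in>carrier M. f (a \<odot>\<^bsub>M\<^esub> x) = a \<odot>\<^bsub>N\<^esub> f x)}"

definition homology :: "('r, 'm) module \<Rightarrow> ('m \<Rightarrow> 'm) \<Rightarrow> ('r, 'm set) module" where
  "homology M d =
     quotient_module (M\<lparr>carrier := {m \<in> carrier M. d m = \<zero>\<^bsub>M\<^esub>}\<rparr>) (d ` carrier M)"

definition homology_class :: "('r, 'm) module \<Rightarrow> ('m \<Rightarrow> 'm) \<Rightarrow> 'm \<Rightarrow> 'm set" where
  "homology_class M d z = d ` carrier M +>\<^bsub>M\<^esub> z"


section \<open>Polynomials over the field with two elements\<close>

text \<open>Variable number \<open>0\<close> plays the role of \<open>v\<close>, variable number \<open>i\<close> with \<open>i \<ge> 1\<close> that of \<open>V\<^sub>i\<close>.\<close>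

type_synonym mpoly = "(nat \<Rightarrow>\<^sub>0 nat) \<Rightarrow>\<^sub>0 bit"

definition mvar :: "nat \<Rightarrow> mpoly" where
  "mvar i = Poly_Mapping.single (Poly_Mapping.single i 1) 1"

definition poly_ring :: "nat set \<Rightarrow> mpoly ring" where
  "poly_ring I =
     \<lparr>carrier = {p. \<forall>m\<in>Poly_Mapping.keys p. Poly_Mapping.keys m \<subseteq> I}, monoid.mult = (*), one = 1, zero = 0, add = (+)\<rparr>"

abbreviation F_v :: "mpoly ring" where
  "F_v \<equiv> poly_ring {0}"


section \<open>Grid diagrams\<close>

text \<open>The square \<open>[c, c + 1] \<times> [r, r + 1]\<close> (column \<open>c\<close>, row \<open>r\<close>) is represented by its southwest
  corner \<open>(c, r)\<close>. The markings are labelled by \<open>{1..n}\<close>.\<close>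

record grid =
  gsize :: nat
  Xpos :: "nat \<Rightarrow> nat \<times> nat"
  Opos :: "nat \<Rightarrow> nat \<times> nat"

definition grid_diagram :: "grid \<Rightarrow> bool" where
  "grid_diagram G \<longleftrightarrow>
     (let n = gsize G in
        0 < n \<and>
        Xpos G ` {1..n} \<subseteq> {..<n} \<times> {..<n} \<and>
        Opos G ` {1..n} \<subseteq> {..<n} \<times> {..<n} \<and>
        (\<forall>c<n. \<exists>!i. i \<in> {1..n} \<and> fst (Xpos G i) = c) \<and>
        (\<forall>r<n. \<exists>!i. i \<in> {1..n} \<and> snd (Xpos G i) = r) \<and>
        (\<forall>c<n. \<exists>!i. i \<in> {1..n} \<and> fst (Opos G i) = c) \<and>
        (\<forall>r<n. \<exists>!i. i \<in> {1..n} \<and> snd (Opos G i) = r) \<and>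
        (\<forall>i\<in>{1..n}. \<forall>j\<in>{1..n}. Xpos G i \<noteq> Opos G j))"

text \<open>The link is a union of oriented segments joining markings. A component is given by the set of
  markings lying on it, i.e. by a connected component of the graph whose edges are the segments.\<close>

datatype marking = XM nat | OM nat

definition markings :: "grid \<Rightarrow> marking set" where
  "markings G = XM ` {1..gsize G} \<union> OM ` {1..gsize G}"

definition link_segments :: "grid \<Rightarrow> (marking \<times> marking) set" where
  "link_segments G =
     {(OM i, XM j) | i j. i \<in> {1..gsize G} \<and> j \<in> {1..gsize G} \<and> snd (Opos G i) = snd (Xpos G j)} \<union>
     {(XM j, OM i) | i j. i \<in> {1..gsize G} \<and> j \<in> {1..gsize G} \<and> fst (Xpos G j) = fst (Opos G i)}"

definition link_components :: "grid \<Rightarrow> marking set set" where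
  "link_components G = markings G // (link_segments G \<union> (link_segments G)\<inverse>)\<^sup>*"


section \<open>Grid states and rectangles\<close>

text \<open>The torus is \<open>(\<real>/n\<int>)\<^sup>2\<close>. The intersection point of the vertical circle at \<open>i\<close> with the horizontal
  circle at \<open>j\<close> is represented by \<open>(i, j)\<close> with \<open>i, j < n\<close>.\<close>

type_synonym state = "(nat \<times> nat) set"

definition grid_states :: "grid \<Rightarrow> state set" where
  "grid_states G =
     {x. x \<subseteq> {..<gsize G} \<times> {..<gsize G} \<and>
         (\<forall>i<gsize G. \<exists>!p. p \<in> x \<and> fst p = i) \<and>
         (\<forall>j<gsize G. \<exists>!p. p \<in> x \<and> snd p = j)}"

definition tor :: "grid \<Rightarrow> nat \<Rightarrow> nat \<Rightarrow> nat \<times> nat" where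
  "tor G i j = (i mod gsize G, j mod gsize G)"

text \<open>\<open>((a, b), (w, h))\<close> stands for the image of \<open>[a, a + w] \<times> [b, b + h]\<close> in the torus, which is
  embedded iff \<open>w, h < n\<close>. With the boundary oriented counterclockwise, its right edge runs upwards
  and its left edge downwards, so that \<open>\<partial>(\<partial>r \<inter> \<beta>) = NE - SE + SW - NW\<close>. Hence \<open>x - y\<close> consists of
  the southwest and northeast corners and \<open>y - x\<close> of the other two.\<close>

type_synonym rect = "(nat \<times> nat) \<times> (nat \<times> nat)"

definition Rect :: "grid \<Rightarrow> state \<Rightarrow> state \<Rightarrow> rect set" where
  "Rect G x y =
     {((a, b), (w, h)) | a b w h.
        a < gsize G \<and> b < gsize G \<and> 0 < w \<and> w < gsize G \<and> 0 < h \<and> h < gsize G \<and>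
        card (x \<inter> y) + 2 = gsize G \<and>
        x - y = {tor G a b, tor G (a + w) (b + h)} \<and>
        y - x = {tor G (a + w) b, tor G a (b + h)}}"

fun rect_squares :: "grid \<Rightarrow> rect \<Rightarrow> (nat \<times> nat) set" where
  "rect_squares G ((a, b), (w, h)) = {tor G (a + i) (b + j) | i j. i < w \<and> j < h}"

fun rect_interior :: "grid \<Rightarrow> rect \<Rightarrow> (nat \<times> nat) set" where
  "rect_interior G ((a, b), (w, h)) =
     {tor G (a + i) (b + j) | i j. 0 < i \<and> i < w \<and> 0 < j \<and> j < h}"

definition Rect_noX :: "grid \<Rightarrow> state \<Rightarrow> state \<Rightarrow> rect set" where
  "Rect_noX G x y = {r \<in> Rect G x y. rect_squares G r \<inter> Xpos G ` {1..gsize G} = {}}"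

definition rect_weight :: "grid \<Rightarrow> state \<Rightarrow> rect \<Rightarrow> mpoly" where
  "rect_weight G x r =
     (\<Prod>i\<in>{1..gsize G}. mvar i ^ of_bool (Opos G i \<in> rect_squares G r)) *
     mvar 0 ^ card (rect_interior G r \<inter> x)"


section \<open>Grid complexes\<close>

type_synonym chain = "state \<Rightarrow> mpoly"

text \<open>There are finitely many grid states, so no finiteness of supports has to be required.\<close>

definition GC_minus :: "grid \<Rightarrow> (mpoly, chain) module" where
  "GC_minus G =
     \<lparr>carrier = {c. (\<forall>x\<in>grid_states G. c x \<in> carrier (poly_ring {0..gsize G})) \<and>
                    (\<forall>x. x \<notin> grid_states G \<longrightarrow> c x = 0)},
      monoid.mult = undefined, one = undefined,
      zero = (\<lambda>_. 0), add = (\<lambda>c d x. c x + d x), smult = (\<lambda>p c x. p * c x)\<rparr>"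

definition generator :: "state \<Rightarrow> chain" where
  "generator x = (\<lambda>y. if y = x then 1 else 0)"

definition boundary :: "grid \<Rightarrow> chain \<Rightarrow> chain" where
  "boundary G c =
     (\<lambda>y. if y \<in> grid_states G
          then \<Sum>x\<in>grid_states G. c x * (\<Sum>r\<in>Rect_noX G x y. rect_weight G x r)
          else 0)"

text \<open>\<open>GC_mod G K\<close> is the quotient of \<open>GC_minus G\<close> by \<open>(V\<^sub>i | i \<in> K)\<close>, with differential
  \<open>boundary_mod G K\<close>. The homology \<open>GH_mod G K\<close> is considered as a module over \<open>F_v\<close>.\<close>

definition V_submodule :: "grid \<Rightarrow> nat set \<Rightarrow> chain set" where
  "V_submodule G K = ideal_submodule (poly_ring {0..gsize G}) (mvar ` K) (GC_minus G)"

definition GC_mod :: "grid \<Rightarrow> nat set \<Rightarrow> (mpoly, chain set) module" where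
  "GC_mod G K = quotient_module (GC_minus G) (V_submodule G K)"

definition boundary_mod :: "grid \<Rightarrow> nat set \<Rightarrow> chain set \<Rightarrow> chain set" where
  "boundary_mod G K = induced_map (GC_minus G) (V_submodule G K) (boundary G)"

definition GH_mod :: "grid \<Rightarrow> nat set \<Rightarrow> (mpoly, chain set set) module" where
  "GH_mod G K = homology (GC_mod G K) (boundary_mod G K)"

definition state_class :: "grid \<Rightarrow> nat set \<Rightarrow> state \<Rightarrow> chain set set" where
  "state_class G K x =
     homology_class (GC_mod G K) (boundary_mod G K)
       (V_submodule G K +>\<^bsub>GC_minus G\<^esub> generator x)"

definition x_plus :: "grid \<Rightarrow> state" where
  "x_plus G = (\<lambda>i. tor G (fst (Xpos G i) + 1) (snd (Xpos G i) + 1)) ` {1..gsize G}"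

definition x_minus :: "grid \<Rightarrow> state" where
  "x_minus G = (\<lambda>i. tor G (fst (Xpos G i)) (snd (Xpos G i))) ` {1..gsize G}"

text \<open>In the hat version, \<open>k 1, \<dots>, k l\<close> are labels of one \<open>O\<close> on each of the \<open>l\<close> link components.\<close>

definition GH_hat :: "grid \<Rightarrow> (nat \<Rightarrow> nat) \<Rightarrow> nat \<Rightarrow> (mpoly, chain set set) module" where
  "GH_hat G k l = GH_mod G (k ` {1..l})"

definition lambda_hat_plus :: "grid \<Rightarrow> (nat \<Rightarrow> nat) \<Rightarrow> nat \<Rightarrow> chain set set" where
  "lambda_hat_plus G k l = state_class G (k ` {1..l}) (x_plus G)"

definition lambda_hat_minus :: "grid \<Rightarrow> (nat \<Rightarrow> nat) \<Rightarrow> nat \<Rightarrow> chain set set" where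
  "lambda_hat_minus G k l = state_class G (k ` {1..l}) (x_minus G)"

definition GH_tilde :: "grid \<Rightarrow> (mpoly, chain set set) module" where
  "GH_tilde G = GH_mod G {1..gsize G}"

definition lambda_tilde_plus :: "grid \<Rightarrow> chain set set" where
  "lambda_tilde_plus G = state_class G {1..gsize G} (x_plus G)"

definition lambda_tilde_minus :: "grid \<Rightarrow> chain set set" where
  "lambda_tilde_minus G = state_class G {1..gsize G} (x_minus G)"

end

theory Submission
  imports Defs "HOL-Combinatorics.Permutations" "HOL-Computational_Algebra.Polynomial"
    "HOL-Library.Function_Algebras"
begin

text \<open>
  Suppose that \<open>O\<^sub>i\<close> and \<open>O\<^sub>j\<close> are the two \<open>O\<close> markings in the row and the column of a marking \<open>X\<^sub>k\<close>,
  and let \<open>H\<close> count the rectangles that contain \<open>X\<^sub>k\<close> but no other \<open>X\<close>. Without the variable \<open>v\<close> one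
  has \<open>\<partial>H + H\<partial> = V\<^sub>i + V\<^sub>j\<close>. For the double-point enhanced complex this fails: a thin annulus
  through \<open>X\<^sub>k\<close> plus an L-shaped domain is a product of two rectangles in one way only, and contributes
  a multiple of \<open>v\<close>. What holds is \<open>\<partial>H + H\<partial> = V\<^sub>i \<alpha> + V\<^sub>j \<beta>\<close>, where \<open>\<alpha>\<close> and \<open>\<beta>\<close> are the identity plus
  maps that count domains free of \<open>X\<close>. Such domains strictly decrease an integer-valued function of
  the state (the area of a domain, corrected by \<open>n\<close> times the number of its \<open>X\<close>, depends
  only on its corners), so \<open>\<alpha>\<close> and \<open>\<beta>\<close> are unitriangular.

  If \<open>j \<in> K\<close> and \<open>i \<notin> K\<close>, then modulo \<open>(V\<^sub>k | k \<in> K)\<close> the map \<open>V\<^sub>i \<alpha>\<close> is null-homotopic. Since \<open>V\<^sub>i\<close> is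
  not a zero divisor, \<open>\<alpha>\<close> is an automorphism of the quotient complex, so \<open>V\<^sub>i\<close> sends cycles to boundaries.
  Hence a cycle that becomes a boundary after also dividing by \<open>V\<^sub>i\<close> was a boundary already:
  from \<open>c = \<partial>b + V\<^sub>i e\<close> one gets \<open>\<partial>e = 0\<close>. Walking along the components of the link adds all the \<open>V\<^sub>i\<close>
  one by one.
\<close>

section \<open>Arcs of the torus and weighted rectangles\<close>

text \<open>The injection is induced by the quotient map between the two complexes, so everything
  comes down to reflecting boundaries: a cycle modulo the smaller ideal that bounds modulo the
  larger one already bounds. An ordered pair of distinct columns determines exactly one rectangle
  leaving a given state, and crossing it composes the permutation with a transposition. Products of
  two rectangles are therefore sorted by how two transpositions meet: disjoint, sharing one column,
  or equal. This analysis is done once, for a matrix in which the marked X has an indeterminate as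
  its weight: the coefficients of degree 0 and 1 of the square of that matrix are \<open>d d\<close>
  and \<open>d H + H d\<close>. The obstacle is that the exponent of \<open>v\<close> depends on the
  state at which a rectangle starts, not on its squares alone. Only the points in the moving columns
  cause this, so they are tracked apart from the multiplicative weights.\<close>

definition arc :: "nat \<Rightarrow> nat \<Rightarrow> nat \<Rightarrow> nat set" where
  "arc n p q = (if p < q then {p..<q} else {p..<n} \<union> {..<q})"

text \<open>The strict cyclic order on a circle. The disjuncts are the rotations of one chain, so
  wrapping around the torus needs no separate treatment.\<close>

definition cyc :: "nat \<Rightarrow> nat \<Rightarrow> nat \<Rightarrow> bool" where
  "cyc p q r \<longleftrightarrow> p < q \<and> q < r \<or> q < r \<and> r < p \<or> r < p \<and> p < q"

lemma cyc_rotate: "cyc p q r \<Longrightarrow> cyc q r p"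
  by (auto simp: cyc_def)

lemma cyc_total: "p \<noteq> q \<Longrightarrow> q \<noteq> r \<Longrightarrow> r \<noteq> p \<Longrightarrow> cyc p q r \<or> cyc p r q"
  by (auto simp: cyc_def)

lemma arc_subset: "q \<le> n \<Longrightarrow> arc n p q \<subseteq> {..<n}"
  by (auto simp: arc_def)

lemma finite_arc [simp]: "finite (arc n p q)"
  by (simp add: arc_def)

lemma arc_start: "p < n \<Longrightarrow> p \<in> arc n p q"
  by (auto simp: arc_def)

lemma arc_end: "p \<noteq> q \<Longrightarrow> q \<notin> arc n p q"
  by (auto simp: arc_def)

lemma arc_complement:
  assumes "p < n" "q < n" "p \<noteq> q"
  shows "arc n p q \<union> arc n q p = {..<n}" "arc n p q \<inter> arc n q p = {}"
  using assms by (auto simp: arc_def)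

lemma cyc_arcs:
  assumes "cyc p q r" "p < n" "q < n" "r < n"
  shows "arc n p r = arc n p q \<union> arc n q r" "arc n q p = arc n q r \<union> arc n r p"
    "arc n r q = arc n r p \<union> arc n p q"
    "arc n p q \<inter> arc n q r = {}" "arc n q r \<inter> arc n r p = {}" "arc n r p \<inter> arc n p q = {}"
    "arc n p q \<union> arc n q r \<union> arc n r p = {..<n}"
  using assms unfolding cyc_def arc_def by (elim disjE conjE; simp; auto)+

lemma cyc_mem:
  assumes "cyc p q r" "p < n" "q < n" "r < n"
  shows "p \<in> arc n p q" "p \<notin> arc n q r" "p \<notin> arc n r p"
    "q \<notin> arc n p q" "q \<in> arc n q r" "q \<notin> arc n r p"
    "r \<notin> arc n p q" "r \<notin> arc n q r" "r \<in> arc n r p"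
    "p \<noteq> q" "q \<noteq> r" "p \<noteq> r"
  using assms unfolding cyc_def arc_def by (elim disjE conjE; simp)+

lemma mem_arc_cyc: "x < n \<Longrightarrow> x \<noteq> p \<Longrightarrow> x \<noteq> q \<Longrightarrow> p \<noteq> q \<Longrightarrow>  x \<in> arc n p q \<longleftrightarrow> cyc p x q"
 by (auto simp: arc_def cyc_def)
text \<open>Sorted by arc, this equates two differences. Each vanishes unless the two pairs separate
  each other on the circle, and then both have the same sign. It balances the exponents of
  \<open>v\<close> when rectangles without common columns are interchanged.\<close>

lemma arc_interlace:
  assumes "distinct [p, q, p', q']" "p < n" "q < n" "p' < n" "q' < n"
  shows "of_bool (p' \<in> arc n p q) + of_bool (p \<in> arc n p' q') =
    (of_bool (q' \<in> arc n p q) + of_bool (q \<in> arc n p' q') :: int)"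
proof -
  have ne: "p \<noteq> q" "p' \<noteq> q'" "p \<noteq> p'" "p \<noteq> q'" "q \<noteq> p'" "q \<noteq> q'" using assms by auto
  then show ?thesis using assms by (simp add: mem_arc_cyc cyc_def del: distinct.simps)
qed

text \<open>The weights of squares stay arbitrary, so that an indeterminate can be put on one of
  them later. Characteristic 2 serves to cancel equal products of rectangles in pairs.\<close>

locale torus_weights =
  fixes n :: nat and w :: "nat \<times> nat \<Rightarrow> 'a :: comm_ring_1" and v :: 'a
  assumes char2: "\<And>x :: 'a. x + x = 0"
begin

text \<open>
  A state is given by a permutation \<open>\<sigma>\<close> of the columns. A rectangle starting at \<open>\<sigma>\<close> is determined by the
  pair of the columns of its southwest and northeast corners, and leads to \<open>swap_cols\<close>.
\<close>

definition box_squares :: "(nat \<Rightarrow> nat) \<Rightarrow> nat \<times> nat \<Rightarrow> (nat \<times> nat) set" where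
  "box_squares \<sigma> P = arc n (fst P) (snd P) \<times> arc n (\<sigma> (fst P)) (\<sigma> (snd P))"

text \<open>Arcs contain their start and omit their end, so deleting both starts leaves the
  positions strictly inside the rectangle.\<close>

definition box_points :: "(nat \<Rightarrow> nat) \<Rightarrow> nat \<times> nat \<Rightarrow> nat set" where
  "box_points \<sigma> P = {c \<in> arc n (fst P) (snd P) - {fst P}.
     \<sigma> c \<in> arc n (\<sigma> (fst P)) (\<sigma> (snd P)) - {\<sigma> (fst P)}}"

definition box_weight :: "(nat \<Rightarrow> nat) \<Rightarrow> nat \<times> nat \<Rightarrow> 'a" where
  "box_weight \<sigma> P = prod w (box_squares \<sigma> P) * v ^ card (box_points \<sigma> P)"

definition swap_cols :: "(nat \<Rightarrow> nat) \<Rightarrow> nat \<times> nat \<Rightarrow> nat \<Rightarrow> nat" where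
  "swap_cols \<sigma> P = \<sigma> \<circ> transpose (fst P) (snd P)"

definition col_pairs :: "(nat \<times> nat) set" where
  "col_pairs = {(p, q). p < n \<and> q < n \<and> p \<noteq> q}"

definition pair_weight :: "(nat \<Rightarrow> nat) \<Rightarrow> nat \<times> nat \<Rightarrow> nat \<times> nat \<Rightarrow> 'a" where
  "pair_weight \<sigma> P P' = box_weight \<sigma> P * box_weight (swap_cols \<sigma> P) P'"

text \<open>
  The points of \<open>\<sigma>\<close> outside the columns in \<open>T\<close> act like weights of squares, which makes this
  multiplicative in \<open>I\<close> and \<open>J\<close>; only the points in the columns \<open>T\<close> have to be treated separately.
\<close>

definition block :: "(nat \<Rightarrow> nat) \<Rightarrow> nat set \<Rightarrow> nat set \<Rightarrow> nat set \<Rightarrow> 'a" where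
  "block \<sigma> T I J = prod w (I \<times> J) * v ^ card {c \<in> I - T. \<sigma> c \<in> J}"

lemma block_Un1:
  assumes "finite I" "finite I'" "finite J" "I \<inter> I' = {}"
  shows "block \<sigma> T (I \<union> I') J = block \<sigma> T I J * block \<sigma> T I' J"
proof -
  have 1: "(I \<union> I') \<times> J = I \<times> J \<union> I' \<times> J" "I \<times> J \<inter> I' \<times> J = {}" using assms by auto
  have 2: "{c \<in> (I \<union> I') - T. \<sigma> c \<in> J} = {c \<in> I - T. \<sigma> c \<in> J} \<union> {c \<in> I' - T. \<sigma> c \<in> J}"
    "{c \<in> I - T. \<sigma> c \<in> J} \<inter> {c \<in> I' - T. \<sigma> c \<in> J} = {}" using assms by auto
  show ?thesis unfolding block_def 1(1) 2(1)
    using assms 1(2) 2(2) by (simp add: prod.union_disjoint card_Un_disjoint power_add mult_ac)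
qed

lemma block_Un2:
  assumes "finite I" "finite J" "finite J'" "J \<inter> J' = {}"
  shows "block \<sigma> T I (J \<union> J') = block \<sigma> T I J * block \<sigma> T I J'"
proof -
  have 1: "I \<times> (J \<union> J') = I \<times> J \<union> I \<times> J'" "I \<times> J \<inter> I \<times> J' = {}" using assms by auto
  have 2: "{c \<in> I - T. \<sigma> c \<in> J \<union> J'} = {c \<in> I - T. \<sigma> c \<in> J} \<union> {c \<in> I - T. \<sigma> c \<in> J'}"
    "{c \<in> I - T. \<sigma> c \<in> J} \<inter> {c \<in> I - T. \<sigma> c \<in> J'} = {}" using assms by auto
  show ?thesis unfolding block_def 1(1) 2(1)
    using assms 1(2) 2(2) by (simp add: prod.union_disjoint card_Un_disjoint power_add mult_ac)
qed

text \<open>\<open>\<rho>\<close> may be the state before or after a swap within \<open>T\<close>.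
  Points in other columns are the same for both, so the weights of successive rectangles become
  blocks of one fixed \<open>\<sigma>\<close> and can be compared.\<close>

lemma box_weight_block:
  assumes T: "p \<in> T" "q \<in> T" "T \<subseteq> {..<n}" "finite T"
    and \<rho>: "inj_on \<rho> {..<n}" "\<And>c. c \<notin> T \<Longrightarrow> \<rho> c = \<sigma> c" and "p \<noteq> q"
  shows "box_weight \<rho> (p, q) = block \<sigma> T (arc n p q) (arc n (\<rho> p) (\<rho> q)) *
    v ^ card {c \<in> T - {p, q}. c \<in> arc n p q \<and> \<rho> c \<in> arc n (\<rho> p) (\<rho> q)}"
proof -
  have q: "q < n" "p < n" using T by auto
  have sub: "arc n p q \<subseteq> {..<n}" using q by (intro arc_subset) simp
  have ne: "\<rho> c \<noteq> \<rho> p" if "c \<in> arc n p q" "c \<noteq> p" for c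
    using that \<rho>(1) q sub by (auto simp: inj_on_eq_iff subset_iff)
  have "box_points \<rho> (p, q) = {c \<in> arc n p q - T. \<sigma> c \<in> arc n (\<rho> p) (\<rho> q)} \<union>
    {c \<in> T - {p, q}. c \<in> arc n p q \<and> \<rho> c \<in> arc n (\<rho> p) (\<rho> q)}" (is "_ = ?A \<union> ?B")
    using ne T \<rho>(2) arc_end[OF \<open>p \<noteq> q\<close>] by (auto simp: box_points_def)
  moreover have "?A \<inter> ?B = {}" "finite ?A" "finite ?B" using T by auto
  ultimately have "card (box_points \<rho> (p, q)) = card ?A + card ?B"
    by (simp add: card_Un_disjoint)
  then show ?thesis
    by (simp add: box_weight_def block_def box_squares_def power_add mult_ac)
qed

lemma box_weight_triple:
  assumes "distinct [p, q, r]" "p < n" "q < n" "r < n" "T = {p, q, r}"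
    and \<rho>: "inj_on \<rho> {..<n}" "\<And>c. c \<notin> T \<Longrightarrow> \<rho> c = \<sigma> c"
  shows "box_weight \<rho> (p, q) = block \<sigma> T (arc n p q) (arc n (\<rho> p) (\<rho> q)) *
    (if r \<in> arc n p q \<and> \<rho> r \<in> arc n (\<rho> p) (\<rho> q) then v else 1)"
proof -
  have "{c \<in> T - {p, q}. c \<in> arc n p q \<and> \<rho> c \<in> arc n (\<rho> p) (\<rho> q)} =
    (if r \<in> arc n p q \<and> \<rho> r \<in> arc n (\<rho> p) (\<rho> q) then {r} else {})"
    using assms(1,5) by auto
  moreover have "box_weight \<rho> (p, q) = block \<sigma> T (arc n p q) (arc n (\<rho> p) (\<rho> q)) *
    v ^ card {c \<in> T - {p, q}. c \<in> arc n p q \<and> \<rho> c \<in> arc n (\<rho> p) (\<rho> q)}"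
    by (rule box_weight_block[OF _ _ _ _ \<rho>]) (use assms(1-5) in auto)
  ultimately show ?thesis by (simp split: if_splits)
qed

lemma swap_cols_permutes: "\<sigma> permutes {..<n} \<Longrightarrow> p < n \<Longrightarrow> q < n \<Longrightarrow> swap_cols \<sigma> (p, q) permutes {..<n}"
  unfolding swap_cols_def by (intro permutes_compose[of _ _ \<sigma>] permutes_swap_id) auto

text \<open>Both \<open>a\<close>, \<open>b\<close>, \<open>c\<close> and \<open>a'\<close>,
  \<open>b'\<close>, \<open>c'\<close> enumerate \<open>T\<close> in any order, so that each of the
  twelve pairs of rectangles is an instance. Apart from the blocks, only the third column can
  contribute a factor \<open>v\<close>.\<close>

lemma pair_weight_triple:
  assumes \<sigma>: "\<sigma> permutes {..<n}" and T: "T = {p, q, r}" "distinct [p, q, r]" "T \<subseteq> {..<n}"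
    and abc: "a \<in> T" "b \<in> T" "c \<in> T" "a \<noteq> b" "b \<noteq> c" "c \<noteq> a"
    and abc': "a' \<in> T" "b' \<in> T" "c' \<in> T" "a' \<noteq> b'" "b' \<noteq> c'" "c' \<noteq> a'"
    and \<rho>: "\<rho> = \<sigma> \<circ> transpose a b"
  shows "pair_weight \<sigma> (a, b) (a', b') =
    block \<sigma> T (arc n a b) (arc n (\<sigma> a) (\<sigma> b)) *
    (if c \<in> arc n a b \<and> \<sigma> c \<in> arc n (\<sigma> a) (\<sigma> b) then v else 1) *
    (block \<sigma> T (arc n a' b') (arc n (\<rho> a') (\<rho> b')) *
    (if c' \<in> arc n a' b' \<and> \<rho> c' \<in> arc n (\<rho> a') (\<rho> b') then v else 1))"
proof -
  have ab: "{a, b, c} = T" "distinct [a, b, c]" using abc T by auto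
  have ab': "{a', b', c'} = T" "distinct [a', b', c']" using abc' T by auto
  have lt: "a < n" "b < n" "c < n" "a' < n" "b' < n" "c' < n" using T ab ab' by auto
  have \<rho>p: "swap_cols \<sigma> (a, b) = \<rho>" "\<rho> permutes {..<n}"
    using swap_cols_permutes[OF \<sigma>, of a b] lt by (simp_all add: swap_cols_def \<rho>)
  have 1: "\<rho> d = \<sigma> d" if "d \<notin> T" for d
    using that ab(1) unfolding \<rho> by (metis comp_apply insertCI transpose_apply_other)
  show ?thesis
    unfolding pair_weight_def \<rho>p
    using box_weight_triple[OF ab(2) lt(1-3) ab(1)[symmetric], of \<sigma> \<sigma>] permutes_inj_on[OF \<sigma>]
      box_weight_triple[OF ab'(2) lt(4-6) ab'(1)[symmetric], of \<rho> \<sigma>] permutes_inj_on[OF \<rho>p(2)] 1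
    by simp
qed

end


section \<open>Pairs of rectangles with one common column\<close>

context torus_weights
begin

text \<open>The inclusions are strict so that a square remains when the annulus of width one is
  removed; this later forces a strict drop of the potential. \<open>D\<close> forgets
  multiplicities, which return through the intersection of the rectangles.\<close>

definition covers_annulus :: "(nat \<Rightarrow> nat) \<Rightarrow> nat \<times> nat \<Rightarrow> nat \<times> nat \<Rightarrow> bool" where
  "covers_annulus \<sigma> P P' \<longleftrightarrow>
     (let D = box_squares \<sigma> P \<union> box_squares (swap_cols \<sigma> P) P' in
      (\<exists>i<n. {i} \<times> {..<n} \<subset> D) \<or> (\<exists>j<n. {..<n} \<times> {j} \<subset> D))"

text \<open>The column \<open>i\<close> lies over both rectangles, whose row arcs cover the circle;
  the column \<open>i'\<close> provides a square outside the annulus.\<close>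

lemma covers_annulusI1:
  assumes "i < n" "i \<in> arc n p q" "i \<in> arc n p' q'" "i' \<in> arc n p q \<union> arc n p' q'" "i' \<noteq> i"
    and "\<sigma> p < n" "\<rho> p' < n" "\<rho> = swap_cols \<sigma> (p, q)"
    and "arc n (\<sigma> p) (\<sigma> q) \<union> arc n (\<rho> p') (\<rho> q') = {..<n}"
  shows "covers_annulus \<sigma> (p, q) (p', q')"
proof -
  let ?D = "box_squares \<sigma> (p, q) \<union> box_squares \<rho> (p', q')"
  have "{i} \<times> {..<n} \<subseteq> ?D"
    using assms(2,3) unfolding assms(9)[symmetric] by (auto simp: box_squares_def)
  moreover have "(i', \<sigma> p) \<in> ?D \<or> (i', \<rho> p') \<in> ?D"
    using assms(4,6,7) by (auto simp: box_squares_def arc_start)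
  then have "{i} \<times> {..<n} \<noteq> ?D" using assms(5) by blast
  ultimately show ?thesis unfolding covers_annulus_def Let_def using assms(1,8) by blast
qed

lemma covers_annulusI2:
  assumes "j < n" "j \<in> arc n (\<sigma> p) (\<sigma> q)" "j \<in> arc n (\<rho> p') (\<rho> q')"
    and "j' \<in> arc n (\<sigma> p) (\<sigma> q) \<union> arc n (\<rho> p') (\<rho> q')" "j' \<noteq> j"
    and "p < n" "p' < n" "\<rho> = swap_cols \<sigma> (p, q)"
    and "arc n p q \<union> arc n p' q' = {..<n}"
  shows "covers_annulus \<sigma> (p, q) (p', q')"
proof -
  let ?D = "box_squares \<sigma> (p, q) \<union> box_squares \<rho> (p', q')"
  have "{..<n} \<times> {j} \<subseteq> ?D"
    using assms(2,3) unfolding assms(9)[symmetric] by (auto simp: box_squares_def)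
  moreover have "(p, j') \<in> ?D \<or> (p', j') \<in> ?D"
    using assms(4,6,7) by (auto simp: box_squares_def arc_start)
  then have "{..<n} \<times> {j} \<noteq> ?D" using assms(5) by blast
  ultimately show ?thesis unfolding covers_annulus_def Let_def using assms(1,8) by blast
qed

context
  fixes \<sigma> p q r
  assumes \<sigma>: "\<sigma> permutes {..<n}" and lt: "p < n" "q < n" "r < n"
begin

lemma image_less: "\<sigma> p < n" "\<sigma> q < n" "\<sigma> r < n"
  using permutes_in_image[OF \<sigma>] lt by auto

text \<open>The suffixes of this lemma and the next three give the cyclic order of the columns, then
  that of the rows. Each equation compares the two ways of cutting one L-shaped hexagon into
  rectangles. Rotating \<open>p\<close>, \<open>q\<close>, \<open>r\<close> in the three claims
  accounts for all twelve pairs.\<close>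

lemma pair_weights_pqr_pqr:
  assumes c: "cyc p q r" and d: "cyc (\<sigma> p) (\<sigma> q) (\<sigma> r)"
  shows "pair_weight \<sigma> (p, q) (p, r) = pair_weight \<sigma> (q, r) (p, q)"
    and "covers_annulus \<sigma> (q, p) (p, r)" and "covers_annulus \<sigma> (q, p) (r, p)"
proof -
  note lc = lt and ld = image_less
  note mem = cyc_mem[OF c lc] cyc_mem[OF d ld] cyc_mem(10-12)[OF c lc, symmetric]
    cyc_mem(10-12)[OF d ld, symmetric]
  note arcs = cyc_arcs(1-3)[OF c lc] cyc_arcs(1-3)[OF d ld]
  note disj = cyc_arcs(4-6)[OF c lc] cyc_arcs(4-6)[OF d ld]
  note disj' = disj disj[THEN trans[OF Int_commute]]
  have T: "distinct [p, q, r]" "{p, q, r} \<subseteq> {..<n}" using lt by (simp_all add: mem)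
  note pw = pair_weight_triple[OF \<sigma> refl T _ _ _ _ _ _ _ _ _ _ _ _ refl]
  \<comment> \<open>Splitting every arc into arcs between neighbouring corners turns both sides into
    the same product of blocks.\<close>
  show "pair_weight \<sigma> (p, q) (p, r) = pair_weight \<sigma> (q, r) (p, q)"
    by (simp add: pw[where c = r and c' = q] pw[where c = p and c' = r] mem arcs
      block_Un1 block_Un2 Int_Un_distrib Int_Un_distrib2 disj' mult_ac)
  show "covers_annulus \<sigma> (q, p) (p, r)"
    by (rule covers_annulusI2[OF _ _ _ _ _ _ _ refl, where j = "\<sigma> q" and j' = "\<sigma> r"])
      (simp_all add: lt image_less mem swap_cols_def arcs cyc_arcs(7)[OF c lc, symmetric] Un_ac)
  show "covers_annulus \<sigma> (q, p) (r, p)"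
    by (rule covers_annulusI1[OF _ _ _ _ _ _ _ refl, where i = "r" and i' = "q"])
      (simp_all add: lt image_less mem swap_cols_def arcs cyc_arcs(7)[OF d ld, symmetric] Un_ac)
qed

lemma pair_weights_pqr_prq:
  assumes c: "cyc p q r" and d: "cyc (\<sigma> p) (\<sigma> r) (\<sigma> q)"
  shows "pair_weight \<sigma> (p, q) (r, p) = pair_weight \<sigma> (r, q) (p, q)"
    and "covers_annulus \<sigma> (p, q) (p, r)" and "covers_annulus \<sigma> (q, p) (p, r)"
proof -
  note lc = lt and ld = image_less(1,3,2)
  note mem = cyc_mem[OF c lc] cyc_mem[OF d ld] cyc_mem(10-12)[OF c lc, symmetric]
    cyc_mem(10-12)[OF d ld, symmetric]
  note arcs = cyc_arcs(1-3)[OF c lc] cyc_arcs(1-3)[OF d ld]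
  note disj = cyc_arcs(4-6)[OF c lc] cyc_arcs(4-6)[OF d ld]
  note disj' = disj disj[THEN trans[OF Int_commute]]
  have T: "distinct [p, q, r]" "{p, q, r} \<subseteq> {..<n}" using lt by (simp_all add: mem)
  note pw = pair_weight_triple[OF \<sigma> refl T _ _ _ _ _ _ _ _ _ _ _ _ refl]
  show "pair_weight \<sigma> (p, q) (r, p) = pair_weight \<sigma> (r, q) (p, q)"
    by (simp add: pw[where c = r and c' = q] pw[where c = p and c' = r] mem arcs
      block_Un1 block_Un2 Int_Un_distrib Int_Un_distrib2 disj' mult_ac)
  show "covers_annulus \<sigma> (p, q) (p, r)"
    by (rule covers_annulusI1[OF _ _ _ _ _ _ _ refl, where i = "p" and i' = "q"])
      (simp_all add: lt image_less mem swap_cols_def arcs cyc_arcs(7)[OF d ld, symmetric] Un_ac)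
  show "covers_annulus \<sigma> (q, p) (p, r)"
    by (rule covers_annulusI2[OF _ _ _ _ _ _ _ refl, where j = "\<sigma> q" and j' = "\<sigma> p"])
      (simp_all add: lt image_less mem swap_cols_def arcs cyc_arcs(7)[OF c lc, symmetric] Un_ac)
qed

lemma pair_weights_prq_pqr:
  assumes c: "cyc p r q" and d: "cyc (\<sigma> p) (\<sigma> q) (\<sigma> r)"
  shows "pair_weight \<sigma> (p, q) (p, r) = pair_weight \<sigma> (p, r) (r, q)"
    and "covers_annulus \<sigma> (p, q) (r, p)" and "covers_annulus \<sigma> (q, p) (r, p)"
proof -
  note lc = lt(1,3,2) and ld = image_less
  note mem = cyc_mem[OF c lc] cyc_mem[OF d ld] cyc_mem(10-12)[OF c lc, symmetric]
    cyc_mem(10-12)[OF d ld, symmetric]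
  note arcs = cyc_arcs(1-3)[OF c lc] cyc_arcs(1-3)[OF d ld]
  note disj = cyc_arcs(4-6)[OF c lc] cyc_arcs(4-6)[OF d ld]
  note disj' = disj disj[THEN trans[OF Int_commute]]
  have T: "distinct [p, q, r]" "{p, q, r} \<subseteq> {..<n}" using lt by (simp_all add: mem)
  note pw = pair_weight_triple[OF \<sigma> refl T _ _ _ _ _ _ _ _ _ _ _ _ refl]
  show "pair_weight \<sigma> (p, q) (p, r) = pair_weight \<sigma> (p, r) (r, q)"
    by (simp add: pw[where c = r and c' = q] pw[where c = q and c' = p] mem arcs
      block_Un1 block_Un2 Int_Un_distrib Int_Un_distrib2 disj' mult_ac)
  show "covers_annulus \<sigma> (p, q) (r, p)"
    by (rule covers_annulusI2[OF _ _ _ _ _ _ _ refl, where j = "\<sigma> p" and j' = "\<sigma> r"])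
      (simp_all add: lt image_less mem swap_cols_def arcs cyc_arcs(7)[OF c lc, symmetric] Un_ac)
  show "covers_annulus \<sigma> (q, p) (r, p)"
    by (rule covers_annulusI1[OF _ _ _ _ _ _ _ refl, where i = "q" and i' = "r"])
      (simp_all add: lt image_less mem swap_cols_def arcs cyc_arcs(7)[OF d ld, symmetric] Un_ac)
qed

lemma pair_weights_prq_prq:
  assumes c: "cyc p r q" and d: "cyc (\<sigma> p) (\<sigma> r) (\<sigma> q)"
  shows "pair_weight \<sigma> (q, p) (p, r) = pair_weight \<sigma> (p, r) (q, r)"
    and "covers_annulus \<sigma> (p, q) (p, r)" and "covers_annulus \<sigma> (p, q) (r, p)"
proof -
  note lc = lt(1,3,2) and ld = image_less(1,3,2)
  note mem = cyc_mem[OF c lc] cyc_mem[OF d ld] cyc_mem(10-12)[OF c lc, symmetric]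
    cyc_mem(10-12)[OF d ld, symmetric]
  note arcs = cyc_arcs(1-3)[OF c lc] cyc_arcs(1-3)[OF d ld]
  note disj = cyc_arcs(4-6)[OF c lc] cyc_arcs(4-6)[OF d ld]
  note disj' = disj disj[THEN trans[OF Int_commute]]
  have T: "distinct [p, q, r]" "{p, q, r} \<subseteq> {..<n}" using lt by (simp_all add: mem)
  note pw = pair_weight_triple[OF \<sigma> refl T _ _ _ _ _ _ _ _ _ _ _ _ refl]
  show "pair_weight \<sigma> (q, p) (p, r) = pair_weight \<sigma> (p, r) (q, r)"
    by (simp add: pw[where c = r and c' = q] pw[where c = q and c' = p] mem arcs
      block_Un1 block_Un2 Int_Un_distrib Int_Un_distrib2 disj' mult_ac)
  show "covers_annulus \<sigma> (p, q) (p, r)"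
    by (rule covers_annulusI1[OF _ _ _ _ _ _ _ refl, where i = "p" and i' = "r"])
      (simp_all add: lt image_less mem swap_cols_def arcs cyc_arcs(7)[OF d ld, symmetric] Un_ac)
  show "covers_annulus \<sigma> (p, q) (r, p)"
    by (rule covers_annulusI2[OF _ _ _ _ _ _ _ refl, where j = "\<sigma> r" and j' = "\<sigma> p"])
      (simp_all add: lt image_less mem swap_cols_def arcs cyc_arcs(7)[OF c lc, symmetric] Un_ac)
qed

end

text \<open>
  Any 3-cycle of columns arises from twelve pairs of rectangles. Depending on the two cyclic orders,
  six of them cancel in pairs, and the domain of each of the other six contains a whole row or column.
\<close>

definition triple_pairs :: "nat \<Rightarrow> nat \<Rightarrow> nat \<Rightarrow> ((nat \<times> nat) \<times> (nat \<times> nat)) set" where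
  "triple_pairs p q r = {(p, q), (q, p)} \<times> {(p, r), (r, p)}"

lemma add_cancel_char2: "(x + x) + y = (y :: 'a)"
  by (simp add: char2)

text \<open>\<open>\<G>\<close> is kept abstract: of the six annular terms only membership in a set
  closed under addition is asked.\<close>

lemma sum_triple_pairs:
  assumes \<sigma>: "\<sigma> permutes {..<n}" and lt: "p < n" "q < n" "r < n" and ne: "p \<noteq> q" "q \<noteq> r" "r \<noteq> p"
    and G0: "\<And>x y. x \<in> \<G> \<Longrightarrow> y \<in> \<G> \<Longrightarrow> x + y \<in> \<G>"
    and bad: "\<And>P P'. covers_annulus \<sigma> P P' \<Longrightarrow>
      (P, P') \<in> triple_pairs p q r \<union> triple_pairs q r p \<union> triple_pairs r p q \<Longrightarrow> pair_weight \<sigma> P P' \<in> \<G>"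
  shows "(\<Sum>(P, P') \<in> triple_pairs p q r \<union> triple_pairs q r p \<union> triple_pairs r p q. pair_weight \<sigma> P P') \<in> \<G>"
proof -
  have ne': "\<sigma> p \<noteq> \<sigma> q" "\<sigma> q \<noteq> \<sigma> r" "\<sigma> r \<noteq> \<sigma> p"
    using ne permutes_inj[OF \<sigma>] by (simp_all add: inj_eq)
  note ne2 = ne ne[symmetric]
  let ?W = "pair_weight \<sigma>"
  have sum: "(\<Sum>(P, P') \<in> triple_pairs p q r \<union> triple_pairs q r p \<union> triple_pairs r p q. ?W P P') =
    ?W (p, q) (p, r) + ?W (p, q) (r, p) + ?W (q, p) (p, r) + ?W (q, p) (r, p) +
    (?W (q, r) (q, p) + ?W (q, r) (p, q) + ?W (r, q) (q, p) + ?W (r, q) (p, q)) +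
    (?W (r, p) (r, q) + ?W (r, p) (q, r) + ?W (p, r) (r, q) + ?W (p, r) (q, r))" (is "_ = ?S")
    by (simp add: triple_pairs_def ne2 add_ac)
  note bad' = bad[unfolded triple_pairs_def]
  consider "cyc p q r" "cyc (\<sigma> p) (\<sigma> q) (\<sigma> r)" | "cyc p q r" "cyc (\<sigma> p) (\<sigma> r) (\<sigma> q)"
    | "cyc p r q" "cyc (\<sigma> p) (\<sigma> q) (\<sigma> r)" | "cyc p r q" "cyc (\<sigma> p) (\<sigma> r) (\<sigma> q)"
    using cyc_total[OF ne] cyc_total[OF ne'] by blast
  then have "?S \<in> \<G>"
  proof cases
    case 1
    note e = pair_weights_pqr_pqr[OF \<sigma> lt 1(1) 1(2)]
      pair_weights_pqr_pqr[OF \<sigma> lt(2,3,1) 1(1)[THEN cyc_rotate] 1(2)[THEN cyc_rotate]]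
      pair_weights_pqr_pqr[OF \<sigma> lt(3,1,2) 1(1)[THEN cyc_rotate, THEN cyc_rotate] 1(2)[THEN cyc_rotate, THEN cyc_rotate]]
    \<comment> \<open>Rewriting with \<open>e(1,4,7)\<close> makes three terms occur twice. They
      cancel in characteristic 2, and the six annular terms remain.\<close>
    have "?S = (?W (p, q) (p, r) + ?W (p, q) (p, r)) + ((?W (q, r) (q, p) + ?W (q, r) (q, p)) + ((?W (r, p) (r, q) + ?W (r, p) (r, q)) +
      (?W (q, p) (p, r) + ?W (q, p) (r, p) + ?W (r, q) (q, p) +
      ?W (r, q) (p, q) + ?W (p, r) (r, q) + ?W (p, r) (q, r))))"
      by (simp only: e(1,4,7) add_ac)
    also have "\<dots> \<in> \<G>"
      unfolding add_cancel_char2 by (intro G0 bad' e) simp_all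
    finally show ?thesis .
  next
    case 2
    note e = pair_weights_pqr_prq[OF \<sigma> lt 2(1) 2(2)]
      pair_weights_pqr_prq[OF \<sigma> lt(2,3,1) 2(1)[THEN cyc_rotate] 2(2)[THEN cyc_rotate, THEN cyc_rotate]]
      pair_weights_pqr_prq[OF \<sigma> lt(3,1,2) 2(1)[THEN cyc_rotate, THEN cyc_rotate] 2(2)[THEN cyc_rotate]]
    have "?S = (?W (p, q) (r, p) + ?W (p, q) (r, p)) + ((?W (q, r) (p, q) + ?W (q, r) (p, q)) + ((?W (r, p) (q, r) + ?W (r, p) (q, r)) +
      (?W (p, q) (p, r) + ?W (q, p) (p, r) + ?W (q, r) (q, p) +
      ?W (r, q) (q, p) + ?W (r, p) (r, q) + ?W (p, r) (r, q))))"
      by (simp only: e(1,4,7) add_ac)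
    also have "\<dots> \<in> \<G>"
      unfolding add_cancel_char2 by (intro G0 bad' e) simp_all
    finally show ?thesis .
  next
    case 3
    note e = pair_weights_prq_pqr[OF \<sigma> lt 3(1) 3(2)]
      pair_weights_prq_pqr[OF \<sigma> lt(2,3,1) 3(1)[THEN cyc_rotate, THEN cyc_rotate] 3(2)[THEN cyc_rotate]]
      pair_weights_prq_pqr[OF \<sigma> lt(3,1,2) 3(1)[THEN cyc_rotate] 3(2)[THEN cyc_rotate, THEN cyc_rotate]]
    have "?S = (?W (p, q) (p, r) + ?W (p, q) (p, r)) + ((?W (q, r) (q, p) + ?W (q, r) (q, p)) + ((?W (r, p) (r, q) + ?W (r, p) (r, q)) +
      (?W (p, q) (r, p) + ?W (q, p) (r, p) + ?W (q, r) (p, q) +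
      ?W (r, q) (p, q) + ?W (r, p) (q, r) + ?W (p, r) (q, r))))"
      by (simp only: e(1,4,7) add_ac)
    also have "\<dots> \<in> \<G>"
      unfolding add_cancel_char2 by (intro G0 bad' e) simp_all
    finally show ?thesis .
  next
    case 4
    note e = pair_weights_prq_prq[OF \<sigma> lt 4(1) 4(2)]
      pair_weights_prq_prq[OF \<sigma> lt(2,3,1) 4(1)[THEN cyc_rotate, THEN cyc_rotate] 4(2)[THEN cyc_rotate, THEN cyc_rotate]]
      pair_weights_prq_prq[OF \<sigma> lt(3,1,2) 4(1)[THEN cyc_rotate] 4(2)[THEN cyc_rotate]]
    have "?S = (?W (q, p) (p, r) + ?W (q, p) (p, r)) + ((?W (r, q) (q, p) + ?W (r, q) (q, p)) + ((?W (p, r) (r, q) + ?W (p, r) (r, q)) +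
      (?W (p, q) (p, r) + ?W (p, q) (r, p) + ?W (q, r) (q, p) +
      ?W (q, r) (p, q) + ?W (r, p) (r, q) + ?W (r, p) (q, r))))"
      by (simp only: e(1,4,7) add_ac)
    also have "\<dots> \<in> \<G>"
      unfolding add_cancel_char2 by (intro G0 bad' e) simp_all
    finally show ?thesis .
  qed
  then show ?thesis unfolding sum .
qed

end


section \<open>Products of two rectangles\<close>

context torus_weights
begin

lemma sum_involution_eq_0:
  fixes f :: "'b \<Rightarrow> 'a"
  assumes "finite A"
    and h: "\<And>x. x \<in> A \<Longrightarrow> h x \<in> A \<and> h (h x) = x \<and> h x \<noteq> x \<and> f (h x) = f x"
  shows "sum f A = 0"
  using assms
proof (induction "card A" arbitrary: A rule: less_induct)
  case (less A)
  show ?case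
  proof (cases "A = {}")
    case False
    then obtain x where x: "x \<in> A" by blast
    let ?B = "A - {x, h x}"
    have "card ?B < card A" using x less.prems(1) by (intro psubset_card_mono) auto
    moreover have "h y \<in> ?B \<and> h (h y) = y \<and> h y \<noteq> y \<and> f (h y) = f y" if "y \<in> ?B" for y
      using that less.prems(2) x by (metis Diff_iff insert_iff singletonD)
    ultimately have "sum f ?B = 0" using less.hyps less.prems(1) by blast
    moreover have "sum f A = sum f ?B + sum f {x, h x}"
      using less.prems x by (intro sum.subset_diff) auto
    moreover have "sum f {x, h x} = 0" using less.prems(2)[OF x] by (auto simp: char2)
    ultimately show ?thesis by simp
  qed simp
qed

lemma card_pair_filter: "x \<noteq> y \<Longrightarrow> card {c \<in> {x, y}. Q c} = of_bool (Q x) + of_bool (Q y)"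
proof -
  assume "x \<noteq> y"
  have "{c \<in> {x, y}. Q c} = (if Q x then {x} else {}) \<union> (if Q y then {y} else {})" by auto
  then show ?thesis using \<open>x \<noteq> y\<close> by auto
qed

text \<open>Interchanging the rectangles can change which corners of one lie inside the other, so
  the exponents \<open>?k1\<close> to \<open>?k4\<close> need not match one by one; only the two
  sums agree.\<close>

lemma pair_weight_disjoint:
  assumes \<sigma>: "\<sigma> permutes {..<n}" and lt: "p < n" "q < n" "p' < n" "q' < n"
    and dist: "distinct [p, q, p', q']"
  shows "pair_weight \<sigma> (p, q) (p', q') = pair_weight \<sigma> (p', q') (p, q)"
proof -
  define T where "T = {p, q, p', q'}"
  define \<rho> \<rho>' where "\<rho> = swap_cols \<sigma> (p, q)" and "\<rho>' = swap_cols \<sigma> (p', q')"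
  have ne: "p \<noteq> q" "p' \<noteq> q'" "p \<noteq> p'" "p \<noteq> q'" "q \<noteq> p'" "q \<noteq> q'" using dist by auto
  have val: "\<rho> p = \<sigma> q" "\<rho> q = \<sigma> p" "\<rho> p' = \<sigma> p'" "\<rho> q' = \<sigma> q'"
    "\<rho>' p = \<sigma> p" "\<rho>' q = \<sigma> q" "\<rho>' p' = \<sigma> q'" "\<rho>' q' = \<sigma> p'"
    using ne ne[symmetric] by (simp_all add: \<rho>_def \<rho>'_def swap_cols_def)
  have out: "\<rho> c = \<sigma> c" "\<rho>' c = \<sigma> c" if "c \<notin> T" for c
    using that by (auto simp: \<rho>_def \<rho>'_def swap_cols_def T_def)
  have inj: "inj_on \<sigma> {..<n}" "inj_on \<rho> {..<n}" "inj_on \<rho>' {..<n}"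
    unfolding \<rho>_def \<rho>'_def using \<sigma> lt by (auto intro!: permutes_inj_on swap_cols_permutes)
  have T: "p \<in> T" "q \<in> T" "p' \<in> T" "q' \<in> T" "T \<subseteq> {..<n}" "finite T"
    "T - {p, q} = {p', q'}" "T - {p', q'} = {p, q}"
    using lt ne by (auto simp: T_def)
  have lt': "\<sigma> p < n" "\<sigma> q < n" "\<sigma> p' < n" "\<sigma> q' < n"
    using permutes_in_image[OF \<sigma>] lt by auto
  have dist': "distinct [\<sigma> p, \<sigma> q, \<sigma> p', \<sigma> q']"
    using dist permutes_inj[OF \<sigma>] by (simp add: inj_eq)
  let ?a = "\<lambda>c. of_bool (c \<in> arc n p q) :: int" and ?a' = "\<lambda>c. of_bool (c \<in> arc n p' q') :: int"
    and ?b = "\<lambda>c. of_bool (\<sigma> c \<in> arc n (\<sigma> p) (\<sigma> q)) :: int"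
    and ?b' = "\<lambda>c. of_bool (\<sigma> c \<in> arc n (\<sigma> p') (\<sigma> q')) :: int"
  let ?k1 = "card {c \<in> T - {p, q}. c \<in> arc n p q \<and> \<sigma> c \<in> arc n (\<sigma> p) (\<sigma> q)}"
    and ?k2 = "card {c \<in> T - {p', q'}. c \<in> arc n p' q' \<and> \<rho> c \<in> arc n (\<rho> p') (\<rho> q')}"
    and ?k3 = "card {c \<in> T - {p', q'}. c \<in> arc n p' q' \<and> \<sigma> c \<in> arc n (\<sigma> p') (\<sigma> q')}"
    and ?k4 = "card {c \<in> T - {p, q}. c \<in> arc n p q \<and> \<rho>' c \<in> arc n (\<rho>' p) (\<rho>' q)}"
  have a: "?a p' - ?a q' = ?a' q - ?a' p" and b: "?b p' - ?b q' = ?b' q - ?b' p"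
    using arc_interlace[OF dist lt] arc_interlace[OF dist' lt'] by linarith+
  \<comment> \<open>A swap exchanges the rows of two corners, so \<open>?k1 - ?k4\<close> and
    \<open>?k3 - ?k2\<close> each factor into a horizontal and a vertical difference. These factors
    are equal by \<open>a\<close> and \<open>b\<close>.\<close>
  have "int (?k1 + ?k2) - int (?k3 + ?k4) =
    (?a p' - ?a q') * (?b p' - ?b q') - (?a' q - ?a' p) * (?b' q - ?b' p)"
    unfolding T(7,8) card_pair_filter[OF ne(1)] card_pair_filter[OF ne(2)] val of_nat_add of_nat_of_bool
      of_bool_conj of_nat_mult by (simp only: algebra_simps)
  also have "\<dots> = 0" unfolding a b by simp
  finally have k: "?k1 + ?k2 = ?k3 + ?k4" by linarith
  let ?B = "block \<sigma> T (arc n p q) (arc n (\<sigma> p) (\<sigma> q))"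
    and ?B' = "block \<sigma> T (arc n p' q') (arc n (\<sigma> p') (\<sigma> q'))"
  have 1: "box_weight \<sigma> (p, q) = ?B * v ^ ?k1"
    using box_weight_block[OF T(1,2,5,6) inj(1) refl ne(1)] .
  have 2: "box_weight \<rho> (p', q') = ?B' * v ^ ?k2"
    using box_weight_block[OF T(3,4,5,6) inj(2) out(1) ne(2)] unfolding val .
  have 3: "box_weight \<sigma> (p', q') = ?B' * v ^ ?k3"
    using box_weight_block[OF T(3,4,5,6) inj(1) refl ne(2)] .
  have 4: "box_weight \<rho>' (p, q) = ?B * v ^ ?k4"
    using box_weight_block[OF T(1,2,5,6) inj(3) out(2) ne(1)] unfolding val .
  have "pair_weight \<sigma> (p, q) (p', q') = ?B * ?B' * v ^ (?k1 + ?k2)"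
    unfolding pair_weight_def \<rho>_def[symmetric] 1 2 power_add by (simp only: mult_ac)
  moreover have "pair_weight \<sigma> (p', q') (p, q) = ?B * ?B' * v ^ (?k3 + ?k4)"
    unfolding pair_weight_def \<rho>'_def[symmetric] 3 4 power_add by (simp only: mult_ac)
  ultimately show ?thesis by (simp only: k)
qed

definition swap_paths :: "(nat \<Rightarrow> nat) \<Rightarrow> (nat \<Rightarrow> nat) \<Rightarrow> ((nat \<times> nat) \<times> (nat \<times> nat)) set" where
  "swap_paths \<sigma> \<tau> =
     {(P, P'). P \<in> col_pairs \<and> P' \<in> col_pairs \<and> swap_cols (swap_cols \<sigma> P) P' = \<tau>}"

lemma finite_col_pairs: "finite col_pairs"
  by (rule finite_subset[of _ "{..<n} \<times> {..<n}"]) (auto simp: col_pairs_def)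

lemma finite_swap_paths: "finite (swap_paths \<sigma> \<tau>)"
  by (rule finite_subset[of _ "col_pairs \<times> col_pairs"]) (auto simp: swap_paths_def finite_col_pairs)

definition disjoint_cols :: "(nat \<times> nat) \<times> (nat \<times> nat) \<Rightarrow> bool" where
  "disjoint_cols = (\<lambda>((p, q), (p', q')). {p, q} \<inter> {p', q'} = {})"

lemma triple_pairs_swaps:
  assumes "(P, P') \<in> triple_pairs c d e"
  shows "swap_cols (swap_cols \<sigma> P) P' = \<sigma> \<circ> (transpose c d \<circ> transpose c e)"
  using assms by (auto simp: triple_pairs_def swap_cols_def comp_assoc transpose_commute)

lemma three_cycle_apply:
  assumes "distinct [c, d, e]"
  shows "(transpose c d \<circ> transpose c e) c = e" "(transpose c d \<circ> transpose c e) e = d"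
    "(transpose c d \<circ> transpose c e) d = c"
    "x \<notin> {c, d, e} \<Longrightarrow> (transpose c d \<circ> transpose c e) x = x"
  using assms by (auto simp: transpose_def)

lemma three_cycle_rotate:
  "distinct [c, d, e] \<Longrightarrow> transpose d e \<circ> transpose d c = transpose c d \<circ> transpose c e"
  by (auto simp: fun_eq_iff transpose_def)

text \<open>Swapping the same two columns twice would give \<open>\<sigma> = \<tau>\<close>, so
  exactly one column is shared; it becomes \<open>c\<close>.\<close>

lemma sharing_triple:
  assumes "(P, P') \<in> swap_paths \<sigma> \<tau>" "\<not> disjoint_cols (P, P')" "\<sigma> \<noteq> \<tau>"
  obtains c d e where "distinct [c, d, e]" "c < n" "d < n" "e < n" "(P, P') \<in> triple_pairs c d e"
proof -
  obtain p q p' q' where P: "P = (p, q)" "P' = (p', q')" by fastforce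
  have lt: "p < n" "q < n" "p \<noteq> q" "p' < n" "q' < n" "p' \<noteq> q'"
    and \<tau>: "\<tau> = \<sigma> \<circ> (transpose p q \<circ> transpose p' q')"
    using assms(1) by (auto simp: P swap_paths_def col_pairs_def swap_cols_def comp_assoc)
  have neq: "{p, q} \<noteq> {p', q'}"
  proof
    assume "{p, q} = {p', q'}"
    then have "transpose p' q' = transpose p q"
      by (auto simp: doubleton_eq_iff transpose_commute)
    then show False using assms(3) \<tau> by simp
  qed
  have "p = p' \<or> p = q' \<or> q = p' \<or> q = q'" using assms(2) by (auto simp: P disjoint_cols_def)
  then show ?thesis
  proof (elim disjE)
    assume "p = p'" then show ?thesis using that[of p q q'] lt neq by (auto simp: P triple_pairs_def)
  next
    assume "p = q'" then show ?thesis using that[of p q p'] lt neq by (auto simp: P triple_pairs_def)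
  next
    assume "q = p'" then show ?thesis using that[of q p q'] lt neq by (auto simp: P triple_pairs_def)
  next
    assume "q = q'" then show ?thesis using that[of q p p'] lt neq by (auto simp: P triple_pairs_def)
  qed
qed

text \<open>Terms with disjoint columns cancel under interchanging the rectangles. For the others
  the two transpositions compose to a 3-cycle, which \<open>\<sigma>\<close> and
  \<open>\<tau>\<close> determine, so they are exactly the twelve pairs over one triple.\<close>

theorem sum_swap_paths:
  assumes \<sigma>: "\<sigma> permutes {..<n}" and "\<sigma> \<noteq> \<tau>"
    and G: "0 \<in> \<G>" "\<And>x y. x \<in> \<G> \<Longrightarrow> y \<in> \<G> \<Longrightarrow> x + y \<in> \<G>"
    and bad: "\<And>P P'. (P, P') \<in> swap_paths \<sigma> \<tau> \<Longrightarrow> covers_annulus \<sigma> P P' \<Longrightarrow> pair_weight \<sigma> P P' \<in> \<G>"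
  shows "(\<Sum>(P, P') \<in> swap_paths \<sigma> \<tau>. pair_weight \<sigma> P P') \<in> \<G>"
proof -
  let ?f = "\<lambda>(P, P'). pair_weight \<sigma> P P'"
  let ?D = "{x \<in> swap_paths \<sigma> \<tau>. disjoint_cols x}" and ?S = "{x \<in> swap_paths \<sigma> \<tau>. \<not> disjoint_cols x}"
  have "sum ?f ?D = 0"
  proof (rule sum_involution_eq_0[where h = prod.swap])
    show "finite ?D" using finite_swap_paths by simp
    fix x assume x: "x \<in> ?D"
    obtain p q p' q' where X: "x = ((p, q), (p', q'))" by (metis surj_pair)
    have lt: "p < n" "q < n" "p' < n" "q' < n" "distinct [p, q, p', q']"
      using x by (auto simp: X swap_paths_def col_pairs_def disjoint_cols_def)
    have "transpose p q \<circ> transpose p' q' = transpose p' q' \<circ> transpose p q"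
      using lt(5) by (auto simp: fun_eq_iff transpose_def)
    then have "prod.swap x \<in> ?D"
      using x by (auto simp: X swap_paths_def disjoint_cols_def swap_cols_def comp_assoc)
    then show "prod.swap x \<in> ?D \<and> prod.swap (prod.swap x) = x \<and> prod.swap x \<noteq> x \<and> ?f (prod.swap x) = ?f x"
      using pair_weight_disjoint[OF \<sigma> lt] lt(5) by (auto simp: X)
  qed
  moreover have "sum ?f ?S \<in> \<G>"
  proof (cases "?S = {}")
    case True
    show ?thesis unfolding True using G(1) by simp
  next
    case False
    then obtain P0 P0' where "(P0, P0') \<in> swap_paths \<sigma> \<tau>" "\<not> disjoint_cols (P0, P0')" by auto
    from sharing_triple[OF this \<open>\<sigma> \<noteq> \<tau>\<close>] obtain p q r where
      pqr: "distinct [p, q, r]" "p < n" "q < n" "r < n" and "(P0, P0') \<in> triple_pairs p q r" .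
    with \<open>(P0, P0') \<in> swap_paths \<sigma> \<tau>\<close> have \<tau>: "\<tau> = \<sigma> \<circ> (transpose p q \<circ> transpose p r)"
      by (auto simp: swap_paths_def triple_pairs_swaps)
    have "?S = triple_pairs p q r \<union> triple_pairs q r p \<union> triple_pairs r p q" (is "_ = ?T")
    proof (intro equalityI subsetI)
      fix x assume "x \<in> ?S"
      then obtain P P' where x: "x = (P, P')" "(P, P') \<in> swap_paths \<sigma> \<tau>" "\<not> disjoint_cols (P, P')"
        by (cases x) auto
      from sharing_triple[OF x(2,3) \<open>\<sigma> \<noteq> \<tau>\<close>] obtain c d e where
        cde: "distinct [c, d, e]" and PP: "(P, P') \<in> triple_pairs c d e" .
      have "\<sigma> \<circ> (transpose c d \<circ> transpose c e) = \<sigma> \<circ> (transpose p q \<circ> transpose p r)"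
        using x(2) triple_pairs_swaps[OF PP, of \<sigma>] \<tau> by (auto simp: swap_paths_def)
      \<comment> \<open>Injectivity of \<open>\<sigma>\<close> recovers the 3-cycle, and a 3-cycle
        fixes its columns up to rotation.\<close>
      then have eq: "transpose c d \<circ> transpose c e = transpose p q \<circ> transpose p r" (is "_ = ?k")
        using injD[OF fun.inj_map[OF permutes_inj[OF \<sigma>]]] by blast
      define k where "k = transpose p q \<circ> transpose p r"
      note k' = three_cycle_apply[OF pqr(1), folded k_def]
      have k: "k c = e" "k e = d" using three_cycle_apply(1,2)[OF cde] unfolding eq k_def .
      have "e \<noteq> c" using cde by auto
      then have "c \<in> {p, q, r}" using k'(4)[of c] k(1) by metis
      then consider "c = p" "e = r" "d = q" | "c = q" "e = p" "d = r" | "c = r" "e = q" "d = p"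
        using k k'(1-3) by (elim insertE) auto
      then show "x \<in> ?T" using PP x(1) by cases auto
    next
      fix x assume "x \<in> ?T"
      obtain P P' where x: "x = (P, P')" by (cases x)
      with \<open>x \<in> ?T\<close> have "(P, P') \<in> triple_pairs p q r \<or> (P, P') \<in> triple_pairs q r p \<or> (P, P') \<in> triple_pairs r p q"
        by auto
      then have "swap_cols (swap_cols \<sigma> P) P' = \<tau>"
        using triple_pairs_swaps[of P P' _ _ _ \<sigma>] \<tau> three_cycle_rotate[of p q r] three_cycle_rotate[of q r p] pqr(1)
        by (elim disjE) (simp_all add: eq_commute)
      then show "x \<in> ?S" using \<open>x \<in> ?T\<close> pqr
        by (auto simp: x swap_paths_def triple_pairs_def col_pairs_def disjoint_cols_def)
    qed
    note ST = this
    have "sum ?f ?T \<in> \<G>"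
    proof (rule sum_triple_pairs[OF \<sigma> pqr(2-4)])
      show "p \<noteq> q" "q \<noteq> r" "r \<noteq> p" using pqr(1) by auto
      show "pair_weight \<sigma> P P' \<in> \<G>" if "covers_annulus \<sigma> P P'" "(P, P') \<in> ?T" for P P'
        using that(2) unfolding ST[symmetric] by (intro bad that(1)) simp
    qed (rule G(2))
    then show ?thesis unfolding ST .
  qed
  moreover have "sum ?f (swap_paths \<sigma> \<tau>) = sum ?f ?D + sum ?f ?S"
    using finite_swap_paths
    by (simp add: Collect_conj_eq Int_commute set_diff_eq sum.Int_Diff[of "swap_paths \<sigma> \<tau>" ?f "Collect disjoint_cols"])
  ultimately show ?thesis by simp
qed

text \<open>The second rectangle must use the same two columns. In the same order it completes the
  first one to a vertical annulus, in the opposite order to a horizontal one.\<close>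

lemma sum_swap_paths_same:
  assumes \<sigma>: "\<sigma> permutes {..<n}"
  shows "(\<Sum>(P, P') \<in> swap_paths \<sigma> \<sigma>. pair_weight \<sigma> P P') =
    (\<Sum>(p, q) \<in> col_pairs. pair_weight \<sigma> (p, q) (p, q)) +
    (\<Sum>(p, q) \<in> col_pairs. pair_weight \<sigma> (p, q) (q, p))"
proof -
  let ?A = "(\<lambda>P. (P, P)) ` col_pairs" and ?B = "(\<lambda>P. (P, prod.swap P)) ` col_pairs"
  have "swap_paths \<sigma> \<sigma> = ?A \<union> ?B"
  proof (intro equalityI subsetI)
    fix x assume x: "x \<in> swap_paths \<sigma> \<sigma>"
    obtain p q p' q' where X: "x = ((p, q), (p', q'))" by (metis surj_pair)
    have lt: "p < n" "q < n" "p \<noteq> q" "p' < n" "q' < n" "p' \<noteq> q'"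
      and eq: "\<sigma> \<circ> (transpose p q \<circ> transpose p' q') = \<sigma>"
      using x by (auto simp: X swap_paths_def col_pairs_def swap_cols_def comp_assoc)
    have "transpose p q (transpose p' q' c) = c" for c
      using fun_cong[OF eq, of c] permutes_inj[OF \<sigma>] by (simp add: inj_eq)
    then have "transpose p q p' = q'" "transpose p q q' = p'"
      by (metis transpose_apply_second) (metis transpose_apply_first \<open>\<And>c. transpose p q (transpose p' q' c) = c\<close>)
    then have "p' = p \<and> q' = q \<or> p' = q \<and> q' = p"
      using lt by (auto simp: transpose_def split: if_splits)
    then show "x \<in> ?A \<union> ?B" using lt by (auto simp: X col_pairs_def)
  next
    fix x assume "x \<in> ?A \<union> ?B"
    then show "x \<in> swap_paths \<sigma> \<sigma>"
      by (auto simp: swap_paths_def col_pairs_def swap_cols_def comp_assoc transpose_commute)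
  qed
  moreover have "?A \<inter> ?B = {}" by (auto simp: col_pairs_def)
  ultimately have "(\<Sum>(P, P') \<in> swap_paths \<sigma> \<sigma>. pair_weight \<sigma> P P') =
     (\<Sum>(P, P') \<in> ?A. pair_weight \<sigma> P P') + (\<Sum>(P, P') \<in> ?B. pair_weight \<sigma> P P')"
    using finite_col_pairs by (simp add: sum.union_disjoint)
  also have "(\<Sum>(P, P') \<in> ?A. pair_weight \<sigma> P P') = (\<Sum>(p, q) \<in> col_pairs. pair_weight \<sigma> (p, q) (p, q))"
    by (subst sum.reindex) (auto simp: inj_on_def case_prod_unfold)
  also have "(\<Sum>(P, P') \<in> ?B. pair_weight \<sigma> P P') = (\<Sum>(p, q) \<in> col_pairs. pair_weight \<sigma> (p, q) (q, p))"
    by (subst sum.reindex) (auto simp: inj_on_def case_prod_unfold prod.swap_def)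
  finally show ?thesis .
qed

end


section \<open>The weights of a grid diagram\<close>

lemma mpoly_char2: "(p :: mpoly) + p = 0"
proof (rule poly_mapping_eqI)
  fix m
  have "b + b = 0" for b :: bit by (cases b) simp_all
  then show "Poly_Mapping.lookup (p + p) m = Poly_Mapping.lookup 0 m"
    unfolding lookup_add by simp
qed

lemma mpoly_poly_char2: "(p :: mpoly poly) + p = 0"
  by (rule poly_eqI) (simp only: coeff_add mpoly_char2 coeff_0)

lemma poly_ring_0: "0 \<in> carrier (poly_ring I)" and poly_ring_1: "1 \<in> carrier (poly_ring I)"
  by (simp_all add: poly_ring_def)

lemma poly_ring_add: "p \<in> carrier (poly_ring I) \<Longrightarrow> q \<in> carrier (poly_ring I) \<Longrightarrow> p + q \<in> carrier (poly_ring I)"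
  using Poly_Mapping.keys_add[of p q] by (fastforce simp: poly_ring_def)

lemma poly_ring_mult:
  assumes "p \<in> carrier (poly_ring I)" "q \<in> carrier (poly_ring I)"
  shows "p * q \<in> carrier (poly_ring I)"
proof -
  have "Poly_Mapping.keys m \<subseteq> I" if m: "m \<in> Poly_Mapping.keys (p * q)" for m
  proof -
    from m keys_mult[of p q] obtain a b where "m = a + b" "a \<in> Poly_Mapping.keys p" "b \<in> Poly_Mapping.keys q" by blast
    then show ?thesis
      using assms Poly_Mapping.keys_add[of a b] by (fastforce simp: poly_ring_def)
  qed
  then show ?thesis by (simp add: poly_ring_def)
qed

lemma poly_ring_mvar: "i \<in> I \<Longrightarrow> mvar i \<in> carrier (poly_ring I)"
  by (simp add: poly_ring_def mvar_def)

lemma poly_ring_sum: "(\<And>x. x \<in> A \<Longrightarrow> h x \<in> carrier (poly_ring I)) \<Longrightarrow> sum h A \<in> carrier (poly_ring I)"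
  by (induction A rule: infinite_finite_induct) (auto intro: poly_ring_0 poly_ring_add)

lemma poly_ring_prod: "(\<And>x. x \<in> A \<Longrightarrow> h x \<in> carrier (poly_ring I)) \<Longrightarrow> prod h A \<in> carrier (poly_ring I)"
  by (induction A rule: infinite_finite_induct) (auto intro: poly_ring_1 poly_ring_mult)

lemma poly_ring_power: "p \<in> carrier (poly_ring I) \<Longrightarrow> p ^ m \<in> carrier (poly_ring I)"
  by (induction m) (auto intro: poly_ring_1 poly_ring_mult)

lemma coeff_0_prod: "coeff (prod h A) 0 = (\<Prod>x\<in>A. coeff (h x) 0 :: 'a :: comm_semiring_1)"
  by (simp add: poly_0_coeff_0[symmetric] poly_prod)

lemma coeff_0_power: "coeff (p ^ m) 0 = (coeff p 0 :: 'a :: comm_semiring_1) ^ m"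
  by (simp add: poly_0_coeff_0[symmetric])

lemma coeff_1_mult:
  "coeff (p * q) 1 = coeff p 0 * coeff q 1 + coeff p 1 * (coeff q 0 :: 'a :: comm_semiring_1)"
  by (simp add: coeff_mult)

text \<open>A total of 0 makes prefix sums a primitive on the circle, so an arc that wraps around
  obeys the same formula as one that does not.\<close>

lemma sum_arc:
  assumes "p < n" "q < n" "p \<noteq> q" "sum h {..<n} = (0 :: int)"
  shows "sum h (arc n p q) = sum h {..<q} - sum h {..<p}"
proof (cases "p < q")
  case True
  then show ?thesis
    using sum.atLeastLessThan_concat[of 0 p q h] by (simp add: arc_def lessThan_atLeast0)
next
  case False
  then have "sum h (arc n p q) = sum h {p..<n} + sum h {..<q}"
    using assms by (simp add: arc_def, subst sum.union_disjoint) auto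
  then show ?thesis
    using sum.atLeastLessThan_concat[of 0 p n h] assms by (simp add: lessThan_atLeast0)
qed

text \<open>\<open>k0\<close> labels the X that the rectangles of the homotopy have to
  contain.\<close>

locale marked_grid =
  fixes G :: grid and k0 :: nat
  assumes grid: "grid_diagram G" and k0: "k0 \<in> {1..gsize G}"
begin

abbreviation n :: nat where "n \<equiv> gsize G"

definition Xs :: "(nat \<times> nat) set" where "Xs = Xpos G ` {1..n}"

lemma X_col: "c < n \<Longrightarrow> \<exists>!i. i \<in> {1..n} \<and> fst (Xpos G i) = c"
  and X_row: "r < n \<Longrightarrow> \<exists>!i. i \<in> {1..n} \<and> snd (Xpos G i) = r"
  and O_col: "c < n \<Longrightarrow> \<exists>!i. i \<in> {1..n} \<and> fst (Opos G i) = c"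
  and O_row: "r < n \<Longrightarrow> \<exists>!i. i \<in> {1..n} \<and> snd (Opos G i) = r"
  by (use grid in \<open>unfold grid_diagram_def Let_def, elim conjE, simp only:\<close>)+

lemma X_range: "i \<in> {1..n} \<Longrightarrow> Xpos G i \<in> {..<n} \<times> {..<n}"
  and O_range: "i \<in> {1..n} \<Longrightarrow> Opos G i \<in> {..<n} \<times> {..<n}"
  and X_neq_O: "i \<in> {1..n} \<Longrightarrow> j \<in> {1..n} \<Longrightarrow> Xpos G i \<noteq> Opos G j"
  by (use grid in \<open>unfold grid_diagram_def Let_def, elim conjE, auto\<close>)+

lemma X_in_col: assumes "c < n" shows "\<exists>!r. (c, r) \<in> Xs"
proof -
  obtain i where i: "i \<in> {1..n}" "fst (Xpos G i) = c" using X_col[OF assms] by blast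
  show ?thesis
  proof (rule ex1I)
    show "(c, snd (Xpos G i)) \<in> Xs" using i unfolding Xs_def by (metis imageI prod.collapse)
    fix r assume "(c, r) \<in> Xs"
    then obtain j where j: "j \<in> {1..n}" "Xpos G j = (c, r)" by (auto simp: Xs_def)
    then have "j = i" using X_col[OF assms] i by (metis fst_conv)
    then show "r = snd (Xpos G i)" using j by simp
  qed
qed

lemma X_in_row: assumes "r < n" shows "\<exists>!c. (c, r) \<in> Xs"
proof -
  obtain i where i: "i \<in> {1..n}" "snd (Xpos G i) = r" using X_row[OF assms] by blast
  show ?thesis
  proof (rule ex1I)
    show "(fst (Xpos G i), r) \<in> Xs" using i unfolding Xs_def by (metis imageI prod.collapse)
    fix c assume "(c, r) \<in> Xs"
    then obtain j where j: "j \<in> {1..n}" "Xpos G j = (c, r)" by (auto simp: Xs_def)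
    then have "j = i" using X_row[OF assms] i by (metis snd_conv)
    then show "c = fst (Xpos G i)" using j by simp
  qed
qed

lemma Xs_sub: "Xs \<subseteq> {..<n} \<times> {..<n}" unfolding Xs_def by (intro image_subsetI X_range)

definition c0 :: nat where "c0 = fst (Xpos G k0)"
definition r0 :: nat where "r0 = snd (Xpos G k0)"

lemma X0: "(c0, r0) \<in> Xs" "Xpos G k0 = (c0, r0)" "c0 < n" "r0 < n"
  using k0 X_range[OF k0] by (auto simp: c0_def r0_def Xs_def)

definition Ocol :: nat where "Ocol = (THE i. i \<in> {1..n} \<and> fst (Opos G i) = c0)"
definition Orow :: nat where "Orow = (THE i. i \<in> {1..n} \<and> snd (Opos G i) = r0)"

lemma Ocol: "Ocol \<in> {1..n}" "fst (Opos G Ocol) = c0" and Orow: "Orow \<in> {1..n}" "snd (Opos G Orow) = r0"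
  using theI'[OF O_col[OF X0(3)]] theI'[OF O_row[OF X0(4)]] by (auto simp: Ocol_def Orow_def)

lemma Ocol_unique: "i \<in> {1..n} \<Longrightarrow> fst (Opos G i) = c0 \<longleftrightarrow> i = Ocol"
  using O_col[OF X0(3)] Ocol by metis

lemma Orow_unique: "i \<in> {1..n} \<Longrightarrow> snd (Opos G i) = r0 \<longleftrightarrow> i = Orow"
  using O_row[OF X0(4)] Orow by metis

lemma n_ge_2: "n \<ge> 2"
proof (rule ccontr)
  assume "\<not> n \<ge> 2"
  then have "n = 1" using X0(3) by simp
  then show False using X_range[OF k0] O_range[OF k0] X_neq_O[OF k0 k0] by auto
qed

text \<open>
  The polynomial variable marks \<open>X\<^sub>k\<close>: the coefficients of degree 0 and 1 of a weight belong to \<open>\<partial>\<close> and \<open>H\<close>.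
\<close>

definition wX :: "nat \<times> nat \<Rightarrow> mpoly poly" where
  "wX s = (if s = (c0, r0) then [:0, 1:] else if s \<in> Xs then 0 else 1)"

definition wO :: "nat \<times> nat \<Rightarrow> mpoly poly" where
  "wO s = (\<Prod>i\<in>{1..n}. if Opos G i = s then [:mvar i:] else 1)"

definition wt :: "nat \<times> nat \<Rightarrow> mpoly poly" where
  "wt s = wX s * wO s"

sublocale torus_weights n wt "[:mvar 0:]"
  by unfold_locales (rule mpoly_poly_char2)

lemma prod_wO: "finite A \<Longrightarrow> prod wO A = (\<Prod>i\<in>{1..n}. [:mvar i:] ^ of_bool (Opos G i \<in> A))"
  unfolding wO_def by (subst prod.swap) (simp add: prod.delta, intro prod.cong, auto)

lemma prod_wX_col:
  assumes "i < n" shows "prod wX ({i} \<times> {..<n}) = (if i = c0 then [:0, 1:] else 0)"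
proof (cases "i = c0")
  case True
  have "wX s = 1" if "s \<in> {i} \<times> {..<n} - {(c0, r0)}" for s
    using that X_in_col[OF X0(3)] X0(1) True by (auto simp: wX_def)
  then have "prod wX ({i} \<times> {..<n}) = wX (c0, r0)"
    using X0 True by (subst prod.remove[of _ "(c0, r0)"]) auto
  then show ?thesis using True by (simp add: wX_def)
next
  case False
  obtain r where r: "(i, r) \<in> Xs" using X_in_col[OF assms] by blast
  then have "(i, r) \<in> {i} \<times> {..<n}" "wX (i, r) = 0" using Xs_sub False by (auto simp: wX_def)
  then show ?thesis using False by (metis finite_SigmaI finite.emptyI finite_insert finite_lessThan prod_zero)
qed

lemma prod_wX_row:
  assumes "j < n" shows "prod wX ({..<n} \<times> {j}) = (if j = r0 then [:0, 1:] else 0)"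
proof (cases "j = r0")
  case True
  have "wX s = 1" if "s \<in> {..<n} \<times> {j} - {(c0, r0)}" for s
    using that X_in_row[OF X0(4)] X0(1) True by (auto simp: wX_def)
  then have "prod wX ({..<n} \<times> {j}) = wX (c0, r0)"
    using X0 True by (subst prod.remove[of _ "(c0, r0)"]) auto
  then show ?thesis using True by (simp add: wX_def)
next
  case False
  obtain c where c: "(c, j) \<in> Xs" using X_in_row[OF assms] by blast
  then have "(c, j) \<in> {..<n} \<times> {j}" "wX (c, j) = 0" using Xs_sub False by (auto simp: wX_def)
  then show ?thesis using False by (metis finite_SigmaI finite.emptyI finite_insert finite_lessThan prod_zero)
qed

text \<open>Every column other than \<open>c0\<close> contains an X of weight 0. In
  \<open>c0\<close> the marked X gives the indeterminate and the single O its variable; this is the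
  origin of the factors in \<open>d H + H d\<close>.\<close>

lemma prod_wt_col:
  assumes "i < n" shows "prod wt ({i} \<times> {..<n}) = (if i = c0 then [:0, mvar Ocol:] else 0)"
proof -
  have "(\<Prod>j\<in>{1..n}. [:mvar j:] ^ of_bool (Opos G j \<in> {c0} \<times> {..<n})) =
    (\<Prod>j\<in>{1..n}. if j = Ocol then [:mvar j:] else 1)"
    using O_range Ocol_unique by (intro prod.cong) (auto simp: mem_Times_iff)
  also have "\<dots> = [:mvar Ocol:]" using Ocol(1) by simp
  finally show ?thesis using prod_wX_col[OF assms]
    by (simp add: wt_def prod.distrib prod_wO)
qed

lemma prod_wt_row:
  assumes "j < n" shows "prod wt ({..<n} \<times> {j}) = (if j = r0 then [:0, mvar Orow:] else 0)"
proof -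
  have "(\<Prod>i\<in>{1..n}. [:mvar i:] ^ of_bool (Opos G i \<in> {..<n} \<times> {r0})) =
    (\<Prod>i\<in>{1..n}. if i = Orow then [:mvar i:] else 1)"
    using O_range Orow_unique by (intro prod.cong) (auto simp: mem_Times_iff)
  also have "\<dots> = [:mvar Orow:]" using Orow(1) by simp
  finally show ?thesis using prod_wX_row[OF assms]
    by (simp add: wt_def prod.distrib prod_wO)
qed

text \<open>
  The excess of a domain is its area minus \<open>n\<close> times the number of its \<open>X\<close>. It vanishes on annuli.
\<close>

definition excess :: "nat \<times> nat \<Rightarrow> int" where
  "excess s = 1 - int n * of_bool (s \<in> Xs)"

lemma excess_col: assumes "i < n" shows "(\<Sum>j<n. excess (i, j)) = 0"
proof -
  obtain r where r: "\<And>j. (i, j) \<in> Xs \<longleftrightarrow> j = r"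
    using X_in_col[OF assms] by metis
  then have "r < n" using Xs_sub by auto
  have "(\<Sum>j<n. excess (i, j)) = (\<Sum>j<n. 1 - (if j = r then int n else 0))"
    using r by (intro sum.cong) (auto simp: excess_def)
  then show ?thesis using \<open>r < n\<close> by (simp add: sum_subtractf)
qed

lemma excess_row: assumes "j < n" shows "(\<Sum>i<n. excess (i, j)) = 0"
proof -
  obtain c where c: "\<And>i. (i, j) \<in> Xs \<longleftrightarrow> i = c"
    using X_in_row[OF assms] by metis
  then have "c < n" using Xs_sub by auto
  have "(\<Sum>i<n. excess (i, j)) = (\<Sum>i<n. 1 - (if i = c then int n else 0))"
    using c by (intro sum.cong) (auto simp: excess_def)
  then show ?thesis using \<open>c < n\<close> by (simp add: sum_subtractf)
qed

text \<open>A primitive of \<open>excess\<close> in both directions. Since rows and columns have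
  total 0 it is consistent around the torus, and the excess of a rectangle becomes an alternating
  sum over its corners.\<close>

definition corner :: "nat \<Rightarrow> nat \<Rightarrow> int" where
  "corner p r = (\<Sum>i<p. \<Sum>j<r. excess (i, j))"

definition potential :: "(nat \<Rightarrow> nat) \<Rightarrow> int" where
  "potential \<sigma> = (\<Sum>c<n. corner c (\<sigma> c))"

text \<open>The southwest and northeast corners belong to the old state, the other two to the new
  one, and all other columns cancel between the potentials.\<close>

lemma sum_excess_box:
  assumes \<sigma>: "\<sigma> permutes {..<n}" and P: "P \<in> col_pairs"
  shows "sum excess (box_squares \<sigma> P) = potential \<sigma> - potential (swap_cols \<sigma> P)"
proof -
  obtain p q where PQ: "P = (p, q)" by fastforce
  have lt: "p < n" "q < n" "p \<noteq> q" using P by (auto simp: PQ col_pairs_def)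
  have lt': "\<sigma> p < n" "\<sigma> q < n" "\<sigma> p \<noteq> \<sigma> q"
    using permutes_in_image[OF \<sigma>] permutes_inj[OF \<sigma>] lt by (auto simp: inj_eq)
  define h where "h = (\<lambda>r i. \<Sum>j<r. excess (i, j))"
  \<comment> \<open>Vanishing row sums allow \<open>sum_arc\<close> to be applied a second time, now
    in the horizontal direction.\<close>
  have hz: "sum (h r) {..<n} = 0" if "r \<le> n" for r
    unfolding h_def by (subst sum.swap) (use excess_row that in simp)
  have "sum excess (box_squares \<sigma> P) = (\<Sum>i\<in>arc n p q. \<Sum>j\<in>arc n (\<sigma> p) (\<sigma> q). excess (i, j))"
    by (simp add: box_squares_def PQ sum.cartesian_product)
  also have "\<dots> = (\<Sum>i\<in>arc n p q. h (\<sigma> q) i - h (\<sigma> p) i)"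
    using arc_subset[of q n p] lt(2) lt' excess_col
    by (intro sum.cong refl) (simp add: h_def sum_arc subset_iff)
  also have "\<dots> = corner q (\<sigma> q) - corner p (\<sigma> q) - (corner q (\<sigma> p) - corner p (\<sigma> p))"
    unfolding sum_subtractf using lt lt' hz[of "\<sigma> p"] hz[of "\<sigma> q"]
    by (simp add: sum_arc corner_def h_def)
  finally have 1: "sum excess (box_squares \<sigma> P) =
    corner p (\<sigma> p) + corner q (\<sigma> q) - (corner p (\<sigma> q) + corner q (\<sigma> p))" by simp
  have split: "potential \<tau> = corner p (\<tau> p) + corner q (\<tau> q) + (\<Sum>c\<in>{..<n} - {p, q}. corner c (\<tau> c))" for \<tau>
    unfolding potential_def using lt by (subst sum.subset_diff[of "{p, q}"]) auto
  have "(\<Sum>c\<in>{..<n} - {p, q}. corner c (swap_cols \<sigma> P c)) = (\<Sum>c\<in>{..<n} - {p, q}. corner c (\<sigma> c))"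
    by (intro sum.cong) (auto simp: PQ swap_cols_def)
  then show ?thesis unfolding 1 split by (simp add: PQ swap_cols_def)
qed

lemma coeff_wt_poly_ring: "coeff (wt s) 0 \<in> carrier (poly_ring {0..n})"
  by (auto simp: wt_def wX_def wO_def coeff_0_prod mult.commute intro!: poly_ring_prod poly_ring_0 poly_ring_1 poly_ring_mvar)

lemma coeff_prod_wt_X_free:
  assumes "finite A" "coeff (prod wt A) 0 \<noteq> 0"
  shows "sum excess A = int (card A)"
proof -
  have "s \<notin> Xs" if "s \<in> A" for s
  proof
    assume "s \<in> Xs"
    then have "coeff (wt s) 0 = 0" by (auto simp: wt_def wX_def)
    then have "coeff (prod wt A) 0 = 0" unfolding coeff_0_prod using that assms(1) by (metis prod_zero)
    then show False using assms(2) by simp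
  qed
  then show ?thesis by (simp add: excess_def)
qed

text \<open>The instance of \<open>\<G>\<close>. Degree 0 encodes \<open>d d = 0\<close>, degree 1
  the shape of \<open>d H + H d\<close> off the diagonal. The condition on potentials depends on the
  two states only, which keeps the set closed under addition.\<close>

definition lower_terms :: "(nat \<Rightarrow> nat) \<Rightarrow> (nat \<Rightarrow> nat) \<Rightarrow> mpoly poly set" where
  "lower_terms \<sigma> \<tau> = {e. coeff e 0 = 0 \<and> (\<exists>\<alpha> \<in> carrier (poly_ring {0..n}). \<exists>\<beta> \<in> carrier (poly_ring {0..n}).
     coeff e 1 = mvar Orow * \<alpha> + mvar Ocol * \<beta> \<and> (\<alpha> = 0 \<and> \<beta> = 0 \<or> potential \<tau> < potential \<sigma>))}"

lemma lower_termsI: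
  assumes "coeff e 0 = 0" "coeff e 1 = mvar Orow * \<alpha> + mvar Ocol * \<beta>"
    and "\<alpha> \<in> carrier (poly_ring {0..n})" "\<beta> \<in> carrier (poly_ring {0..n})"
    and "\<alpha> \<noteq> 0 \<or> \<beta> \<noteq> 0 \<Longrightarrow> potential \<tau> < potential \<sigma>"
  shows "e \<in> lower_terms \<sigma> \<tau>"
  unfolding lower_terms_def using assms by blast

lemma lower_terms_0: "0 \<in> lower_terms \<sigma> \<tau>"
  by (auto simp: lower_terms_def intro!: bexI[of _ 0] poly_ring_0)

lemma lower_terms_add:
  assumes "x \<in> lower_terms \<sigma> \<tau>" "y \<in> lower_terms \<sigma> \<tau>" shows "x + y \<in> lower_terms \<sigma> \<tau>"
proof -
  obtain a b where 1: "a \<in> carrier (poly_ring {0..n})" "b \<in> carrier (poly_ring {0..n})"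
    "coeff x 1 = mvar Orow * a + mvar Ocol * b" "a = 0 \<and> b = 0 \<or> potential \<tau> < potential \<sigma>" "coeff x 0 = 0"
    using assms(1) unfolding lower_terms_def by blast
  obtain c d where 2: "c \<in> carrier (poly_ring {0..n})" "d \<in> carrier (poly_ring {0..n})"
    "coeff y 1 = mvar Orow * c + mvar Ocol * d" "c = 0 \<and> d = 0 \<or> potential \<tau> < potential \<sigma>" "coeff y 0 = 0"
    using assms(2) unfolding lower_terms_def by blast
  show ?thesis
  proof (rule lower_termsI[of _ "a + c" "b + d"])
    show "coeff (x + y) 1 = mvar Orow * (a + c) + mvar Ocol * (b + d)"
      using 1 2 by (simp add: algebra_simps)
    show "potential \<tau> < potential \<sigma>" if "a + c \<noteq> 0 \<or> b + d \<noteq> 0"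
      using that 1(4) 2(4) by auto
  qed (use 1 2 in \<open>auto intro: poly_ring_add\<close>)
qed

text \<open>Split an annulus \<open>Z\<close> of width one off the domain. If it misses the marked
  X, its weight is 0. Otherwise it yields the indeterminate times one variable, and the coefficient
  of degree 1 is that variable times the constant coefficient of the rest \<open>R\<close>.\<close>

lemma pair_weight_covers_annulus:
  assumes \<sigma>: "\<sigma> permutes {..<n}" and PP: "(P, P') \<in> swap_paths \<sigma> \<tau>" and cov: "covers_annulus \<sigma> P P'"
  shows "pair_weight \<sigma> P P' \<in> lower_terms \<sigma> \<tau>"
proof -
  define A B where "A = box_squares \<sigma> P" and "B = box_squares (swap_cols \<sigma> P) P'"
  have PP': "P \<in> col_pairs" "P' \<in> col_pairs" "swap_cols (swap_cols \<sigma> P) P' = \<tau>"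
    using PP by (auto simp: swap_paths_def)
  have \<rho>: "swap_cols \<sigma> P permutes {..<n}" using swap_cols_permutes[OF \<sigma>] PP'(1) by (auto simp: col_pairs_def)
  have fin: "finite A" "finite B" by (auto simp: A_def B_def box_squares_def)
  have pot: "potential \<sigma> - potential \<tau> = sum excess A + sum excess B"
    using sum_excess_box[OF \<sigma> PP'(1)] sum_excess_box[OF \<rho> PP'(2)] PP'(3) by (simp add: A_def B_def)
  obtain Z V where Z: "Z \<subset> A \<union> B" "sum excess Z = 0" "prod wt Z = 0 \<or> prod wt Z = [:0, mvar V:]" "V = Orow \<or> V = Ocol"
  proof -
    from cov consider i where "i < n" "{i} \<times> {..<n} \<subset> A \<union> B" | j where "j < n" "{..<n} \<times> {j} \<subset> A \<union> B"
      unfolding covers_annulus_def Let_def A_def B_def by blast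
    then show ?thesis
    proof cases
      case 1
      have "sum excess ({i} \<times> {..<n}) = (\<Sum>j<n. excess (i, j))"
        by (simp add: sum.cartesian_product[of "\<lambda>i j. excess (i, j)", simplified, symmetric])
      then show ?thesis using that[of "{i} \<times> {..<n}" Ocol] 1 prod_wt_col excess_col by auto
    next
      case 2
      have "sum excess ({..<n} \<times> {j}) = (\<Sum>i<n. excess (i, j))"
        by (simp add: sum.cartesian_product[of "\<lambda>i j. excess (i, j)", simplified, symmetric])
      then show ?thesis using that[of "{..<n} \<times> {j}" Orow] 2 prod_wt_row excess_row by auto
    qed
  qed
  define R where "R = prod wt (A \<union> B - Z) * prod wt (A \<inter> B) *
    [:mvar 0:] ^ (card (box_points \<sigma> P) + card (box_points (swap_cols \<sigma> P) P'))"
  have finZ: "finite Z" using Z(1) fin by (meson finite_UnI finite_subset psubset_imp_subset)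
  \<comment> \<open>The rectangles may overlap, so squares of the intersection enter twice.\<close>
  have "prod wt A * prod wt B = prod wt (A \<union> B) * prod wt (A \<inter> B)"
    using fin by (simp add: prod.union_inter)
  also have "prod wt (A \<union> B) = prod wt (A \<union> B - Z) * prod wt Z"
    using fin Z(1) by (intro prod.subset_diff) auto
  finally have AB: "prod wt A * prod wt B = prod wt (A \<union> B - Z) * prod wt Z * prod wt (A \<inter> B)" .
  have "pair_weight \<sigma> P P' = (prod wt A * prod wt B) *
    [:mvar 0:] ^ (card (box_points \<sigma> P) + card (box_points (swap_cols \<sigma> P) P'))"
    unfolding pair_weight_def box_weight_def A_def B_def power_add by (simp only: mult_ac)
  then have e: "pair_weight \<sigma> P P' = prod wt Z * R"
    unfolding AB R_def by (simp only: mult_ac)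
  \<comment> \<open>A nonzero constant coefficient means that the rest avoids every X, so its excess
    is its area, while \<open>Z\<close> has excess 0.\<close>
  have pos: "potential \<tau> < potential \<sigma>" if "coeff R 0 \<noteq> 0"
  proof -
    have "coeff (prod wt (A \<union> B - Z)) 0 \<noteq> 0" "coeff (prod wt (A \<inter> B)) 0 \<noteq> 0"
      using that by (auto simp: R_def coeff_mult)
    then have 1: "sum excess (A \<union> B - Z) = int (card (A \<union> B - Z))" "sum excess (A \<inter> B) = int (card (A \<inter> B))"
      using coeff_prod_wt_X_free fin by auto
    have "sum excess A + sum excess B = sum excess (A \<union> B) + sum excess (A \<inter> B)"
      using fin by (simp add: sum.union_inter)
    also have "sum excess (A \<union> B) = sum excess (A \<union> B - Z) + sum excess Z"
      using fin Z(1) by (intro sum.subset_diff) auto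
    finally have "potential \<sigma> - potential \<tau> = int (card (A \<union> B - Z)) + int (card (A \<inter> B))"
      using pot Z(2) 1 by simp
    \<comment> \<open>Here the strict inclusion in \<open>covers_annulus\<close> is used.\<close>
    moreover have "card (A \<union> B - Z) > 0" using Z(1) fin by (auto simp: card_gt_0_iff)
    ultimately show ?thesis by linarith
  qed
  have R: "coeff R 0 \<in> carrier (poly_ring {0..n})"
    unfolding R_def by (auto simp: coeff_mult coeff_0_prod coeff_0_power
      intro!: poly_ring_mult poly_ring_prod poly_ring_power poly_ring_mvar coeff_wt_poly_ring)
  from Z(3) show ?thesis
  proof
    assume "prod wt Z = 0"
    then show ?thesis using e lower_terms_0 by simp
  next
    assume "prod wt Z = [:0, mvar V:]"
    then have c: "coeff (pair_weight \<sigma> P P') 0 = 0" "coeff (pair_weight \<sigma> P P') 1 = mvar V * coeff R 0"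
      unfolding e by (simp_all add: coeff_mult)
    from Z(4) show ?thesis
    proof
      assume "V = Orow"
      then show ?thesis using c R pos poly_ring_0
        by (intro lower_termsI[of _ "coeff R 0" 0]) auto
    next
      assume "V = Ocol"
      then show ?thesis using c R pos poly_ring_0
        by (intro lower_termsI[of _ 0 "coeff R 0"]) auto
    qed
  qed
qed

section \<open>The square of the matrix of rectangle weights\<close>

definition perms :: "(nat \<Rightarrow> nat) set" where
  "perms = {\<sigma>. \<sigma> permutes {..<n}}"

lemma finite_perms: "finite perms"
  by (simp add: perms_def finite_permutations)

definition edge_weight :: "(nat \<Rightarrow> nat) \<Rightarrow> (nat \<Rightarrow> nat) \<Rightarrow> mpoly poly" where
  "edge_weight \<sigma> \<tau> = sum (box_weight \<sigma>) {P \<in> col_pairs. swap_cols \<sigma> P = \<tau>}"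

lemma edge_weight_mult:
  assumes "\<sigma> \<in> perms"
  shows "(\<Sum>\<rho>\<in>perms. edge_weight \<sigma> \<rho> * edge_weight \<rho> \<tau>) = (\<Sum>(P, P')\<in>swap_paths \<sigma> \<tau>. pair_weight \<sigma> P P')"
proof -
  have sub: "swap_cols \<sigma> ` col_pairs \<subseteq> perms"
    using assms swap_cols_permutes by (auto simp: perms_def col_pairs_def)
  have "(\<Sum>\<rho>\<in>perms. edge_weight \<sigma> \<rho> * edge_weight \<rho> \<tau>) =
    (\<Sum>\<rho>\<in>perms. \<Sum>P\<in>{P \<in> col_pairs. swap_cols \<sigma> P = \<rho>}. box_weight \<sigma> P * edge_weight (swap_cols \<sigma> P) \<tau>)"
    by (simp add: edge_weight_def[of \<sigma>] sum_distrib_right)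
  also have "\<dots> = (\<Sum>P\<in>col_pairs. box_weight \<sigma> P * edge_weight (swap_cols \<sigma> P) \<tau>)"
    by (rule sum.group[OF finite_col_pairs finite_perms sub])
  also have "\<dots> = (\<Sum>P\<in>col_pairs. \<Sum>P'\<in>{P' \<in> col_pairs. swap_cols (swap_cols \<sigma> P) P' = \<tau>}. pair_weight \<sigma> P P')"
    by (simp add: edge_weight_def pair_weight_def sum_distrib_left)
  also have "\<dots> = (\<Sum>(P, P')\<in>Sigma col_pairs (\<lambda>P. {P' \<in> col_pairs. swap_cols (swap_cols \<sigma> P) P' = \<tau>}). pair_weight \<sigma> P P')"
    using finite_col_pairs by (intro sum.Sigma) auto
  also have "Sigma col_pairs (\<lambda>P. {P' \<in> col_pairs. swap_cols (swap_cols \<sigma> P) P' = \<tau>}) = swap_paths \<sigma> \<tau>"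
    by (auto simp: swap_paths_def)
  finally show ?thesis .
qed

lemma edge_weight_mult_distinct:
  assumes "\<sigma> \<in> perms" "\<sigma> \<noteq> \<tau>"
  shows "(\<Sum>\<rho>\<in>perms. edge_weight \<sigma> \<rho> * edge_weight \<rho> \<tau>) \<in> lower_terms \<sigma> \<tau>"
  unfolding edge_weight_mult[OF assms(1)]
  using assms by (intro sum_swap_paths lower_terms_0 lower_terms_add pair_weight_covers_annulus) (auto simp: perms_def)

text \<open>Only neighbouring lines enclose a single column, so each diagonal sum below keeps
  exactly one pair.\<close>

lemma arc_subset_single:
  assumes "p < m" "q < m" "p \<noteq> q" "arc m p q \<subseteq> {c}"
  shows "p = c \<and> q = Suc c mod m"
proof -
  have pc: "p = c" using arc_start[OF assms(1), of q] assms(4) by auto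
  show ?thesis
  proof (cases "p < q")
    case True
    have "\<not> Suc p < q"
    proof
      assume "Suc p < q"
      then have "Suc p \<in> arc m p q" using True by (simp add: arc_def)
      then show False using assms(4) pc by auto
    qed
    then have "q = Suc p" using True by simp
    then show ?thesis using pc assms(2) by simp
  next
    case False
    have "q = 0"
    proof (rule ccontr)
      assume "q \<noteq> 0"
      then have "0 \<in> arc m p q" using False by (simp add: arc_def)
      then show False using assms(4) pc False \<open>q \<noteq> 0\<close> by auto
    qed
    moreover have "\<not> Suc p < m"
    proof
      assume "Suc p < m"
      then have "Suc p \<in> arc m p q" using False by (simp add: arc_def)
      then show False using assms(4) pc by auto
    qed
    then have "Suc p = m" using assms(1) by simp
    ultimately show ?thesis using pc by simp
  qed
qed

lemma arc_single: "c < m \<Longrightarrow> arc m c (Suc c mod m) = {c}"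
  by (cases "Suc c < m") (auto simp: arc_def not_less le_Suc_eq)

lemma Suc_mod_less: "c < n \<Longrightarrow> Suc c mod n < n" "c < n \<Longrightarrow> Suc c mod n \<noteq> c"
  using n_ge_2 by (simp, cases "Suc c < n") (auto simp: not_less le_Suc_eq)

lemma prod_wt_cols:
  assumes "I \<subseteq> {..<n}" "\<not> I \<subseteq> {c0}" shows "prod wt (I \<times> {..<n}) = 0"
proof -
  have fin: "finite I" using assms(1) finite_subset by blast
  obtain i where i: "i \<in> I" "i \<noteq> c0" using assms(2) by blast
  have "prod wt (I \<times> {..<n}) = prod wt (I \<times> {..<n} - {i} \<times> {..<n}) * prod wt ({i} \<times> {..<n})"
    using i fin by (intro prod.subset_diff) auto
  then show ?thesis using prod_wt_col[of i] i assms(1) by auto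
qed

lemma prod_wt_rows:
  assumes "J \<subseteq> {..<n}" "\<not> J \<subseteq> {r0}" shows "prod wt ({..<n} \<times> J) = 0"
proof -
  have fin: "finite J" using assms(1) finite_subset by blast
  obtain j where j: "j \<in> J" "j \<noteq> r0" using assms(2) by blast
  have "prod wt ({..<n} \<times> J) = prod wt ({..<n} \<times> J - {..<n} \<times> {j}) * prod wt ({..<n} \<times> {j})"
    using j fin by (intro prod.subset_diff) auto
  then show ?thesis using prod_wt_row[of j] j assms(1) by auto
qed

lemma sum_single_term:
  assumes "finite A" "a \<in> A" "\<And>x. x \<in> A \<Longrightarrow> x \<noteq> a \<Longrightarrow> f x = (0 :: 'b :: comm_monoid_add)"
  shows "sum f A = f a"
  using assms by (simp add: sum.remove sum.neutral)

text \<open>Loops at a state have annuli as domains. An annulus wider than one, or away from the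
  marked X, contains an X of weight 0. What remains is the column and the row of the marked X, each
  once.\<close>

lemma edge_weight_mult_same:
  assumes "\<sigma> \<in> perms"
  shows "(\<Sum>\<rho>\<in>perms. edge_weight \<sigma> \<rho> * edge_weight \<rho> \<sigma>) = [:0, mvar Orow + mvar Ocol:]"
proof -
  have \<sigma>: "\<sigma> permutes {..<n}" using assms by (simp add: perms_def)
  have im: "\<sigma> p < n \<longleftrightarrow> p < n" for p using permutes_in_image[OF \<sigma>] by simp
  have inj: "\<sigma> p = \<sigma> q \<longleftrightarrow> p = q" for p q using permutes_inj[OF \<sigma>] by (simp add: inj_eq)
  have sw: "swap_cols \<sigma> (p, q) p = \<sigma> q" "swap_cols \<sigma> (p, q) q = \<sigma> p" for p q
    by (simp_all add: swap_cols_def)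
  have col: "pair_weight \<sigma> (p, q) (p, q) = prod wt (arc n p q \<times> {..<n}) *
     [:mvar 0:] ^ (card (box_points \<sigma> (p, q)) + card (box_points (swap_cols \<sigma> (p, q)) (p, q)))"
    if "(p, q) \<in> col_pairs" for p q
  proof -
    have lt: "p < n" "q < n" "p \<noteq> q" using that by (auto simp: col_pairs_def)
    note cpl = arc_complement[of "\<sigma> p" n "\<sigma> q", unfolded im inj, OF lt]
    have "arc n p q \<times> {..<n} = box_squares \<sigma> (p, q) \<union> box_squares (swap_cols \<sigma> (p, q)) (p, q)"
      unfolding cpl(1)[symmetric] by (auto simp: box_squares_def sw)
    moreover have "box_squares \<sigma> (p, q) \<inter> box_squares (swap_cols \<sigma> (p, q)) (p, q) = {}"
      using cpl(2) by (auto simp: box_squares_def sw)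
    ultimately have "prod wt (arc n p q \<times> {..<n}) =
        prod wt (box_squares \<sigma> (p, q)) * prod wt (box_squares (swap_cols \<sigma> (p, q)) (p, q))"
      by (simp add: prod.union_disjoint box_squares_def)
    then show ?thesis by (simp only: pair_weight_def box_weight_def power_add mult_ac)
  qed
  have row: "pair_weight \<sigma> (p, q) (q, p) = prod wt ({..<n} \<times> arc n (\<sigma> p) (\<sigma> q)) *
     [:mvar 0:] ^ (card (box_points \<sigma> (p, q)) + card (box_points (swap_cols \<sigma> (p, q)) (q, p)))"
    if "(p, q) \<in> col_pairs" for p q
  proof -
    have lt: "p < n" "q < n" "p \<noteq> q" using that by (auto simp: col_pairs_def)
    note cpl = arc_complement[OF lt]
    have "{..<n} \<times> arc n (\<sigma> p) (\<sigma> q) = box_squares \<sigma> (p, q) \<union> box_squares (swap_cols \<sigma> (p, q)) (q, p)"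
      unfolding cpl(1)[symmetric] by (auto simp: box_squares_def sw)
    moreover have "box_squares \<sigma> (p, q) \<inter> box_squares (swap_cols \<sigma> (p, q)) (q, p) = {}"
      using cpl(2) by (auto simp: box_squares_def sw)
    ultimately have "prod wt ({..<n} \<times> arc n (\<sigma> p) (\<sigma> q)) =
        prod wt (box_squares \<sigma> (p, q)) * prod wt (box_squares (swap_cols \<sigma> (p, q)) (q, p))"
      by (simp add: prod.union_disjoint box_squares_def)
    then show ?thesis by (simp only: pair_weight_def box_weight_def power_add mult_ac)
  qed
  have "(\<Sum>(p, q) \<in> col_pairs. pair_weight \<sigma> (p, q) (p, q)) = [:0, mvar Ocol:]"
  proof -
    let ?q = "Suc c0 mod n"
    have mem: "(c0, ?q) \<in> col_pairs" using X0 Suc_mod_less[OF X0(3)] by (auto simp: col_pairs_def)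
    have "(\<Sum>(p, q) \<in> col_pairs. pair_weight \<sigma> (p, q) (p, q)) = pair_weight \<sigma> (c0, ?q) (c0, ?q)"
    proof (subst sum_single_term[OF finite_col_pairs mem])
      fix P assume P: "P \<in> col_pairs" "P \<noteq> (c0, ?q)"
      obtain p q where PQ: "P = (p, q)" by (cases P)
      have lt: "p < n" "q < n" "p \<noteq> q" using P by (auto simp: PQ col_pairs_def)
      have "\<not> arc n p q \<subseteq> {c0}" using arc_subset_single[OF lt] P(2) PQ by auto
      then have "prod wt (arc n p q \<times> {..<n}) = 0"
        using lt(2) by (intro prod_wt_cols arc_subset) auto
      then show "(case P of (p, q) \<Rightarrow> pair_weight \<sigma> (p, q) (p, q)) = 0"
        using col[of p q] P(1) by (simp add: PQ)
    qed simp
    \<comment> \<open>A rectangle of width one has no interior points, so no power of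
      \<open>v\<close> appears.\<close>
    also have "\<dots> = [:0, mvar Ocol:]"
      unfolding col[OF mem] using prod_wt_col[OF X0(3)]
      by (simp add: arc_single[OF X0(3)] box_points_def)
    finally show ?thesis .
  qed
  moreover have "(\<Sum>(p, q) \<in> col_pairs. pair_weight \<sigma> (p, q) (q, p)) = [:0, mvar Orow:]"
  proof -
    \<comment> \<open>\<open>p0\<close> and \<open>q0\<close> are the columns of the points on the
      two horizontal lines bounding row \<open>r0\<close>.\<close>
    obtain p0 where p0: "\<sigma> p0 = r0" "p0 < n"
      using permutes_surj[OF \<sigma>] X0(4) im by (metis surjD)
    obtain q0 where q0: "\<sigma> q0 = Suc r0 mod n" "q0 < n"
      using permutes_surj[OF \<sigma>] Suc_mod_less(1)[OF X0(4)] im by (metis surjD)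
    have mem: "(p0, q0) \<in> col_pairs" using p0 q0 Suc_mod_less(2)[OF X0(4)] by (auto simp: col_pairs_def)
    have "(\<Sum>(p, q) \<in> col_pairs. pair_weight \<sigma> (p, q) (q, p)) = pair_weight \<sigma> (p0, q0) (q0, p0)"
    proof (subst sum_single_term[OF finite_col_pairs mem])
      fix P assume P: "P \<in> col_pairs" "P \<noteq> (p0, q0)"
      obtain p q where PQ: "P = (p, q)" by (cases P)
      have lt: "p < n" "q < n" "p \<noteq> q" using P by (auto simp: PQ col_pairs_def)
      have "\<not> arc n (\<sigma> p) (\<sigma> q) \<subseteq> {r0}"
      proof
        assume "arc n (\<sigma> p) (\<sigma> q) \<subseteq> {r0}"
        from arc_subset_single[OF _ _ _ this] have "\<sigma> p = \<sigma> p0" "\<sigma> q = \<sigma> q0"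
          using lt by (simp_all add: im inj p0 q0)
        then show False using P(2) unfolding inj PQ by simp
      qed
      then have "prod wt ({..<n} \<times> arc n (\<sigma> p) (\<sigma> q)) = 0"
        using lt im by (intro prod_wt_rows arc_subset) (auto simp: less_imp_le)
      then show "(case P of (p, q) \<Rightarrow> pair_weight \<sigma> (p, q) (q, p)) = 0"
        using row[of p q] P(1) by (simp add: PQ)
    qed simp
    also have "\<dots> = [:0, mvar Orow:]"
      unfolding row[OF mem] using prod_wt_row[OF X0(4)]
      by (simp add: p0 q0 arc_single[OF X0(4)] box_points_def sw)
    finally show ?thesis .
  qed
  ultimately show ?thesis
    unfolding edge_weight_mult[OF assms] sum_swap_paths_same[OF \<sigma>] by (simp add: add.commute)
qed

end


section \<open>Chains, ideals and unitriangular matrices\<close>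

text \<open>For \<open>K \<subseteq> I\<close> this is the ideal generated by the variables in
  \<open>K\<close>, described by its monomials; membership can be tested on each monomial
  separately.\<close>

definition mvar_ideal :: "nat set \<Rightarrow> nat set \<Rightarrow> mpoly set" where
  "mvar_ideal I K = {p \<in> carrier (poly_ring I). \<forall>m\<in>Poly_Mapping.keys p. \<exists>i\<in>K. Poly_Mapping.lookup m i \<noteq> 0}"

lemma mpoly_monomials: "(p :: mpoly) = (\<Sum>m\<in>Poly_Mapping.keys p. Poly_Mapping.single m (Poly_Mapping.lookup p m))"
proof (rule poly_mapping_eqI)
  fix m
  show "Poly_Mapping.lookup p m = Poly_Mapping.lookup (\<Sum>m\<in>Poly_Mapping.keys p. Poly_Mapping.single m (Poly_Mapping.lookup p m)) m"
    by (simp add: lookup_sum lookup_single when_def in_keys_iff)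
qed

lemma lookup_mvar_mult:
  "Poly_Mapping.lookup (mvar i * p) (Poly_Mapping.single i 1 + m) = Poly_Mapping.lookup p m"
proof -
  have "mvar i * p = mvar i * (\<Sum>m\<in>Poly_Mapping.keys p. Poly_Mapping.single m (Poly_Mapping.lookup p m))"
    using mpoly_monomials[of p] by simp
  also have "\<dots> = (\<Sum>m\<in>Poly_Mapping.keys p. Poly_Mapping.single (Poly_Mapping.single i 1 + m) (Poly_Mapping.lookup p m))"
    by (simp only: sum_distrib_left mvar_def mult_single mult_1_left)
  finally show ?thesis
    by (simp add: lookup_sum lookup_single when_def in_keys_iff)
qed

lemma mvar_ideal_sub: "p \<in> mvar_ideal I K \<Longrightarrow> p \<in> carrier (poly_ring I)"
  by (simp add: mvar_ideal_def)

lemma mvar_ideal_0: "0 \<in> mvar_ideal I K"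
  by (simp add: mvar_ideal_def poly_ring_0)

lemma mvar_ideal_add: "p \<in> mvar_ideal I K \<Longrightarrow> q \<in> mvar_ideal I K \<Longrightarrow> p + q \<in> mvar_ideal I K"
  using Poly_Mapping.keys_add[of p q] by (auto simp: mvar_ideal_def poly_ring_add)

lemma mvar_ideal_mult:
  assumes "p \<in> carrier (poly_ring I)" "q \<in> mvar_ideal I K"
  shows "p * q \<in> mvar_ideal I K"
proof -
  have "\<exists>i\<in>K. Poly_Mapping.lookup m i \<noteq> 0" if m: "m \<in> Poly_Mapping.keys (p * q)" for m
  proof -
    from m keys_mult[of p q] obtain a b where "m = a + b" "b \<in> Poly_Mapping.keys q" by blast
    then show ?thesis using assms by (auto simp: mvar_ideal_def lookup_add)
  qed
  then show ?thesis using assms by (simp add: mvar_ideal_def poly_ring_mult)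
qed

lemma mvar_ideal_mult_right:
  "q \<in> mvar_ideal I K \<Longrightarrow> p \<in> carrier (poly_ring I) \<Longrightarrow> q * p \<in> mvar_ideal I K"
  using mvar_ideal_mult[of p I q K] by (simp only: mult.commute)

lemma mvar_ideal_sum: "(\<And>x. x \<in> A \<Longrightarrow> h x \<in> mvar_ideal I K) \<Longrightarrow> sum h A \<in> mvar_ideal I K"
  by (induction A rule: infinite_finite_induct) (auto intro: mvar_ideal_0 mvar_ideal_add)

lemma mvar_ideal_mono: "K \<subseteq> K' \<Longrightarrow> mvar_ideal I K \<subseteq> mvar_ideal I K'"
  unfolding mvar_ideal_def by blast

lemma mvar_ideal_mvar_mult:
  assumes "j \<in> K" "j \<in> I" "p \<in> carrier (poly_ring I)" shows "mvar j * p \<in> mvar_ideal I K"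
proof -
  have "mvar j \<in> mvar_ideal I K" using assms poly_ring_mvar[of j I]
    by (auto simp: mvar_ideal_def mvar_def lookup_single when_def intro!: bexI[of _ j])
  then show ?thesis using assms(3) by (rule mvar_ideal_mult_right)
qed

text \<open>Multiplication by \<open>mvar i\<close> raises the exponent of \<open>i\<close> in every
  monomial and leaves the exponents of variables in \<open>K\<close> alone. This is how
  \<open>mvar i\<close> is not a zero divisor modulo the ideal.\<close>

lemma mvar_ideal_cancel:
  assumes "mvar i * p \<in> mvar_ideal I K" "i \<notin> K" "p \<in> carrier (poly_ring I)"
  shows "p \<in> mvar_ideal I K"
proof -
  have "\<exists>j\<in>K. Poly_Mapping.lookup m j \<noteq> 0" if "m \<in> Poly_Mapping.keys p" for m
  proof -
    have "Poly_Mapping.single i 1 + m \<in> Poly_Mapping.keys (mvar i * p)"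
      using that unfolding in_keys_iff lookup_mvar_mult .
    then obtain j where "j \<in> K" "Poly_Mapping.lookup (Poly_Mapping.single i 1 + m) j \<noteq> 0"
      using assms(1) by (auto simp: mvar_ideal_def)
    then show ?thesis using assms(2) by (intro bexI[of _ j]) (auto simp: lookup_add lookup_single when_def split: if_splits)
  qed
  then show ?thesis using assms(3) by (simp add: mvar_ideal_def)
qed

lemma single_divide_mvar:
  assumes "Poly_Mapping.lookup m i \<noteq> 0"
  shows "Poly_Mapping.single m (b :: bit) = mvar i * Poly_Mapping.single (m - Poly_Mapping.single i 1) b"
proof -
  have "Poly_Mapping.single i 1 + (m - Poly_Mapping.single i 1) = m"
    using assms by (intro poly_mapping_eqI) (auto simp: lookup_add lookup_minus lookup_single when_def)
  then show ?thesis by (simp add: mvar_def mult_single)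
qed

lemma single_divide_mvar_carrier:
  assumes "Poly_Mapping.keys m \<subseteq> I"
  shows "Poly_Mapping.single (m - Poly_Mapping.single i 1) (b :: bit) \<in> carrier (poly_ring I)"
proof -
  have "Poly_Mapping.keys (m - Poly_Mapping.single i (1 :: nat)) \<subseteq> Poly_Mapping.keys m"
    by (auto simp: in_keys_iff lookup_minus)
  then show ?thesis using assms by (auto simp: poly_ring_def)
qed

text \<open>Monomials that meet \<open>K\<close> go into \<open>a\<close>; each remaining one
  contains \<open>i\<close> and can be divided by it.\<close>

lemma mvar_ideal_insert:
  assumes "p \<in> mvar_ideal I (insert i K)"
  obtains a b where "p = a + mvar i * b" "a \<in> mvar_ideal I K" "b \<in> carrier (poly_ring I)"
proof -
  let ?h = "\<lambda>m. \<exists>j\<in>K. Poly_Mapping.lookup m j \<noteq> 0" and ?c = "Poly_Mapping.lookup p"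
  let ?A = "{m \<in> Poly_Mapping.keys p. ?h m}" and ?B = "{m \<in> Poly_Mapping.keys p. \<not> ?h m}"
  define a where "a = (\<Sum>m\<in>?A. Poly_Mapping.single m (?c m))"
  define b where "b = (\<Sum>m\<in>?B. Poly_Mapping.single (m - Poly_Mapping.single i 1) (?c m))"
  have keys: "Poly_Mapping.keys m \<subseteq> I" if "m \<in> Poly_Mapping.keys p" for m
    using that assms by (auto simp: mvar_ideal_def poly_ring_def)
  have "p = (\<Sum>m\<in>Poly_Mapping.keys p. Poly_Mapping.single m (?c m))" by (rule mpoly_monomials)
  also have "\<dots> = a + (\<Sum>m\<in>?B. Poly_Mapping.single m (?c m))"
    unfolding a_def by (subst sum.union_disjoint[symmetric]) (auto intro: sum.cong)
  also have "(\<Sum>m\<in>?B. Poly_Mapping.single m (?c m)) = mvar i * b"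
    unfolding b_def sum_distrib_left
  proof (intro sum.cong refl single_divide_mvar)
    fix m assume "m \<in> ?B"
    then show "Poly_Mapping.lookup m i \<noteq> 0" using assms by (auto simp: mvar_ideal_def)
  qed
  finally have "p = a + mvar i * b" .
  moreover have "a \<in> mvar_ideal I K"
    unfolding a_def using keys by (intro mvar_ideal_sum) (auto simp: mvar_ideal_def poly_ring_def)
  moreover have "b \<in> carrier (poly_ring I)"
    unfolding b_def using keys by (intro poly_ring_sum single_divide_mvar_carrier) auto
  ultimately show ?thesis using that by blast
qed

section \<open>Chains and the submodules generated by variables\<close>

abbreviation grid_chains :: "grid \<Rightarrow> chain set" where
  "grid_chains G \<equiv> carrier (GC_minus G)"

lemma chainsI:
  "(\<And>x. x \<in> grid_states G \<Longrightarrow> c x \<in> carrier (poly_ring {0..gsize G})) \<Longrightarrow>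
   (\<And>x. x \<notin> grid_states G \<Longrightarrow> c x = 0) \<Longrightarrow> c \<in> grid_chains G"
  by (simp add: GC_minus_def)

lemma chains_value: "c \<in> grid_chains G \<Longrightarrow> c x \<in> carrier (poly_ring {0..gsize G})"
  by (cases "x \<in> grid_states G") (auto simp: GC_minus_def poly_ring_0)

lemma chains_outside: "c \<in> grid_chains G \<Longrightarrow> x \<notin> grid_states G \<Longrightarrow> c x = 0"
  by (simp add: GC_minus_def)

lemma GC_minus_simps: "c \<oplus>\<^bsub>GC_minus G\<^esub> d = c + d" "\<zero>\<^bsub>GC_minus G\<^esub> = 0"
  "p \<odot>\<^bsub>GC_minus G\<^esub> c = (\<lambda>x. p * c x)"
  by (simp_all add: GC_minus_def fun_eq_iff)

lemma chains_add: "c \<in> grid_chains G \<Longrightarrow> d \<in> grid_chains G \<Longrightarrow> c + d \<in> grid_chains G"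
  by (rule chainsI) (auto intro: poly_ring_add chains_value simp: chains_outside)

lemma chains_0: "0 \<in> grid_chains G"
  by (rule chainsI) (auto intro: poly_ring_0)

lemma chains_smult: "p \<in> carrier (poly_ring {0..gsize G}) \<Longrightarrow> c \<in> grid_chains G \<Longrightarrow> (\<lambda>x. p * c x) \<in> grid_chains G"
  by (rule chainsI) (auto intro: poly_ring_mult chains_value simp: chains_outside)

lemma chain_char2: "(c :: chain) + c = 0"
  by (simp only: fun_eq_iff plus_fun_apply mpoly_char2 zero_fun_apply) simp

lemma chain_add_cancel: "(c :: chain) + (c + d) = d"
  by (simp only: add.assoc[symmetric] chain_char2 add_0)

definition ideal_chains :: "grid \<Rightarrow> nat set \<Rightarrow> chain set" where
  "ideal_chains G K = {c \<in> grid_chains G. \<forall>x. c x \<in> mvar_ideal {0..gsize G} K}"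

lemma ideal_chains_sub: "ideal_chains G K \<subseteq> grid_chains G"
  by (auto simp: ideal_chains_def)

lemma ideal_chains_0: "0 \<in> ideal_chains G K"
  by (simp add: ideal_chains_def chains_0 mvar_ideal_0)

lemma ideal_chains_add: "c \<in> ideal_chains G K \<Longrightarrow> d \<in> ideal_chains G K \<Longrightarrow> c + d \<in> ideal_chains G K"
  by (simp add: ideal_chains_def chains_add mvar_ideal_add)

lemma ideal_chains_smult:
  "p \<in> carrier (poly_ring {0..gsize G}) \<Longrightarrow> c \<in> ideal_chains G K \<Longrightarrow> (\<lambda>x. p * c x) \<in> ideal_chains G K"
  by (simp add: ideal_chains_def chains_smult mvar_ideal_mult)

lemma GC_minus_abelian_group: "abelian_group (GC_minus G)"
proof (rule abelian_groupI)
  show "\<exists>y\<in>grid_chains G. y \<oplus>\<^bsub>GC_minus G\<^esub> x = \<zero>\<^bsub>GC_minus G\<^esub>" if "x \<in> grid_chains G" for x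
    using that by (intro bexI[of _ x]) (simp_all only: GC_minus_simps chain_char2)
qed (simp_all add: GC_minus_simps chains_add chains_0 add_ac)

lemma GC_minus_inv:
  assumes "c \<in> grid_chains G" shows "inv\<^bsub>add_monoid (GC_minus G)\<^esub> c = c"
proof -
  interpret abelian_group "GC_minus G" by (rule GC_minus_abelian_group)
  show ?thesis
    using minus_equality[of c c] assms unfolding a_inv_def GC_minus_simps chain_char2 by simp
qed

lemma submodule_GC_minusI:
  assumes "N \<subseteq> grid_chains G" "0 \<in> N" "\<And>c d. c \<in> N \<Longrightarrow> d \<in> N \<Longrightarrow> c + d \<in> N"
    and "\<And>p c. p \<in> carrier R \<Longrightarrow> c \<in> N \<Longrightarrow> (\<lambda>x. p * c x) \<in> N"
  shows "submodule N R (GC_minus G)"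
proof (intro submodule.intro subgroup.intro submodule_axioms.intro)
  show "N \<subseteq> carrier (add_monoid (GC_minus G))" "\<one>\<^bsub>add_monoid (GC_minus G)\<^esub> \<in> N"
    using assms(1,2) by (simp_all add: GC_minus_simps)
  show "c \<otimes>\<^bsub>add_monoid (GC_minus G)\<^esub> d \<in> N" if "c \<in> N" "d \<in> N" for c d
    using assms(3)[OF that] by (simp add: GC_minus_simps)
  show "inv\<^bsub>add_monoid (GC_minus G)\<^esub> c \<in> N" if "c \<in> N" for c
    using GC_minus_inv[of c G] that assms(1) by auto
  show "p \<odot>\<^bsub>GC_minus G\<^esub> c \<in> N" if "p \<in> carrier R" "c \<in> N" for p c
    using assms(4)[OF that] by (simp add: GC_minus_simps)
qed

lemma submodule_add_sum:
  assumes "submodule N R (GC_minus G)" "finite A" "\<And>a. a \<in> A \<Longrightarrow> h a \<in> N"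
  shows "(\<Sum>a\<in>A. h a) \<in> N"
proof -
  interpret submodule N R "GC_minus G" by fact
  have "0 \<in> N" and add: "\<And>c d. c \<in> N \<Longrightarrow> d \<in> N \<Longrightarrow> c + d \<in> N"
    using one_closed m_closed by (simp_all add: GC_minus_simps)
  from assms(2,3) show ?thesis
    by (induction A rule: finite_induct) (simp_all add: \<open>0 \<in> N\<close> add)
qed

lemma finite_grid_states: "finite (grid_states G)"
  by (rule finite_subset[of _ "Pow ({..<gsize G} \<times> {..<gsize G})"]) (auto simp: grid_states_def)

lemma sum_fun_apply: "(\<Sum>a\<in>A. h a) x = (\<Sum>a\<in>A. (h a x :: 'b :: comm_monoid_add))"
  by (induction A rule: infinite_finite_induct) auto

text \<open>For the inclusion from right to left, a chain is split into chains with one monomial at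
  one state; each of these is a variable of \<open>K\<close> times a chain.\<close>

lemma V_submodule_eq:
  assumes "K \<subseteq> {1..gsize G}"
  shows "V_submodule G K = ideal_chains G K"
proof
  have "submodule (ideal_chains G K) (poly_ring {0..gsize G}) (GC_minus G)"
    by (rule submodule_GC_minusI) (auto intro: ideal_chains_0 ideal_chains_add ideal_chains_smult dest: subsetD[OF ideal_chains_sub])
  moreover have "a \<odot>\<^bsub>GC_minus G\<^esub> m \<in> ideal_chains G K" if a: "a \<in> mvar ` K" and m: "m \<in> grid_chains G" for a m
  proof -
    obtain j where j: "a = mvar j" "j \<in> K" using a by blast
    have "j \<in> {0..gsize G}" using j(2) assms by auto
    then show ?thesis
      unfolding GC_minus_simps ideal_chains_def j(1)
      using chains_smult[OF poly_ring_mvar m] mvar_ideal_mvar_mult[OF j(2) _ chains_value[OF m]] by simp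
  qed
  ultimately show "V_submodule G K \<subseteq> ideal_chains G K"
    unfolding V_submodule_def ideal_submodule_def by blast
  show "ideal_chains G K \<subseteq> V_submodule G K"
    unfolding V_submodule_def ideal_submodule_def
  proof (intro subsetI InterI, clarify)
    fix c N
    assume c: "c \<in> ideal_chains G K" and N: "submodule N (poly_ring {0..gsize G}) (GC_minus G)"
      and gen: "\<forall>a\<in>mvar ` K. \<forall>m\<in>grid_chains G. a \<odot>\<^bsub>GC_minus G\<^esub> m \<in> N"
    define h where "h x m = (\<lambda>y. if y = x then Poly_Mapping.single m (Poly_Mapping.lookup (c x) m) else (0 :: mpoly))" for x m
    have "h x m \<in> N" if x: "x \<in> grid_states G" and m: "m \<in> Poly_Mapping.keys (c x)" for x m
    proof -
      have cx: "c x \<in> mvar_ideal {0..gsize G} K" using c by (auto simp: ideal_chains_def)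
      then obtain i where i: "i \<in> K" "Poly_Mapping.lookup m i \<noteq> 0" using m by (auto simp: mvar_ideal_def)
      define c' where "c' = (\<lambda>y. if y = x then Poly_Mapping.single (m - Poly_Mapping.single i 1) (Poly_Mapping.lookup (c x) m) else 0)"
      have "Poly_Mapping.keys m \<subseteq> {0..gsize G}" using cx m by (auto simp: mvar_ideal_def poly_ring_def)
      then have "c' \<in> grid_chains G"
        unfolding c'_def using x by (intro chainsI) (auto intro: single_divide_mvar_carrier poly_ring_0 simp del: One_nat_def)
      then have "mvar i \<odot>\<^bsub>GC_minus G\<^esub> c' \<in> N" using gen i(1) by blast
      moreover have "mvar i \<odot>\<^bsub>GC_minus G\<^esub> c' = h x m"
        unfolding GC_minus_simps h_def c'_def by (auto simp: fun_eq_iff single_divide_mvar[OF i(2)])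
      ultimately show ?thesis by simp
    qed
    then have "(\<Sum>x\<in>grid_states G. \<Sum>m\<in>Poly_Mapping.keys (c x). h x m) \<in> N"
      by (intro submodule_add_sum[OF N]) (auto simp: finite_grid_states)
    moreover have "c = (\<Sum>x\<in>grid_states G. \<Sum>m\<in>Poly_Mapping.keys (c x). h x m)"
    proof
      fix y
      have "(\<Sum>x\<in>grid_states G. \<Sum>m\<in>Poly_Mapping.keys (c x). h x m) y =
        (\<Sum>x\<in>grid_states G. if x = y then \<Sum>m\<in>Poly_Mapping.keys (c y). Poly_Mapping.single m (Poly_Mapping.lookup (c y) m) else 0)"
        unfolding sum_fun_apply h_def by (intro sum.cong) auto
      also have "\<dots> = c y"
        using mpoly_monomials[of "c y"] c finite_grid_states
        by (auto simp: ideal_chains_def chains_outside)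
      finally show "c y = (\<Sum>x\<in>grid_states G. \<Sum>m\<in>Poly_Mapping.keys (c x). h x m) y" by simp
    qed
    ultimately show "c \<in> N" by simp
  qed
qed

lemma ideal_chains_insert:
  assumes "u \<in> ideal_chains G (insert i K)"
  obtains a e where "u = a + (\<lambda>x. mvar i * e x)" "a \<in> ideal_chains G K" "e \<in> grid_chains G"
proof -
  have "\<exists>p q. u x = p + mvar i * q \<and> p \<in> mvar_ideal {0..gsize G} K \<and> q \<in> carrier (poly_ring {0..gsize G})" for x
    using assms mvar_ideal_insert[of "u x" "{0..gsize G}" i K] by (auto simp: ideal_chains_def) metis
  then obtain p q where pq: "\<And>x. u x = p x + mvar i * q x" "\<And>x. p x \<in> mvar_ideal {0..gsize G} K"
    "\<And>x. q x \<in> carrier (poly_ring {0..gsize G})" by metis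
  define a e where "a = (\<lambda>x. if x \<in> grid_states G then p x else 0)"
    and "e = (\<lambda>x. if x \<in> grid_states G then q x else 0)"
  have out: "u x = 0" if "x \<notin> grid_states G" for x
    using assms that by (auto simp: ideal_chains_def chains_outside)
  have "u = a + (\<lambda>x. mvar i * e x)" using pq(1) out by (auto simp: a_def e_def fun_eq_iff)
  moreover have "a \<in> ideal_chains G K"
    using pq(2) mvar_ideal_sub by (fastforce simp: ideal_chains_def a_def mvar_ideal_0 intro!: chainsI)
  moreover have "e \<in> grid_chains G" unfolding e_def using pq(3) by (intro chainsI) auto
  ultimately show ?thesis using that by blast
qed

section \<open>Matrices acting on chains, and the algebra of the homotopy\<close>

definition matrix_map :: "grid \<Rightarrow> (state \<Rightarrow> state \<Rightarrow> mpoly) \<Rightarrow> chain \<Rightarrow> chain" where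
  "matrix_map G A c = (\<lambda>y. if y \<in> grid_states G then \<Sum>x\<in>grid_states G. c x * A x y else 0)"

lemma matrix_map_add: "matrix_map G A (c + d) = matrix_map G A c + matrix_map G A d"
  by (auto simp: matrix_map_def fun_eq_iff algebra_simps sum.distrib)

lemma matrix_map_smult: "matrix_map G A (\<lambda>x. p * c x) = (\<lambda>x. p * matrix_map G A c x)"
  by (auto simp: matrix_map_def fun_eq_iff algebra_simps sum_distrib_left)

lemma matrix_map_0: "matrix_map G A 0 = 0"
  by (auto simp: matrix_map_def fun_eq_iff)

text \<open>Chains are row vectors, so the matrix applied first is the left factor.\<close>

lemma matrix_map_comp:
  "matrix_map G B (matrix_map G A c) = matrix_map G (\<lambda>x z. \<Sum>y\<in>grid_states G. A x y * B y z) c"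
  unfolding matrix_map_def fun_eq_iff
  by (auto simp: sum_distrib_left sum_distrib_right mult.assoc intro: sum.swap)

lemma matrix_map_sum: "matrix_map G (\<lambda>x y. A x y + B x y) c = matrix_map G A c + matrix_map G B c"
  by (auto simp: matrix_map_def fun_eq_iff algebra_simps sum.distrib)

lemma matrix_map_cong:
  "(\<And>x y. x \<in> grid_states G \<Longrightarrow> y \<in> grid_states G \<Longrightarrow> A x y = B x y) \<Longrightarrow> matrix_map G A = matrix_map G B"
  by (auto simp: matrix_map_def fun_eq_iff intro!: sum.cong)

lemma matrix_map_scale: "matrix_map G (\<lambda>x y. p * A x y) c = (\<lambda>x. p * matrix_map G A c x)"
  by (auto simp: matrix_map_def fun_eq_iff sum_distrib_left mult_ac)

definition poly_matrix :: "grid \<Rightarrow> (state \<Rightarrow> state \<Rightarrow> mpoly) \<Rightarrow> bool" where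
  "poly_matrix G A \<longleftrightarrow> (\<forall>x\<in>grid_states G. \<forall>y\<in>grid_states G. A x y \<in> carrier (poly_ring {0..gsize G}))"

lemma matrix_map_chains: "poly_matrix G A \<Longrightarrow> c \<in> grid_chains G \<Longrightarrow> matrix_map G A c \<in> grid_chains G"
  by (rule chainsI) (simp_all add: matrix_map_def poly_matrix_def poly_ring_sum poly_ring_mult chains_value)

lemma matrix_map_ideal_chains:
  assumes "poly_matrix G A" "c \<in> ideal_chains G K"
  shows "matrix_map G A c \<in> ideal_chains G K"
proof -
  have "c x * A x y \<in> mvar_ideal {0..gsize G} K" if "x \<in> grid_states G" "y \<in> grid_states G" for x y
    using assms that by (intro mvar_ideal_mult_right) (simp_all add: poly_matrix_def ideal_chains_def)
  then show ?thesis
    using assms matrix_map_chains[OF assms(1)]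
    by (auto simp: ideal_chains_def matrix_map_def intro!: mvar_ideal_sum mvar_ideal_0)
qed

definition unitriangular :: "grid \<Rightarrow> (state \<Rightarrow> int) \<Rightarrow> (state \<Rightarrow> state \<Rightarrow> mpoly) \<Rightarrow> bool" where
  "unitriangular G f A \<longleftrightarrow> poly_matrix G A \<and> (\<forall>x\<in>grid_states G. A x x = 1) \<and>
     (\<forall>x\<in>grid_states G. \<forall>y\<in>grid_states G. x \<noteq> y \<longrightarrow> A x y \<noteq> 0 \<longrightarrow> f y < f x)"

lemma unitriangular_apply:
  assumes "unitriangular G f A" "z \<in> grid_states G"
  shows "matrix_map G A c z = c z + (\<Sum>x\<in>grid_states G - {z}. c x * A x z)"
  using assms finite_grid_states[of G] by (simp add: matrix_map_def unitriangular_def sum.remove)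

text \<open>Successive approximation: in characteristic 2 the error of taking \<open>e\<close> as
  its own preimage is \<open>r\<close>, and each state in the support of \<open>r\<close> has a
  smaller value of \<open>f\<close> than some state in the support of \<open>e\<close>. With
  finitely many states this terminates.\<close>

lemma unitriangular_surj:
  assumes A: "unitriangular G f A" and "e \<in> grid_chains G"
  shows "\<exists>e'\<in>grid_chains G. matrix_map G A e' = e"
proof -
  have pA: "poly_matrix G A" using A by (simp add: unitriangular_def)
  obtain b where b: "\<And>x. x \<in> grid_states G \<Longrightarrow> b \<le> f x"
    using finite_grid_states[of G] by (metis Min_le finite_imageI imageI)
  have "\<exists>e'\<in>grid_chains G. matrix_map G A e' = e" if "e \<in> grid_chains G" "\<And>x. e x \<noteq> 0 \<Longrightarrow> nat (f x - b) < m" for m e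
    using that
  proof (induction m arbitrary: e)
    case 0
    then have "e = 0" by (auto simp: fun_eq_iff)
    then show ?case using chains_0 matrix_map_0 by metis
  next
    case (Suc m)
    define r where "r = e + matrix_map G A e"
    have "r \<in> grid_chains G" unfolding r_def using Suc.prems(1) pA by (intro chains_add matrix_map_chains)
    moreover have "nat (f z - b) < m" if "r z \<noteq> 0" for z
    proof -
      have z: "z \<in> grid_states G" using \<open>r \<in> grid_chains G\<close> that chains_outside by blast
      have "r z = (\<Sum>x\<in>grid_states G - {z}. e x * A x z)"
        unfolding r_def plus_fun_apply unitriangular_apply[OF A z] by (simp only: add.assoc[symmetric] mpoly_char2) simp
      then obtain x where x: "x \<in> grid_states G - {z}" "e x * A x z \<noteq> 0"
        using \<open>r z \<noteq> 0\<close> by (metis (no_types, lifting) sum.neutral)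
      then have "e x \<noteq> 0" "A x z \<noteq> 0" by auto
      then have "f z < f x" "nat (f x - b) < Suc m"
        using A x(1) z Suc.prems(2) by (auto simp: unitriangular_def)
      then show ?thesis using b[OF z] by linarith
    qed
    ultimately obtain e'' where e'': "e'' \<in> grid_chains G" "matrix_map G A e'' = r" using Suc.IH by blast
    have "matrix_map G A (e + e'') = matrix_map G A e + (matrix_map G A e + e)"
      by (simp only: matrix_map_add e''(2) r_def add.commute)
    then have "matrix_map G A (e + e'') = e" by (simp only: chain_add_cancel)
    then show ?case using chains_add[OF Suc.prems(1) e''(1)] by blast
  qed
  moreover have "nat (f x - b) < Suc (Max ((\<lambda>x. nat (f x - b)) ` grid_states G))" if "e x \<noteq> 0" for x
    using that assms(2) chains_outside finite_grid_states[of G] by (metis Max_ge finite_imageI image_eqI le_imp_less_Suc)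
  ultimately show ?thesis using assms(2) by blast
qed

text \<open>Solve for the coefficients from large values of \<open>f\<close> downwards:
  \<open>c z\<close> differs from the coefficient of the image by terms already known to lie in the
  ideal.\<close>

lemma unitriangular_reflect:
  assumes A: "unitriangular G f A" and c: "c \<in> grid_chains G" and img: "matrix_map G A c \<in> ideal_chains G K"
  shows "c \<in> ideal_chains G K"
proof -
  have pA: "poly_matrix G A" using A by (simp add: unitriangular_def)
  obtain b where b: "\<And>x. x \<in> grid_states G \<Longrightarrow> f x \<le> b"
    using finite_grid_states[of G] by (metis Max_ge finite_imageI imageI)
  have "c z \<in> mvar_ideal {0..gsize G} K" if "z \<in> grid_states G" for z
    using that
  proof (induction "nat (b - f z)" arbitrary: z rule: less_induct)
    case less
    have "c x * A x z \<in> mvar_ideal {0..gsize G} K" if x: "x \<in> grid_states G - {z}" for x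
    proof (cases "A x z = 0")
      case True
      then show ?thesis by (simp add: mvar_ideal_0)
    next
      case False
      then have "f z < f x" using A x less.prems by (auto simp: unitriangular_def)
      then have "nat (b - f x) < nat (b - f z)" using b[of x] x by auto
      then have "c x \<in> mvar_ideal {0..gsize G} K" using less.hyps x by blast
      moreover have "A x z \<in> carrier (poly_ring {0..gsize G})"
        using pA x less.prems by (simp add: poly_matrix_def)
      ultimately show ?thesis by (rule mvar_ideal_mult_right)
    qed
    then have "(\<Sum>x\<in>grid_states G - {z}. c x * A x z) \<in> mvar_ideal {0..gsize G} K" (is "?s \<in> _")
      by (rule mvar_ideal_sum)
    moreover have "c z + ?s \<in> mvar_ideal {0..gsize G} K"
      using img unfolding unitriangular_apply[OF A less.prems, symmetric] by (auto simp: ideal_chains_def)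
    ultimately have "(c z + ?s) + ?s \<in> mvar_ideal {0..gsize G} K" by (rule mvar_ideal_add[rotated])
    then show ?case by (simp only: add.assoc mpoly_char2 add_0_right)
  qed
  then show ?thesis using c by (auto simp: ideal_chains_def chains_outside mvar_ideal_0) (metis chains_outside mvar_ideal_0)
qed

text \<open>Modulo \<open>ideal_chains G K\<close> the multiples of \<open>mvar j\<close> disappear.
  The homotopy formula only controls \<open>mvar i\<close> times \<open>\<alpha>\<close>, so
  \<open>mvar i\<close> is cancelled along the way, using \<open>i \<notin> K\<close>. The
  correcting chain is \<open>b + matrix_map G H e'\<close>.\<close>

lemma homotopy_unitriangular_step:
  assumes D: "poly_matrix G D" and H: "poly_matrix G H" and \<alpha>: "unitriangular G f \<alpha>" and \<beta>: "poly_matrix G \<beta>"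
    and DD: "\<And>x z. x \<in> grid_states G \<Longrightarrow> z \<in> grid_states G \<Longrightarrow> (\<Sum>y\<in>grid_states G. D x y * D y z) = 0"
    and DH: "\<And>x z. x \<in> grid_states G \<Longrightarrow> z \<in> grid_states G \<Longrightarrow>
      (\<Sum>y\<in>grid_states G. D x y * H y z) + (\<Sum>y\<in>grid_states G. H x y * D y z) = mvar i * \<alpha> x z + mvar j * \<beta> x z"
    and i: "i \<notin> K" "i \<in> {0..gsize G}" and j: "j \<in> K" "j \<in> {0..gsize G}"
    and c: "matrix_map G D c \<in> ideal_chains G K" "c = matrix_map G D b + u"
      "b \<in> grid_chains G" "u \<in> ideal_chains G (insert i K)"
  shows "\<exists>b'\<in>grid_chains G. c + matrix_map G D b' \<in> ideal_chains G K"
proof -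
  let ?d = "matrix_map G D" and ?h = "matrix_map G H" and ?N = "ideal_chains G K"
  let ?m = "\<lambda>i e x. mvar i * e x"
  have dd: "?d (?d e) = 0" for e
  proof -
    have "?d (?d e) = matrix_map G (\<lambda>x z. 0) e"
      unfolding matrix_map_comp by (rule fun_cong[OF matrix_map_cong]) (rule DD)
    then show ?thesis by (auto simp: matrix_map_def fun_eq_iff)
  qed
  have dh: "?h (?d e) + ?d (?h e) = ?m i (matrix_map G \<alpha> e) + ?m j (matrix_map G \<beta> e)" for e
    unfolding matrix_map_comp matrix_map_sum[symmetric] matrix_map_scale[symmetric]
    by (rule fun_cong[OF matrix_map_cong]) (rule DH)
  have \<alpha>': "poly_matrix G \<alpha>" using \<alpha> by (simp add: unitriangular_def)
  have mj: "?m j e \<in> ?N" if "e \<in> grid_chains G" for e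
    unfolding ideal_chains_def
    using chains_smult[OF poly_ring_mvar[OF j(2)] that] mvar_ideal_mvar_mult[OF j chains_value[OF that]] by simp
  have cancel: "e \<in> ?N" if "?m i e \<in> ?N" "e \<in> grid_chains G" for e
    using that i(1) mvar_ideal_cancel[OF _ i(1) chains_value] by (auto simp: ideal_chains_def)
  have drop: "x \<in> ?N" if "x + y \<in> ?N" "y \<in> ?N" for x y
    using ideal_chains_add[OF that] by (simp only: add.assoc chain_char2 add_0_right)
  note closed = chains_add matrix_map_chains[OF D] matrix_map_chains[OF H] matrix_map_chains[OF \<alpha>'] matrix_map_chains[OF \<beta>]
  obtain a e where u: "u = a + ?m i e" "a \<in> ?N" "e \<in> grid_chains G" using ideal_chains_insert[OF c(4)] .
  \<comment> \<open>Only the multiple of \<open>mvar i\<close> survives modulo the ideal, so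
    \<open>e\<close> is a cycle there.\<close>
  have "?d c = ?m i (?d e) + ?d a"
    unfolding c(2) u(1) matrix_map_add matrix_map_smult dd by (simp add: add.commute)
  then have "?m i (?d e) \<in> ?N"
    using c(1) matrix_map_ideal_chains[OF D u(2)] drop by metis
  then have de: "?d e \<in> ?N" using cancel closed u(3) by blast
  \<comment> \<open>The formula turns \<open>mvar i\<close> times a value of \<open>\<alpha>\<close>
    into a boundary when the argument is a cycle, so \<open>e\<close> has to be such a
    value.\<close>
  obtain e' where e': "e' \<in> grid_chains G" "matrix_map G \<alpha> e' = e" using unitriangular_surj[OF \<alpha> u(3)] by blast
  \<comment> \<open>Two evaluations of \<open>?d (?h (?d e'))\<close>: the formula at
    \<open>?d e'\<close>, and \<open>?d\<close> applied to the formula at \<open>e'\<close>.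
    Comparing them puts \<open>\<alpha>\<close> of \<open>?d e'\<close> into the ideal, hence
    \<open>e'\<close> is a cycle modulo it.\<close>
  have "?d (?h (?d e')) = ?m i (matrix_map G \<alpha> (?d e')) + ?m j (matrix_map G \<beta> (?d e'))"
    using dh[of "?d e'"] by (simp only: dd matrix_map_0 add_0)
  moreover have "?d (?h (?d e')) = ?m i (?d e) + ?m j (?d (matrix_map G \<beta> e'))"
    using arg_cong[OF dh[of e'], of ?d] by (simp only: matrix_map_add matrix_map_smult dd e'(2) add_0_right)
  moreover have "?m i (?d e) + ?m j (?d (matrix_map G \<beta> e')) \<in> ?N"
    using \<open>?m i (?d e) \<in> ?N\<close> mj closed e'(1) by (intro ideal_chains_add) auto
  ultimately have "?m i (matrix_map G \<alpha> (?d e')) \<in> ?N"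
    using drop mj[of "matrix_map G \<beta> (?d e')"] closed e'(1) by metis
  then have "matrix_map G \<alpha> (?d e') \<in> ?N" using cancel closed e'(1) by blast
  then have de': "?d e' \<in> ?N" using unitriangular_reflect[OF \<alpha>] closed e'(1) by blast
  have eq: "?m i e + ?d (?h e') = ?h (?d e') + ?m j (matrix_map G \<beta> e')"
  proof -
    have "?m i e + ?d (?h e') = (?h (?d e') + ?h (?d e')) + ?m i e + ?d (?h e')"
      by (simp only: chain_char2 add_0)
    also have "\<dots> = ?h (?d e') + ?m i e + (?h (?d e') + ?d (?h e'))" by (simp only: add_ac)
    also have "\<dots> = ?h (?d e') + ?m j (matrix_map G \<beta> e') + (?m i e + ?m i e)"
      unfolding dh e'(2) by (simp only: add_ac)
    finally show ?thesis by (simp only: chain_char2 add_0_right)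
  qed
  have "c + ?d (b + ?h e') = a + (?m i e + ?d (?h e')) + (?d b + ?d b)"
    unfolding c(2) u(1) matrix_map_add by (simp only: add_ac)
  also have "\<dots> = a + (?h (?d e') + ?m j (matrix_map G \<beta> e'))"
    unfolding eq chain_char2 by simp
  also have "\<dots> \<in> ?N"
    using u(2) matrix_map_ideal_chains[OF H de'] mj closed e'(1) by (intro ideal_chains_add) auto
  finally show ?thesis using c(3) closed e'(1) by blast
qed


section \<open>Rectangles between grid states\<close>

text \<open>Elements of \<open>Rect\<close> are stored as a corner with side lengths; this converts
  from pairs of end points.\<close>

definition arc_length :: "nat \<Rightarrow> nat \<Rightarrow> nat \<Rightarrow> nat" where
  "arc_length n p q = (if p < q then q - p else n - p + q)"

lemma arc_length_bounds:
  assumes "p < n" "q < n" "p \<noteq> q"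
  shows "0 < arc_length n p q" "arc_length n p q < n" "(p + arc_length n p q) mod n = q"
proof -
  show "0 < arc_length n p q" "arc_length n p q < n" using assms by (auto simp: arc_length_def)
  show "(p + arc_length n p q) mod n = q"
  proof (cases "p < q")
    case False
    then have "p + arc_length n p q = n + q" using assms by (simp add: arc_length_def)
    then show ?thesis using assms by simp
  qed (use assms in \<open>simp add: arc_length_def\<close>)
qed

lemma mod_shift_eq: "p < n \<Longrightarrow> i < n \<Longrightarrow> (p + i) mod n = (if p + i < n then p + i else p + i - n)" for p i n :: nat
  by (simp add: mod_if)

lemma arc_length_mod:
  assumes "p < n" "0 < w" "w < n"
  shows "(p + w) mod n < n" "(p + w) mod n \<noteq> p" "arc_length n p ((p + w) mod n) = w"
  using assms by (auto simp: mod_shift_eq arc_length_def)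

lemma arc_image:
  assumes "p < n" "q < n" "p \<noteq> q"
  shows "arc n p q = (\<lambda>i. (p + i) mod n) ` {..<arc_length n p q}"
proof (intro equalityI subsetI)
  fix c assume c: "c \<in> arc n p q"
  define i where "i = (if p \<le> c then c - p else n - p + c)"
  have "i < arc_length n p q" "i < n" "(p + i) mod n = c"
    using c assms by (auto simp: i_def arc_def arc_length_def mod_shift_eq split: if_splits)
  then show "c \<in> (\<lambda>i. (p + i) mod n) ` {..<arc_length n p q}" by auto
next
  fix c assume "c \<in> (\<lambda>i. (p + i) mod n) ` {..<arc_length n p q}"
  then obtain i where i: "i < arc_length n p q" "c = (p + i) mod n" by auto
  then show "c \<in> arc n p q"
    using arc_length_bounds(2)[OF assms] assms by (auto simp: mod_shift_eq arc_def arc_length_def split: if_splits)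
qed

lemma arc_open_image:
  assumes "p < n" "q < n" "p \<noteq> q"
  shows "arc n p q - {p} = (\<lambda>i. (p + i) mod n) ` {0<..<arc_length n p q}"
proof -
  have "(p + i) mod n = p \<longleftrightarrow> i = 0" if "i < arc_length n p q" for i
    using that arc_length_bounds(2)[OF assms] assms by (auto simp: mod_shift_eq)
  then show ?thesis unfolding arc_image[OF assms] by auto
qed

context marked_grid
begin

definition graph :: "(nat \<Rightarrow> nat) \<Rightarrow> state" where
  "graph \<sigma> = (\<lambda>i. (i, \<sigma> i)) ` {..<n}"

lemma mem_graph [simp]: "(i, j) \<in> graph \<sigma> \<longleftrightarrow> i < n \<and> j = \<sigma> i"
  by (auto simp: graph_def)

lemma perms_less: "\<sigma> \<in> perms \<Longrightarrow> \<sigma> i < n \<longleftrightarrow> i < n"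
  using permutes_in_image[of \<sigma> "{..<n}" i] by (simp add: perms_def)

lemma perms_eq_iff: "\<sigma> \<in> perms \<Longrightarrow> \<sigma> i = \<sigma> j \<longleftrightarrow> i = j"
  using permutes_inj[of \<sigma> "{..<n}"] by (simp add: perms_def inj_eq)

lemma perms_outside: "\<sigma> \<in> perms \<Longrightarrow> \<not> i < n \<Longrightarrow> \<sigma> i = i"
  by (simp add: perms_def permutes_def)

lemma graph_state:
  assumes "\<sigma> \<in> perms" shows "graph \<sigma> \<in> grid_states G"
  unfolding grid_states_def mem_Collect_eq
proof (intro conjI allI impI)
  show "graph \<sigma> \<subseteq> {..<n} \<times> {..<n}" using perms_less[OF assms] by (auto simp: graph_def)
  show "\<exists>!p. p \<in> graph \<sigma> \<and> fst p = i" if "i < n" for i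
    using that by (intro ex1I[of _ "(i, \<sigma> i)"]) auto
  show "\<exists>!p. p \<in> graph \<sigma> \<and> snd p = j" if "j < n" for j
  proof -
    obtain i where i: "\<sigma> i = j" using assms permutes_surj[of \<sigma> "{..<n}"] by (metis perms_def mem_Collect_eq surjD)
    then have "i < n" using perms_less[OF assms, of i] that by simp
    then show ?thesis using i perms_eq_iff[OF assms] by (intro ex1I[of _ "(i, j)"]) auto
  qed
qed

lemma graph_inj: "inj_on graph perms"
proof (rule inj_onI)
  fix \<sigma> \<tau> assume st: "\<sigma> \<in> perms" "\<tau> \<in> perms" "graph \<sigma> = graph \<tau>"
  show "\<sigma> = \<tau>"
  proof
    fix i show "\<sigma> i = \<tau> i"
    proof (cases "i < n")
      case True
      then have "(i, \<sigma> i) \<in> graph \<tau>" using st(3)[symmetric] by simp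
      then show ?thesis by simp
    qed (use perms_outside[OF st(1)] perms_outside[OF st(2)] in simp)
  qed
qed

lemma graph_surj:
  assumes "x \<in> grid_states G" shows "\<exists>\<sigma>\<in>perms. graph \<sigma> = x"
proof -
  have x: "x \<subseteq> {..<n} \<times> {..<n}" "\<And>i. i < n \<Longrightarrow> \<exists>!p. p \<in> x \<and> fst p = i" "\<And>j. j < n \<Longrightarrow> \<exists>!p. p \<in> x \<and> snd p = j"
    using assms by (simp_all add: grid_states_def)
  have "\<exists>j. \<forall>j'. (i, j') \<in> x \<longleftrightarrow> j' = j" if "i < n" for i
    using x(2)[OF that] by (metis fst_conv snd_conv prod.collapse)
  then obtain h where h: "\<And>i j'. i < n \<Longrightarrow> (i, j') \<in> x \<longleftrightarrow> j' = h i" by metis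
  define \<sigma> where "\<sigma> i = (if i < n then h i else i)" for i
  have row: "\<sigma> i < n" if "i < n" for i using h[OF that, of "h i"] x(1) that by (auto simp: \<sigma>_def)
  have "inj_on \<sigma> {..<n}"
  proof (rule inj_onI)
    fix i j assume ij: "i \<in> {..<n}" "j \<in> {..<n}" "\<sigma> i = \<sigma> j"
    then have "(i, \<sigma> i) \<in> x" "(j, \<sigma> i) \<in> x" using h by (auto simp: \<sigma>_def)
    then show "i = j" using x(3)[of "\<sigma> i"] row ij by (metis fst_conv snd_conv lessThan_iff)
  qed
  moreover from this have "\<sigma> ` {..<n} = {..<n}" using row by (intro endo_inj_surj) auto
  ultimately have "bij_betw \<sigma> {..<n} {..<n}" by (simp add: bij_betw_def)
  then have "\<sigma> permutes {..<n}" by (rule bij_imp_permutes) (simp add: \<sigma>_def)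
  moreover have "graph \<sigma> = x"
    using x(1) h by (auto simp: \<sigma>_def graph_def image_iff)
  ultimately show ?thesis by (auto simp: perms_def)
qed

lemma graph_bij: "bij_betw graph perms (grid_states G)"
  using graph_inj graph_surj graph_state by (fastforce simp: bij_betw_def)

definition perm_of :: "state \<Rightarrow> nat \<Rightarrow> nat" where
  "perm_of = inv_into perms graph"

lemma perm_of: "x \<in> grid_states G \<Longrightarrow> perm_of x \<in> perms" "x \<in> grid_states G \<Longrightarrow> graph (perm_of x) = x"
  "\<sigma> \<in> perms \<Longrightarrow> perm_of (graph \<sigma>) = \<sigma>"
proof -
  have im: "graph ` perms = grid_states G" using graph_bij by (simp add: bij_betw_def)
  show "perm_of x \<in> perms" "graph (perm_of x) = x" if "x \<in> grid_states G"
    using that inv_into_into[of x graph perms] f_inv_into_f[of x graph perms] unfolding perm_of_def im by auto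
  show "perm_of (graph \<sigma>) = \<sigma>" if "\<sigma> \<in> perms"
    unfolding perm_of_def using graph_inj that by (rule inv_into_f_f)
qed

definition box_rect :: "(nat \<Rightarrow> nat) \<Rightarrow> nat \<times> nat \<Rightarrow> rect" where
  "box_rect \<sigma> P = ((fst P, \<sigma> (fst P)), (arc_length n (fst P) (snd P), arc_length n (\<sigma> (fst P)) (\<sigma> (snd P))))"

lemma box_rect_inj: "inj_on (box_rect \<sigma>) col_pairs"
proof (rule inj_onI)
  fix P P' assume P: "P \<in> col_pairs" "P' \<in> col_pairs" "box_rect \<sigma> P = box_rect \<sigma> P'"
  obtain p q p' q' where PP: "P = (p, q)" "P' = (p', q')" by fastforce
  have lt: "p < n" "q < n" "p \<noteq> q" "p' < n" "q' < n" "p' \<noteq> q'"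
    using P(1,2) by (auto simp: PP col_pairs_def)
  have e: "p = p'" "arc_length n p q = arc_length n p' q'"
    using P(3) unfolding PP box_rect_def fst_conv snd_conv prod.inject by blast+
  have "q = (p + arc_length n p q) mod n" using arc_length_bounds(3)[OF lt(1-3)] by simp
  also have "\<dots> = q'" unfolding e(2) unfolding e(1) by (rule arc_length_bounds(3)[OF lt(4-6)])
  finally show "P = P'" using e PP by simp
qed

text \<open>The two points that leave the state are the southwest and northeast corners, so their
  columns are the pair; the side lengths are those of the two arcs.\<close>

lemma Rect_graph:
  assumes \<sigma>: "\<sigma> \<in> perms" and \<tau>: "\<tau> \<in> perms"
  shows "Rect G (graph \<sigma>) (graph \<tau>) = box_rect \<sigma> ` {P \<in> col_pairs. swap_cols \<sigma> P = \<tau>}"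
proof (intro equalityI subsetI)
  fix r assume "r \<in> Rect G (graph \<sigma>) (graph \<tau>)"
  then obtain a b w h where r: "r = ((a, b), (w, h))" "a < n" "b < n" "0 < w" "w < n" "0 < h" "h < n"
    and d: "graph \<sigma> - graph \<tau> = {tor G a b, tor G (a + w) (b + h)}"
      "graph \<tau> - graph \<sigma> = {tor G (a + w) b, tor G a (b + h)}"
    unfolding Rect_def by blast
  define q where "q = (a + w) mod n"
  define s where "s = (b + h) mod n"
  have t: "tor G a b = (a, b)" "tor G (a + w) (b + h) = (q, s)" "tor G (a + w) b = (q, b)" "tor G a (b + h) = (a, s)"
    using r by (simp_all add: tor_def q_def s_def)
  have q: "q < n" "q \<noteq> a" "arc_length n a q = w" using arc_length_mod r by (simp_all add: q_def)
  have s: "arc_length n b s = h" using arc_length_mod r by (simp add: s_def)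
  have "(a, b) \<in> graph \<sigma>" "(q, s) \<in> graph \<sigma>" "(q, b) \<in> graph \<tau>" "(a, s) \<in> graph \<tau>"
    using d unfolding t by blast+
  then have v: "\<sigma> a = b" "\<sigma> q = s" "\<tau> q = b" "\<tau> a = s" by simp_all
  have "swap_cols \<sigma> (a, q) = \<tau>"
  proof
    fix i
    consider "i = a" | "i = q" | "i \<noteq> a" "i \<noteq> q" "i < n" | "\<not> i < n" by blast
    then show "swap_cols \<sigma> (a, q) i = \<tau> i"
    proof cases
      case 3
      then have "(i, \<sigma> i) \<in> graph \<sigma>" "(i, \<sigma> i) \<notin> graph \<sigma> - graph \<tau>" unfolding d t by auto
      then have "(i, \<sigma> i) \<in> graph \<tau>" by blast
      then show ?thesis using 3 by (simp add: swap_cols_def)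
    next
      case 4
      then have "i \<noteq> a" "i \<noteq> q" using r q by auto
      then show ?thesis using perms_outside[OF \<sigma> 4] perms_outside[OF \<tau> 4] by (simp add: swap_cols_def)
    qed (use v in \<open>simp_all add: swap_cols_def\<close>)
  qed
  moreover have "(a, q) \<in> col_pairs" using r q by (auto simp: col_pairs_def)
  moreover have "r = box_rect \<sigma> (a, q)" using r q s v by (simp add: box_rect_def)
  ultimately show "r \<in> box_rect \<sigma> ` {P \<in> col_pairs. swap_cols \<sigma> P = \<tau>}" by blast
next
  fix r assume "r \<in> box_rect \<sigma> ` {P \<in> col_pairs. swap_cols \<sigma> P = \<tau>}"
  then obtain p q where pq: "p < n" "q < n" "p \<noteq> q" "swap_cols \<sigma> (p, q) = \<tau>" "r = box_rect \<sigma> (p, q)"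
    by (auto simp: col_pairs_def)
  have lt: "\<sigma> p < n" "\<sigma> q < n" "\<sigma> p \<noteq> \<sigma> q" using perms_less perms_eq_iff \<sigma> pq by auto
  note b = arc_length_bounds[OF pq(1-3)] arc_length_bounds[OF lt]
  have \<tau>v: "\<tau> p = \<sigma> q" "\<tau> q = \<sigma> p" "\<And>i. i \<noteq> p \<Longrightarrow> i \<noteq> q \<Longrightarrow> \<tau> i = \<sigma> i"
    using pq(4) by (auto simp: swap_cols_def)
  have \<tau>_eq: "\<tau> i = \<sigma> i \<longleftrightarrow> i \<noteq> p \<and> i \<noteq> q" for i using \<tau>v lt by metis
  have "graph \<sigma> \<inter> graph \<tau> = (\<lambda>i. (i, \<sigma> i)) ` ({..<n} - {p, q})"
    using \<tau>_eq by (auto simp: graph_def image_iff) metis+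
  then have "card (graph \<sigma> \<inter> graph \<tau>) = n - 2"
    using pq by (simp add: card_image inj_on_def card_Diff_subset)
  moreover have "graph \<sigma> - graph \<tau> = {(p, \<sigma> p), (q, \<sigma> q)}"
  proof (rule Set.set_eqI)
    fix z :: "nat \<times> nat"
    obtain i j where z: "z = (i, j)" by (cases z)
    have "\<sigma> i = \<tau> i \<longleftrightarrow> i \<noteq> p \<and> i \<noteq> q" using \<tau>_eq[of i] by auto
    then show "z \<in> graph \<sigma> - graph \<tau> \<longleftrightarrow> z \<in> {(p, \<sigma> p), (q, \<sigma> q)}"
      using pq(1,2) by (auto simp: z)
  qed
  moreover have "graph \<tau> - graph \<sigma> = {(q, \<sigma> p), (p, \<sigma> q)}"
  proof (rule Set.set_eqI)
    fix z :: "nat \<times> nat"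
    obtain i j where z: "z = (i, j)" by (cases z)
    show "z \<in> graph \<tau> - graph \<sigma> \<longleftrightarrow> z \<in> {(q, \<sigma> p), (p, \<sigma> q)}"
      using pq(1,2) \<tau>v(1,2) \<tau>_eq[of i] by (auto simp: z)
  qed
  ultimately show "r \<in> Rect G (graph \<sigma>) (graph \<tau>)"
    unfolding Rect_def pq(5) box_rect_def using b pq lt n_ge_2 by (simp add: tor_def)
qed

lemma rect_squares_box:
  assumes "\<sigma> \<in> perms" "P \<in> col_pairs"
  shows "rect_squares G (box_rect \<sigma> P) = box_squares \<sigma> P"
proof -
  obtain p q where P: "P = (p, q)" by (cases P)
  have lt: "p < n" "q < n" "p \<noteq> q" using assms(2) by (auto simp: P col_pairs_def)
  then have lt': "\<sigma> p < n" "\<sigma> q < n" "\<sigma> p \<noteq> \<sigma> q" using perms_less perms_eq_iff assms(1) by auto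
  show ?thesis
    unfolding P box_squares_def box_rect_def fst_conv snd_conv arc_image[OF lt] arc_image[OF lt']
    by (auto simp: tor_def)
qed

lemma card_rect_interior_box:
  assumes "\<sigma> \<in> perms" "P \<in> col_pairs"
  shows "card (rect_interior G (box_rect \<sigma> P) \<inter> graph \<sigma>) = card (box_points \<sigma> P)"
proof -
  obtain p q where P: "P = (p, q)" by (cases P)
  have lt: "p < n" "q < n" "p \<noteq> q" using assms(2) by (auto simp: P col_pairs_def)
  then have lt': "\<sigma> p < n" "\<sigma> q < n" "\<sigma> p \<noteq> \<sigma> q" using perms_less perms_eq_iff assms(1) by auto
  have "rect_interior G (box_rect \<sigma> P) = (arc n p q - {p}) \<times> (arc n (\<sigma> p) (\<sigma> q) - {\<sigma> p})"
    unfolding P box_rect_def fst_conv snd_conv arc_open_image[OF lt] arc_open_image[OF lt']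
    by (auto simp: tor_def; blast)
  then have "rect_interior G (box_rect \<sigma> P) \<inter> graph \<sigma> = (\<lambda>i. (i, \<sigma> i)) ` box_points \<sigma> P"
    using arc_subset[of q n p] lt by (auto simp: P box_points_def)
  then show ?thesis by (simp add: card_image inj_on_def)
qed

text \<open>At the value 0 of the indeterminate the marked X kills a rectangle like any other X,
  which leaves the rectangles counted by the boundary.\<close>

lemma coeff_0_box_weight:
  assumes "\<sigma> \<in> perms" "P \<in> col_pairs"
  shows "coeff (box_weight \<sigma> P) 0 =
    (if rect_squares G (box_rect \<sigma> P) \<inter> Xpos G ` {1..n} = {} then rect_weight G (graph \<sigma>) (box_rect \<sigma> P) else 0)"
proof -
  have fin: "finite (box_squares \<sigma> P)" by (simp add: box_squares_def)
  have "coeff (prod wX (box_squares \<sigma> P)) 0 = of_bool (box_squares \<sigma> P \<inter> Xs = {})"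
  proof (cases "box_squares \<sigma> P \<inter> Xs = {}")
    case True
    then have "coeff (wX s) 0 = 1" if "s \<in> box_squares \<sigma> P" for s using that X0(1) by (auto simp: wX_def)
    then show ?thesis using True by (simp add: coeff_0_prod)
  next
    case False
    then obtain s where s: "s \<in> box_squares \<sigma> P" "s \<in> Xs" by blast
    then have "coeff (wX s) 0 = 0" by (simp add: wX_def)
    then show ?thesis using False s fin unfolding coeff_0_prod by (auto intro!: prod_zero)
  qed
  moreover have "coeff (prod wO (box_squares \<sigma> P)) 0 = (\<Prod>i\<in>{1..n}. mvar i ^ of_bool (Opos G i \<in> box_squares \<sigma> P))"
    using fin by (simp add: prod_wO coeff_0_prod coeff_0_power)
  moreover have "coeff (box_weight \<sigma> P) 0 = coeff (prod wX (box_squares \<sigma> P)) 0 *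
      coeff (prod wO (box_squares \<sigma> P)) 0 * mvar 0 ^ card (box_points \<sigma> P)"
    by (simp add: box_weight_def wt_def prod.distrib coeff_mult coeff_0_power)
  ultimately show ?thesis
    unfolding rect_weight_def rect_squares_box[OF assms] card_rect_interior_box[OF assms] Xs_def by simp
qed

section \<open>The boundary and the homotopy as matrices\<close>

definition D_matrix :: "state \<Rightarrow> state \<Rightarrow> mpoly" where
  "D_matrix x y = coeff (edge_weight (perm_of x) (perm_of y)) 0"

text \<open>Degree 1 selects the rectangles that contain the marked X and no other X.\<close>

definition H_matrix :: "state \<Rightarrow> state \<Rightarrow> mpoly" where
  "H_matrix x y = coeff (edge_weight (perm_of x) (perm_of y)) 1"

lemma boundary_matrix: "boundary G = matrix_map G D_matrix"
proof -
  have "(\<Sum>r\<in>Rect_noX G x y. rect_weight G x r) = D_matrix x y" if "x \<in> grid_states G" "y \<in> grid_states G" for x y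
  proof -
    define \<sigma> \<tau> where "\<sigma> = perm_of x" and "\<tau> = perm_of y"
    have \<sigma>: "\<sigma> \<in> perms" "graph \<sigma> = x" and \<tau>: "\<tau> \<in> perms" "graph \<tau> = y"
      using that perm_of by (auto simp: \<sigma>_def \<tau>_def)
    let ?A = "{P \<in> col_pairs. swap_cols \<sigma> P = \<tau>}" and ?noX = "\<lambda>r. rect_squares G r \<inter> Xpos G ` {1..n} = {}"
    have R: "Rect G x y = box_rect \<sigma> ` ?A" using Rect_graph[OF \<sigma>(1) \<tau>(1)] \<sigma>(2) \<tau>(2) by simp
    have "finite ?A" using finite_col_pairs by simp
    then have fin: "finite (Rect G x y)" unfolding R by simp
    have "(\<Sum>r\<in>Rect_noX G x y. rect_weight G x r) = (\<Sum>r\<in>Rect G x y. if ?noX r then rect_weight G x r else 0)"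
      unfolding Rect_noX_def using fin by (rule sum.inter_filter)
    also have "\<dots> = (\<Sum>P\<in>?A. coeff (box_weight \<sigma> P) 0)"
      unfolding R using \<sigma> coeff_0_box_weight[OF \<sigma>(1)]
      by (subst sum.reindex) (auto intro: inj_on_subset[OF box_rect_inj])
    also have "\<dots> = D_matrix x y"
      by (simp add: D_matrix_def edge_weight_def coeff_sum \<sigma>_def \<tau>_def)
    finally show ?thesis .
  qed
  then show ?thesis
    by (auto simp: boundary_def matrix_map_def fun_eq_iff intro!: sum.cong)
qed

lemma coeff_prod_carrier:
  assumes "\<And>x k. x \<in> A \<Longrightarrow> coeff (h x) k \<in> carrier (poly_ring I)"
  shows "coeff (prod h A) k \<in> carrier (poly_ring I)"
  using assms
  by (induction A arbitrary: k rule: infinite_finite_induct)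
    (auto simp: coeff_mult coeff_1 intro: poly_ring_0 poly_ring_1 intro!: poly_ring_sum poly_ring_mult)

lemma coeff_wt_carrier: "coeff (wt s) k \<in> carrier (poly_ring {0..n})"
proof -
  have "coeff (wX s) k \<in> carrier (poly_ring {0..n})" for k
    by (auto simp: wX_def coeff_pCons coeff_1 poly_ring_0 poly_ring_1 split: nat.split)
  moreover have "coeff (wO s) k \<in> carrier (poly_ring {0..n})" for k
    unfolding wO_def
    by (rule coeff_prod_carrier) (auto simp: coeff_pCons coeff_1 poly_ring_0 poly_ring_1 poly_ring_mvar split: nat.split)
  ultimately show ?thesis
    by (auto simp: wt_def coeff_mult intro!: poly_ring_sum poly_ring_mult)
qed

lemma coeff_edge_weight_carrier: "coeff (edge_weight \<sigma> \<tau>) k \<in> carrier (poly_ring {0..n})"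
proof -
  have "coeff ([:mvar 0:] ^ m) k \<in> carrier (poly_ring {0..n})" for m k
    using coeff_prod_carrier[of "{..<m}" "\<lambda>_. [:mvar 0:]" "{0..n}" k]
    by (auto simp: coeff_pCons poly_ring_0 poly_ring_mvar split: nat.splits)
  then have "coeff (box_weight \<sigma> P) k \<in> carrier (poly_ring {0..n})" for P
    unfolding box_weight_def coeff_mult
    by (intro poly_ring_sum poly_ring_mult coeff_prod_carrier coeff_wt_carrier)
  then show ?thesis by (simp add: edge_weight_def coeff_sum poly_ring_sum)
qed

lemma poly_matrices: "poly_matrix G D_matrix" "poly_matrix G H_matrix"
  by (simp_all add: poly_matrix_def D_matrix_def H_matrix_def coeff_edge_weight_carrier)

lemma sum_states: "(\<Sum>y\<in>grid_states G. h (perm_of y)) = (\<Sum>\<rho>\<in>perms. h \<rho>)"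
  using sum.reindex_bij_betw[OF graph_bij, of "\<lambda>y. h (perm_of y)"] by (simp add: perm_of)

text \<open>Diagonal entries of the squared matrix are multiples of the indeterminate, and the
  others lie in \<open>lower_terms\<close>; both have constant coefficient 0.\<close>

lemma D_matrix_square:
  assumes "x \<in> grid_states G"
  shows "(\<Sum>y\<in>grid_states G. D_matrix x y * D_matrix y z) = 0"
proof -
  have "(\<Sum>y\<in>grid_states G. D_matrix x y * D_matrix y z) =
    coeff (\<Sum>\<rho>\<in>perms. edge_weight (perm_of x) \<rho> * edge_weight \<rho> (perm_of z)) 0"
    unfolding D_matrix_def using sum_states[of "\<lambda>\<rho>. coeff (edge_weight (perm_of x) \<rho>) 0 * coeff (edge_weight \<rho> (perm_of z)) 0"]
    by (simp add: coeff_sum coeff_mult)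
  also have "\<dots> = 0"
    using edge_weight_mult_same[OF perm_of(1)[OF assms]] edge_weight_mult_distinct[OF perm_of(1)[OF assms], of "perm_of z"]
    by (cases "perm_of x = perm_of z") (auto simp: lower_terms_def)
  finally show ?thesis .
qed

text \<open>The coefficient of degree 1 of a product is the sum of the two mixed products. On the
  diagonal it is the sum of two variables, so both entries are 1; elsewhere they are witnesses from
  \<open>lower_terms\<close>.\<close>

lemma homotopy_matrices:
  obtains \<alpha> \<beta> where "unitriangular G (potential \<circ> perm_of) \<alpha>" "unitriangular G (potential \<circ> perm_of) \<beta>"
    "\<And>x z. x \<in> grid_states G \<Longrightarrow> z \<in> grid_states G \<Longrightarrow>
      (\<Sum>y\<in>grid_states G. D_matrix x y * H_matrix y z) + (\<Sum>y\<in>grid_states G. H_matrix x y * D_matrix y z) =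
      mvar Orow * \<alpha> x z + mvar Ocol * \<beta> x z"
proof -
  let ?P = "carrier (poly_ring {0..n})"
  define S where "S x z = (\<Sum>y\<in>grid_states G. D_matrix x y * H_matrix y z) + (\<Sum>y\<in>grid_states G. H_matrix x y * D_matrix y z)" for x z
  have S: "S x z = coeff (\<Sum>\<rho>\<in>perms. edge_weight (perm_of x) \<rho> * edge_weight \<rho> (perm_of z)) 1" for x z
    unfolding S_def D_matrix_def H_matrix_def coeff_sum coeff_1_mult sum.distrib
    using sum_states[of "\<lambda>\<rho>. coeff (edge_weight (perm_of x) \<rho>) 0 * coeff (edge_weight \<rho> (perm_of z)) 1"]
      sum_states[of "\<lambda>\<rho>. coeff (edge_weight (perm_of x) \<rho>) 1 * coeff (edge_weight \<rho> (perm_of z)) 0"] by simp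
  have "\<exists>a b. a \<in> ?P \<and> b \<in> ?P \<and> S x z = mvar Orow * a + mvar Ocol * b \<and>
      (if x = z then a = 1 \<and> b = 1 else a = 0 \<and> b = 0 \<or> potential (perm_of z) < potential (perm_of x))"
    if xz: "x \<in> grid_states G" "z \<in> grid_states G" for x z
  proof (cases "x = z")
    case True
    then show ?thesis
      unfolding S using edge_weight_mult_same[OF perm_of(1)[OF xz(1)]]
      by (intro exI[of _ 1]) (simp add: poly_ring_1)
  next
    case False
    then have "perm_of x \<noteq> perm_of z" using xz perm_of(2) by metis
    from edge_weight_mult_distinct[OF perm_of(1)[OF xz(1)] this] show ?thesis
      unfolding S lower_terms_def using False by auto
  qed
  then obtain \<alpha> \<beta> where ab: "\<And>x z. x \<in> grid_states G \<Longrightarrow> z \<in> grid_states G \<Longrightarrow>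
      \<alpha> x z \<in> ?P \<and> \<beta> x z \<in> ?P \<and> S x z = mvar Orow * \<alpha> x z + mvar Ocol * \<beta> x z \<and>
      (if x = z then \<alpha> x z = 1 \<and> \<beta> x z = 1
       else \<alpha> x z = 0 \<and> \<beta> x z = 0 \<or> potential (perm_of z) < potential (perm_of x))"
    by metis
  have "unitriangular G (potential \<circ> perm_of) \<alpha>" "unitriangular G (potential \<circ> perm_of) \<beta>"
    unfolding unitriangular_def poly_matrix_def using ab by (auto split: if_splits) metis+
  then show ?thesis using that ab unfolding S_def by blast
qed

theorem boundary_step:
  assumes ij: "i = Orow \<and> j = Ocol \<or> i = Ocol \<and> j = Orow" and "i \<notin> K" "j \<in> K"
    and "boundary G c \<in> ideal_chains G K" "c = boundary G b + u" "b \<in> grid_chains G" "u \<in> ideal_chains G (insert i K)"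
  shows "\<exists>b'\<in>grid_chains G. c + boundary G b' \<in> ideal_chains G K"
proof -
  obtain \<alpha> \<beta> where ab: "unitriangular G (potential \<circ> perm_of) \<alpha>" "unitriangular G (potential \<circ> perm_of) \<beta>"
    and DH: "\<And>x z. x \<in> grid_states G \<Longrightarrow> z \<in> grid_states G \<Longrightarrow>
      (\<Sum>y\<in>grid_states G. D_matrix x y * H_matrix y z) + (\<Sum>y\<in>grid_states G. H_matrix x y * D_matrix y z) =
      mvar Orow * \<alpha> x z + mvar Ocol * \<beta> x z" by (rule homotopy_matrices) (rule that; assumption)
  note p = ab[unfolded unitriangular_def, THEN conjunct1]
  have O: "Orow \<in> {0..n}" "Ocol \<in> {0..n}" using Orow Ocol by auto
  note step = homotopy_unitriangular_step[OF poly_matrices _ _ D_matrix_square, folded boundary_matrix,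
      OF _ _ _ _ assms(2) _ assms(3) _ assms(4-)]
  from ij show ?thesis
  proof
    assume e: "i = Orow \<and> j = Ocol"
    show ?thesis
      by (rule step[OF ab(1) p(2)]) (use e O in \<open>simp_all add: DH\<close>)
  next
    assume e: "i = Ocol \<and> j = Orow"
    show ?thesis
      by (rule step[OF ab(2) p(1)]) (use e O in \<open>simp_all add: DH add.commute\<close>)
  qed
qed

end


section \<open>Homology classes\<close>

definition chain_coset :: "chain set \<Rightarrow> chain \<Rightarrow> chain set" where
  "chain_coset N c = (\<lambda>x. x + c) ` N"

lemma chain_add_swap: "(a :: chain) + b = c \<longleftrightarrow> a = c + b"
proof
  assume "a + b = c"
  then have "c + b = a + (b + b)" by (simp only: add.assoc[symmetric])
  then show "a = c + b" by (simp only: chain_char2 add_0_right)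
next
  assume "a = c + b"
  then have "a + b = c + (b + b)" by (simp only: add.assoc)
  then show "a + b = c" by (simp only: chain_char2 add_0_right)
qed

locale chain_subgroup =
  fixes N :: "chain set"
  assumes zero_mem: "0 \<in> N" and add_mem: "\<And>c d. c \<in> N \<Longrightarrow> d \<in> N \<Longrightarrow> c + d \<in> N"
begin

lemma mem_chain_coset: "x \<in> chain_coset N c \<longleftrightarrow> x + c \<in> N"
  unfolding chain_coset_def image_iff using chain_add_swap by metis

lemma chain_coset_eq_iff: "chain_coset N c = chain_coset N c' \<longleftrightarrow> c + c' \<in> N"
proof
  assume "chain_coset N c = chain_coset N c'"
  moreover have "c \<in> chain_coset N c" using zero_mem by (simp add: mem_chain_coset chain_char2)
  ultimately show "c + c' \<in> N" by (simp add: mem_chain_coset)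
next
  assume cc: "c + c' \<in> N"
  have "x + c \<in> N \<longleftrightarrow> x + c' \<in> N" for x
  proof -
    have 1: "x + c' = (x + c) + (c + c')" by (simp only: add.assoc chain_add_cancel)
    have 2: "x + c = (x + c') + (c + c')"
      by (simp only: add.commute[of c c'] add.assoc chain_add_cancel)
    show ?thesis using add_mem[OF _ cc] 1 2 by metis
  qed
  then show "chain_coset N c = chain_coset N c'" by (auto simp: mem_chain_coset)
qed

lemma chain_coset_map:
  assumes "\<And>c c'. h (c + c') = h c + h c'" "\<And>c. c \<in> N \<Longrightarrow> h c \<in> N"
  shows "(\<Union>x\<in>chain_coset N c. chain_coset N (h x)) = chain_coset N (h c)"
proof -
  have "chain_coset N (h x) = chain_coset N (h c)" if "x \<in> chain_coset N c" for x
    using that assms(2)[of "x + c"] unfolding chain_coset_eq_iff mem_chain_coset assms(1) by blast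
  moreover have "c \<in> chain_coset N c" using zero_mem by (simp add: mem_chain_coset chain_char2)
  ultimately show ?thesis by blast
qed

lemma chain_coset_add: "(\<Union>x\<in>chain_coset N c. \<Union>y\<in>chain_coset N c'. {x + y}) = chain_coset N (c + c')"
proof (intro equalityI subsetI)
  fix z assume "z \<in> (\<Union>x\<in>chain_coset N c. \<Union>y\<in>chain_coset N c'. {x + y})"
  then obtain x y where xy: "x + c \<in> N" "y + c' \<in> N" "z = x + y" by (auto simp: mem_chain_coset)
  have "z + (c + c') = (x + c) + (y + c')" unfolding xy(3) by (simp only: add_ac)
  then show "z \<in> chain_coset N (c + c')" unfolding mem_chain_coset using add_mem[OF xy(1,2)] by (simp only:)
next
  fix z assume z: "z \<in> chain_coset N (c + c')"
  have "z + c' \<in> chain_coset N c" "c' \<in> chain_coset N c'"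
    using z zero_mem by (simp_all add: mem_chain_coset chain_char2 add_ac)
  moreover have "z = (z + c') + c'" by (simp only: add.assoc chain_char2 add_0_right)
  ultimately show "z \<in> (\<Union>x\<in>chain_coset N c. \<Union>y\<in>chain_coset N c'. {x + y})" by blast
qed

end

locale grid_quotient =
  fixes G :: grid and K :: "nat set"
  assumes grid: "grid_diagram G" and K: "K \<subseteq> {1..gsize G}"
begin

abbreviation N :: "chain set" where "N \<equiv> ideal_chains G K"
abbreviation d :: "chain \<Rightarrow> chain" where "d \<equiv> boundary G"

sublocale chain_subgroup N
  by unfold_locales (rule ideal_chains_0, rule ideal_chains_add)

lemma marked: obtains m where "marked_grid G m"
proof -
  have "marked_grid G 1" using grid by unfold_locales (auto simp: grid_diagram_def Let_def)
  then show ?thesis by (rule that)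
qed

lemma d_ideal: "c \<in> N \<Longrightarrow> d c \<in> N"
  and d_add: "d (c + c') = d c + d c'"
  and d_smult: "d (\<lambda>x. p * c x) = (\<lambda>x. p * d c x)"
  and d_0: "d 0 = 0"
proof -
  obtain m where "marked_grid G m" by (rule marked)
  then interpret marked_grid G m .
  show "c \<in> N \<Longrightarrow> d c \<in> N" "d (c + c') = d c + d c'"
    "d (\<lambda>x. p * c x) = (\<lambda>x. p * d c x)" "d 0 = 0"
    unfolding boundary_matrix
    by (auto intro: matrix_map_ideal_chains poly_matrices simp: matrix_map_add matrix_map_smult matrix_map_0)
qed

lemma V_submodule_N: "V_submodule G K = N" by (rule V_submodule_eq[OF K])

lemma GC_coset: "A +>\<^bsub>GC_minus G\<^esub> c = chain_coset A c"
  by (auto simp: a_r_coset_def r_coset_def chain_coset_def GC_minus_simps)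

lemma quotient_module_carrier: "carrier (quotient_module M H) = (\<lambda>x. H +>\<^bsub>M\<^esub> x) ` carrier M"
  by (auto simp: quotient_module_def A_RCOSETS_def RCOSETS_def a_r_coset_def)

lemma GC_mod_carrier: "carrier (GC_mod G K) = chain_coset N ` grid_chains G"
  by (simp only: GC_mod_def quotient_module_carrier V_submodule_N GC_coset)

lemma GC_mod_add: "chain_coset N c \<oplus>\<^bsub>GC_mod G K\<^esub> chain_coset N c' = chain_coset N (c + c')"
  unfolding chain_coset_add[symmetric]
  by (simp add: GC_mod_def quotient_module_def set_add_def set_mult_def GC_minus_simps)

lemma GC_mod_zero: "\<zero>\<^bsub>GC_mod G K\<^esub> = chain_coset N 0"
  by (simp add: GC_mod_def quotient_module_def V_submodule_N chain_coset_def)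

lemma GC_mod_smult:
  assumes "p \<in> carrier (poly_ring {0..gsize G})"
  shows "p \<odot>\<^bsub>GC_mod G K\<^esub> chain_coset N c = chain_coset N (\<lambda>x. p * c x)"
proof -
  have "p \<odot>\<^bsub>GC_mod G K\<^esub> chain_coset N c = (\<Union>x\<in>chain_coset N c. chain_coset N (\<lambda>y. p * x y))"
    by (simp add: GC_mod_def quotient_module_def V_submodule_N GC_coset GC_minus_simps)
  also have "\<dots> = chain_coset N (\<lambda>x. p * c x)"
    by (rule chain_coset_map) (auto simp: fun_eq_iff algebra_simps intro: ideal_chains_smult[OF assms])
  finally show ?thesis .
qed

lemma boundary_mod_coset: "boundary_mod G K (chain_coset N c) = chain_coset N (d c)"
  unfolding boundary_mod_def induced_map_def V_submodule_N GC_coset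
  by (rule chain_coset_map) (auto intro: d_ideal simp: d_add)

text \<open>Homology classes are sets of cosets; this lists the cosets of all representatives
  \<open>c\<close> plus a boundary.\<close>

definition hclass :: "chain \<Rightarrow> chain set set" where
  "hclass c = (\<lambda>b. chain_coset N (d b + c)) ` grid_chains G"

definition cycles :: "chain set" where
  "cycles = {c \<in> grid_chains G. d c \<in> N}"

definition QM :: "(mpoly, chain set) module" where
  "QM = GC_mod G K\<lparr>carrier := {m \<in> carrier (GC_mod G K). boundary_mod G K m = \<zero>\<^bsub>GC_mod G K\<^esub>}\<rparr>"

definition BM :: "chain set set" where
  "BM = boundary_mod G K ` carrier (GC_mod G K)"

lemma GH_mod_eq: "GH_mod G K = quotient_module QM BM"
  by (simp add: GH_mod_def homology_def QM_def BM_def)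

lemma QM_simps: "x \<oplus>\<^bsub>QM\<^esub> y = x \<oplus>\<^bsub>GC_mod G K\<^esub> y" "p \<odot>\<^bsub>QM\<^esub> x = p \<odot>\<^bsub>GC_mod G K\<^esub> x"
  by (simp_all add: QM_def)

lemma BM_eq: "BM = (\<lambda>b. chain_coset N (d b)) ` grid_chains G"
  by (simp add: BM_def GC_mod_carrier image_image boundary_mod_coset)

lemma BM_coset: "BM +>\<^bsub>QM\<^esub> chain_coset N c = hclass c" "BM +>\<^bsub>GC_mod G K\<^esub> chain_coset N c = hclass c"
  by (auto simp: a_r_coset_def r_coset_def BM_eq hclass_def QM_simps GC_mod_add)

lemma QM_carrier: "carrier QM = chain_coset N ` cycles"
proof -
  have "chain_coset N (d c) = chain_coset N 0 \<longleftrightarrow> d c \<in> N" for c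
    by (simp add: chain_coset_eq_iff)
  then have "boundary_mod G K (chain_coset N c) = \<zero>\<^bsub>GC_mod G K\<^esub> \<longleftrightarrow> d c \<in> N" for c
    by (simp only: boundary_mod_coset GC_mod_zero)
  moreover have "carrier QM = {m \<in> chain_coset N ` grid_chains G. boundary_mod G K m = \<zero>\<^bsub>GC_mod G K\<^esub>}"
    by (simp add: QM_def GC_mod_carrier)
  ultimately show ?thesis by (auto simp only: cycles_def)
qed

lemma GH_carrier: "carrier (GH_mod G K) = hclass ` cycles"
  by (simp only: GH_mod_eq quotient_module_carrier QM_carrier image_image BM_coset)

lemma hclass_eq_iff: "hclass c = hclass c' \<longleftrightarrow> (\<exists>b\<in>grid_chains G. c + c' + d b \<in> N)"
proof
  assume eq: "hclass c = hclass c'"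
  have "chain_coset N (d 0 + c) \<in> hclass c" unfolding hclass_def using chains_0 by blast
  then obtain b where "b \<in> grid_chains G" "chain_coset N (d 0 + c) = chain_coset N (d b + c')"
    unfolding eq by (auto simp only: hclass_def)
  then show "\<exists>b\<in>grid_chains G. c + c' + d b \<in> N"
    by (auto simp: chain_coset_eq_iff d_0 add_ac)
next
  have sub: "hclass c \<subseteq> hclass c'" if "b \<in> grid_chains G" "c + c' + d b \<in> N" for b c c'
  proof
    fix X assume "X \<in> hclass c"
    then obtain a where a: "a \<in> grid_chains G" "X = chain_coset N (d a + c)" unfolding hclass_def by blast
    have "(d a + c) + (d (a + b) + c') = (d a + d a) + (c + c' + d b)" unfolding d_add by (simp only: add_ac)
    then have "X = chain_coset N (d (a + b) + c')"
      unfolding a(2) chain_coset_eq_iff using that(2) by (simp only: chain_char2 add_0)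
    then show "X \<in> hclass c'" unfolding hclass_def using chains_add[OF a(1) that(1)] by blast
  qed
  assume "\<exists>b\<in>grid_chains G. c + c' + d b \<in> N"
  then show "hclass c = hclass c'" using sub[of _ c c'] sub[of _ c' c] by (auto simp: add_ac)
qed

lemma GH_add: "hclass c \<oplus>\<^bsub>GH_mod G K\<^esub> hclass c' = hclass (c + c')"
proof -
  have "hclass c \<oplus>\<^bsub>GH_mod G K\<^esub> hclass c' =
    (\<Union>a\<in>grid_chains G. \<Union>b\<in>grid_chains G. {chain_coset N ((d a + c) + (d b + c'))})"
    by (simp add: GH_mod_eq quotient_module_def set_add_def set_mult_def QM_simps hclass_def GC_mod_add)
  also have "\<dots> = (\<Union>a\<in>grid_chains G. \<Union>b\<in>grid_chains G. {chain_coset N (d (a + b) + (c + c'))})"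
    by (simp only: d_add add_ac)
  also have "\<dots> = hclass (c + c')"
  proof (intro equalityI subsetI)
    fix X assume "X \<in> hclass (c + c')"
    then obtain a where "a \<in> grid_chains G" "X = chain_coset N (d (a + 0) + (c + c'))" by (auto simp: hclass_def)
    then show "X \<in> (\<Union>a\<in>grid_chains G. \<Union>b\<in>grid_chains G. {chain_coset N (d (a + b) + (c + c'))})"
      using chains_0 by blast
  qed (auto simp: hclass_def chains_add)
  finally show ?thesis .
qed

text \<open>Scalar multiplication on a quotient is a union over representatives; all of them give
  the same class because \<open>d\<close> commutes with scalars.\<close>

lemma GH_smult:
  assumes p: "p \<in> carrier (poly_ring {0..gsize G})"
  shows "p \<odot>\<^bsub>GH_mod G K\<^esub> hclass c = hclass (\<lambda>x. p * c x)"
proof -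
  have "hclass (\<lambda>x. p * (d b + c) x) = hclass (\<lambda>x. p * c x)" if b: "b \<in> grid_chains G" for b
  proof -
    have "(\<lambda>x. p * (d b + c) x) + (\<lambda>x. p * c x) + d (\<lambda>x. p * b x) = 
      (\<lambda>x. p * d b x) + (\<lambda>x. p * d b x) + ((\<lambda>x. p * c x) + (\<lambda>x. p * c x))"
      unfolding d_smult by (simp only: fun_eq_iff plus_fun_apply distrib_left add_ac) simp
    then have "(\<lambda>x. p * (d b + c) x) + (\<lambda>x. p * c x) + d (\<lambda>x. p * b x) \<in> N"
      using zero_mem by (simp only: chain_char2 add_0)
    then show ?thesis unfolding hclass_eq_iff using chains_smult[OF p b] by blast
  qed
  moreover have "p \<odot>\<^bsub>GH_mod G K\<^esub> hclass c = (\<Union>b\<in>grid_chains G. hclass (\<lambda>x. p * (d b + c) x))"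
    by (simp only: GH_mod_eq quotient_module_def module.simps QM_simps hclass_def[of c] UN_simps GC_mod_smult[OF p] BM_coset)
  ultimately show ?thesis using chains_0[of G] by blast
qed

lemma GH_zero: "\<zero>\<^bsub>GH_mod G K\<^esub> = hclass 0"
  by (simp add: GH_mod_eq quotient_module_def BM_eq hclass_def)

lemma state_class_eq: "state_class G K x = hclass (generator x)"
  by (simp only: state_class_def homology_class_def V_submodule_N GC_coset BM_def[symmetric] BM_coset)

end

text \<open>Induction on the number of labels missing from \<open>L\<close>, starting at the full
  set. \<open>connected\<close> supplies an X with one O in \<open>L\<close> and the other outside,
  so \<open>boundary_step\<close> descends from \<open>insert i L\<close> to
  \<open>L\<close>.\<close>

lemma hclass_reflect:
  assumes K: "K \<subseteq> {1..gsize G}" and grid: "grid_diagram G"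
    and connected: "\<And>L. K \<subseteq> L \<Longrightarrow> L \<subset> {1..gsize G} \<Longrightarrow>
      \<exists>m i j. marked_grid G m \<and> i \<in> {1..gsize G} - L \<and> j \<in> L \<and>
        (i = marked_grid.Orow G m \<and> j = marked_grid.Ocol G m \<or> i = marked_grid.Ocol G m \<and> j = marked_grid.Orow G m)"
    and c: "boundary G c \<in> ideal_chains G K" "b \<in> grid_chains G" "c + boundary G b \<in> ideal_chains G {1..gsize G}"
  shows "\<exists>b\<in>grid_chains G. c + boundary G b \<in> ideal_chains G K"
proof -
  have "\<exists>b\<in>grid_chains G. c + boundary G b \<in> ideal_chains G L"
    if "K \<subseteq> L" "L \<subseteq> {1..gsize G}" for L
    using that
  proof (induction "card ({1..gsize G} - L)" arbitrary: L)
    case 0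
    then have "L = {1..gsize G}" by auto
    then show ?case using c(2,3) by blast
  next
    case (Suc m)
    then have "L \<subset> {1..gsize G}" by auto
    then obtain m' i j where m': "marked_grid G m'" and i: "i \<in> {1..gsize G} - L" and j: "j \<in> L"
      and ij: "i = marked_grid.Orow G m' \<and> j = marked_grid.Ocol G m' \<or> i = marked_grid.Ocol G m' \<and> j = marked_grid.Orow G m'"
      using connected[OF Suc.prems(1)] by blast
    have "{1..gsize G} - insert i L = ({1..gsize G} - L) - {i}" by blast
    then have "m = card ({1..gsize G} - insert i L)" using Suc.hyps(2) i by simp
    then obtain b where b: "b \<in> grid_chains G" "c + boundary G b \<in> ideal_chains G (insert i L)"
      using Suc.hyps(1)[of "insert i L"] Suc.prems i by blast
    interpret marked_grid G m' by (rule m')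
    \<comment> \<open>The cycle condition modulo \<open>K\<close> passes to the larger set
      \<open>L\<close>, as \<open>boundary_step\<close> demands.\<close>
    have "ideal_chains G K \<subseteq> ideal_chains G L"
      using mvar_ideal_mono[OF Suc.prems(1)] by (auto simp: ideal_chains_def)
    moreover have "c = boundary G b + (c + boundary G b)" by (simp only: add.commute[of c] chain_add_cancel)
    ultimately show ?case
      using boundary_step[OF ij, of L c b "c + boundary G b"] i j c(1) b by blast
  qed
  then show ?thesis using K by blast
qed

text \<open>If no X had one O inside \<open>L\<close> and the other outside, then \<open>L\<close>
  together with its adjacent X markings would be a union of components. As \<open>L\<close> meets
  every component, it would contain every O.\<close>

lemma components_connected:
  assumes grid: "grid_diagram G" and C: "bij_betw C {1..l} (link_components G)"
    and k: "\<forall>i\<in>{1..l}. OM (k i) \<in> C i" and L: "k ` {1..l} \<subseteq> L" "L \<subset> {1..gsize G}"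
  shows "\<exists>m i j. marked_grid G m \<and> i \<in> {1..gsize G} - L \<and> j \<in> L \<and>
        (i = marked_grid.Orow G m \<and> j = marked_grid.Ocol G m \<or> i = marked_grid.Ocol G m \<and> j = marked_grid.Orow G m)"
proof (rule ccontr)
  assume no: "\<not> ?thesis"
  have mg: "marked_grid G m" if "m \<in> {1..gsize G}" for m using grid that by unfold_locales
  have row: "snd (Opos G i) = snd (Xpos G m) \<longleftrightarrow> i = marked_grid.Orow G m" if "m \<in> {1..gsize G}" "i \<in> {1..gsize G}" for m i
    using marked_grid.Orow_unique[OF mg that(2)] that(1) marked_grid.r0_def[OF mg] by simp
  have col: "fst (Opos G i) = fst (Xpos G m) \<longleftrightarrow> i = marked_grid.Ocol G m" if "m \<in> {1..gsize G}" "i \<in> {1..gsize G}" for m i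
    using marked_grid.Ocol_unique[OF mg that(2)] that(1) marked_grid.c0_def[OF mg] by simp
  have iff: "marked_grid.Orow G m \<in> L \<longleftrightarrow> marked_grid.Ocol G m \<in> L" if "m \<in> {1..gsize G}" for m
    using no mg[OF that] marked_grid.Orow(1)[OF mg[OF that]] marked_grid.Ocol(1)[OF mg[OF that]] by blast
  define A where "A = OM ` L \<union> XM ` {m \<in> {1..gsize G}. marked_grid.Orow G m \<in> L}"
  have seg: "s \<in> A \<longleftrightarrow> t \<in> A" if "(s, t) \<in> link_segments G" for s t
    using that unfolding link_segments_def
  proof (elim UnE CollectE exE conjE)
    fix i j assume "(s, t) = (OM i, XM j)" "i \<in> {1..gsize G}" "j \<in> {1..gsize G}" "snd (Opos G i) = snd (Xpos G j)"
    then show ?thesis using row[of j i] by (auto simp: A_def)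
  next
    fix i j assume "(s, t) = (XM j, OM i)" "i \<in> {1..gsize G}" "j \<in> {1..gsize G}" "fst (Xpos G j) = fst (Opos G i)"
    then show ?thesis using col[of j i] iff[of j] by (auto simp: A_def)
  qed
  have A: "s \<in> A \<longleftrightarrow> t \<in> A" if "(s, t) \<in> (link_segments G \<union> (link_segments G)\<inverse>)\<^sup>*" for s t
    using that by (induction rule: rtrancl_induct) (use seg in blast)+
  obtain i where i: "i \<in> {1..gsize G}" "i \<notin> L" using L(2) by blast
  then have "(link_segments G \<union> (link_segments G)\<inverse>)\<^sup>* `` {OM i} \<in> link_components G"
    by (auto simp: link_components_def markings_def intro!: quotientI)
  then obtain m where m: "m \<in> {1..l}" "C m = (link_segments G \<union> (link_segments G)\<inverse>)\<^sup>* `` {OM i}"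
    using C unfolding bij_betw_def by (metis imageE)
  then have "(OM i, OM (k m)) \<in> (link_segments G \<union> (link_segments G)\<inverse>)\<^sup>*" using k by auto
  moreover have "k m \<in> L" using L(1) m(1) by blast
  then have "OM (k m) \<in> A" by (simp add: A_def)
  ultimately have "OM i \<in> A" using A by blast
  then show False using i by (auto simp: A_def)
qed

section \<open>The canonical states are cycles\<close>

lemma Suc_mod_pred:
  assumes "i < n" obtains c where "c < n" "\<And>c'. c' < n \<Longrightarrow> Suc c' mod n = i \<longleftrightarrow> c' = c"
proof (rule that[of "if i = 0 then n - 1 else i - 1"])
  show "(if i = 0 then n - 1 else i - 1) < n" using assms by auto
  show "Suc c' mod n = i \<longleftrightarrow> c' = (if i = 0 then n - 1 else i - 1)" if "c' < n" for c'
    using that assms by (auto simp: mod_Suc)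
qed

context marked_grid
begin

lemma Xs_state: "Xs \<in> grid_states G"
  unfolding grid_states_def mem_Collect_eq
proof (intro conjI allI impI Xs_sub)
  show "\<exists>!p. p \<in> Xs \<and> fst p = i" if "i < n" for i
  proof -
    obtain r where r: "\<And>j. (i, j) \<in> Xs \<longleftrightarrow> j = r" using X_in_col[OF \<open>i < n\<close>] by metis
    have "p = (i, r)" if "p \<in> Xs \<and> fst p = i" for p
      using that r[of "snd p"] by (metis prod.collapse)
    then show ?thesis using r[of r] by (intro ex1I[of _ "(i, r)"]) simp_all
  qed
  show "\<exists>!p. p \<in> Xs \<and> snd p = j" if "j < n" for j
  proof -
    obtain c where c: "\<And>i. (i, j) \<in> Xs \<longleftrightarrow> i = c" using X_in_row[OF \<open>j < n\<close>] by metis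
    have "p = (c, j)" if "p \<in> Xs \<and> snd p = j" for p
      using that c[of "fst p"] by (metis prod.collapse)
    then show ?thesis using c[of c] by (intro ex1I[of _ "(c, j)"]) simp_all
  qed
qed

lemma x_minus_eq: "x_minus G = Xs"
  unfolding x_minus_def Xs_def
proof (rule image_cong[OF refl])
  fix i assume "i \<in> {1..n}"
  then show "tor G (fst (Xpos G i)) (snd (Xpos G i)) = Xpos G i"
    using X_range[of i] by (cases "Xpos G i") (auto simp: tor_def)
qed

lemma x_plus_eq: "x_plus G = (\<lambda>(c, r). (Suc c mod n, Suc r mod n)) ` Xs"
  by (simp add: x_plus_def Xs_def image_image tor_def case_prod_unfold)

lemma x_plus_state: "x_plus G \<in> grid_states G"
  unfolding grid_states_def mem_Collect_eq
proof (intro conjI allI impI)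
  have n0: "0 < n" using X0(3) by simp
  show "x_plus G \<subseteq> {..<n} \<times> {..<n}" using n0 by (auto simp: x_plus_eq)
  show "\<exists>!p. p \<in> x_plus G \<and> fst p = i" if "i < n" for i
  proof -
    obtain c where c: "c < n" "\<And>c'. c' < n \<Longrightarrow> Suc c' mod n = i \<longleftrightarrow> c' = c" using Suc_mod_pred[OF \<open>i < n\<close>] by metis
    obtain r where r: "\<And>j. (c, j) \<in> Xs \<longleftrightarrow> j = r" using X_in_col[OF c(1)] by metis
    show ?thesis
    proof (rule ex1I[of _ "(i, Suc r mod n)"])
      show "(i, Suc r mod n) \<in> x_plus G \<and> fst (i, Suc r mod n) = i"
        unfolding x_plus_eq using c r by (auto intro!: image_eqI[of _ _ "(c, r)"])
      fix p assume "p \<in> x_plus G \<and> fst p = i"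
      then obtain c' r' where "(c', r') \<in> Xs" "p = (Suc c' mod n, Suc r' mod n)" "Suc c' mod n = i"
        unfolding x_plus_eq by auto
      then show "p = (i, Suc r mod n)" using c(2)[of c'] r Xs_sub by auto
    qed
  qed
  show "\<exists>!p. p \<in> x_plus G \<and> snd p = j" if "j < n" for j
  proof -
    obtain r where r: "r < n" "\<And>r'. r' < n \<Longrightarrow> Suc r' mod n = j \<longleftrightarrow> r' = r" using Suc_mod_pred[OF \<open>j < n\<close>] by metis
    obtain c where c: "\<And>i. (i, r) \<in> Xs \<longleftrightarrow> i = c" using X_in_row[OF r(1)] by metis
    show ?thesis
    proof (rule ex1I[of _ "(Suc c mod n, j)"])
      show "(Suc c mod n, j) \<in> x_plus G \<and> snd (Suc c mod n, j) = j"
        unfolding x_plus_eq using c r by (auto intro!: image_eqI[of _ _ "(c, r)"])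
      fix p assume "p \<in> x_plus G \<and> snd p = j"
      then obtain c' r' where "(c', r') \<in> Xs" "p = (Suc c' mod n, Suc r' mod n)" "Suc r' mod n = j"
        unfolding x_plus_eq by auto
      then show "p = (Suc c mod n, j)" using r(2)[of r'] c Xs_sub by auto
    qed
  qed
qed

lemma boundary_generator:
  assumes "x \<in> grid_states G" "\<And>y. Rect_noX G x y = {}"
  shows "boundary G (generator x) = 0"
proof
  fix y
  have "generator x x' * (\<Sum>r\<in>Rect_noX G x' y. rect_weight G x' r) = 0" for x'
    using assms(2) by (simp add: generator_def)
  then have "(\<Sum>x'\<in>grid_states G. generator x x' * (\<Sum>r\<in>Rect_noX G x' y. rect_weight G x' r)) = 0"
    by (rule sum.neutral[OF ballI])
  then show "boundary G (generator x) y = 0 y" by (simp only: boundary_def if_cancel zero_fun_apply)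
qed

text \<open>The southwest corner of the rectangle is a point of the state, and the square northeast
  of that point lies in the rectangle and carries an X.\<close>

lemma Rect_noX_x_minus: "Rect_noX G (x_minus G) y = {}"
proof (rule ccontr)
  assume "Rect_noX G (x_minus G) y \<noteq> {}"
  then obtain a b w h where r: "((a, b), (w, h)) \<in> Rect G (x_minus G) y"
    and X: "rect_squares G ((a, b), (w, h)) \<inter> Xs = {}"
    by (auto simp: Rect_noX_def Xs_def)
  have "tor G a b \<in> Xs" "0 < w" "0 < h" using r by (auto simp: Rect_def x_minus_eq)
  moreover have "tor G (a + 0) (b + 0) \<in> rect_squares G ((a, b), (w, h))"
    unfolding rect_squares.simps using calculation(2,3) by blast
  ultimately show False using X by auto
qed

text \<open>Here the northeast corner is decisive: the square southwest of it, at offset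
  \<open>(w - 1, h - 1)\<close>, carries an X.\<close>

lemma Rect_noX_x_plus: "Rect_noX G (x_plus G) y = {}"
proof (rule ccontr)
  assume "Rect_noX G (x_plus G) y \<noteq> {}"
  then obtain a b w h where r: "((a, b), (w, h)) \<in> Rect G (x_plus G) y"
    and X: "rect_squares G ((a, b), (w, h)) \<inter> Xs = {}"
    by (auto simp: Rect_noX_def Xs_def)
  have wh: "0 < w" "0 < h" "tor G (a + w) (b + h) \<in> x_plus G" using r by (auto simp: Rect_def)
  then obtain c s where cs: "(c, s) \<in> Xs" "(a + w) mod n = Suc c mod n" "(b + h) mod n = Suc s mod n"
    unfolding x_plus_eq by (auto simp: tor_def)
  obtain w' h' where w': "w = Suc w'" "h = Suc h'" using wh(1,2) gr0_implies_Suc by blast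
  \<comment> \<open>Passing from the corner back to its square cancels a successor modulo
    \<open>n\<close>.\<close>
  have mod: "u mod n = v mod n" if "Suc u mod n = Suc v mod n" for u v
    using that by (auto simp: mod_Suc split: if_splits)
  have "(a + w') mod n = c" "(b + h') mod n = s"
    using mod[of "a + w'" c] mod[of "b + h'" s] cs Xs_sub w' by auto
  then have "tor G (a + w') (b + h') \<in> Xs" using cs(1) by (simp add: tor_def)
  moreover have "tor G (a + w') (b + h') \<in> rect_squares G ((a, b), (w, h))"
    unfolding rect_squares.simps using w' by blast
  ultimately show False using X by auto
qed

end

lemma generator_chains: "x \<in> grid_states G \<Longrightarrow> generator x \<in> grid_chains G"
  by (rule chainsI) (auto simp: generator_def poly_ring_0 poly_ring_1)

theorem proposition1p3:
  fixes G :: grid and l :: nat and C :: "nat \<Rightarrow> marking set" and k :: "nat \<Rightarrow> nat"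
  assumes "grid_diagram G"
    and "bij_betw C {1..l} (link_components G)"
    and "\<forall>i\<in>{1..l}. OM (k i) \<in> C i"
  shows "(\<exists>f. f \<in> module_homs F_v (GH_hat G k l) (GH_tilde G) \<and>
              inj_on f (carrier (GH_hat G k l)) \<and>
              f (lambda_hat_plus G k l) = lambda_tilde_plus G \<and>
              f (lambda_hat_minus G k l) = lambda_tilde_minus G) \<and>
         (lambda_hat_plus G k l = \<zero>\<^bsub>GH_hat G k l\<^esub> \<longleftrightarrow> lambda_tilde_plus G = \<zero>\<^bsub>GH_tilde G\<^esub>) \<and>
         (lambda_hat_minus G k l = \<zero>\<^bsub>GH_hat G k l\<^esub> \<longleftrightarrow> lambda_tilde_minus G = \<zero>\<^bsub>GH_tilde G\<^esub>)"
proof -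
  define K where "K = k ` {1..l}"
  define M where "M = {1..gsize G}"
  \<comment> \<open>The labels are in range because a component consists of markings of the
    grid.\<close>
  have K: "K \<subseteq> M"
  proof
    fix j assume "j \<in> K"
    then obtain i where i: "i \<in> {1..l}" "j = k i" by (auto simp: K_def)
    have "C i \<in> link_components G" using assms(2) i(1) by (auto simp: bij_betw_def)
    then obtain s where "s \<in> markings G" "C i = (link_segments G \<union> (link_segments G)\<inverse>)\<^sup>* `` {s}"
      by (auto simp: link_components_def elim: quotientE)
    then have "(s, OM j) \<in> (link_segments G \<union> (link_segments G)\<inverse>)\<^sup>*" using assms(3) i by auto
    then have "OM j \<in> markings G"
      using \<open>s \<in> markings G\<close>
      by (induction rule: rtrancl_induct) (auto simp: link_segments_def markings_def)
    then show "j \<in> M" by (auto simp: markings_def M_def)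
  qed
  interpret hat: grid_quotient G K using assms(1) K[unfolded M_def] by unfold_locales
  interpret tilde: grid_quotient G "M" using assms(1) by unfold_locales (simp_all add: M_def)
  obtain m where "marked_grid G m" by (rule hat.marked)
  then interpret marked_grid G m .
  have hat: "GH_hat G k l = GH_mod G K" "lambda_hat_plus G k l = hat.hclass (generator (x_plus G))"
    "lambda_hat_minus G k l = hat.hclass (generator (x_minus G))"
    by (simp_all only: GH_hat_def lambda_hat_plus_def lambda_hat_minus_def K_def[symmetric] hat.state_class_eq)
  have tilde: "GH_tilde G = GH_mod G M" "lambda_tilde_plus G = tilde.hclass (generator (x_plus G))"
    "lambda_tilde_minus G = tilde.hclass (generator (x_minus G))"
    by (simp_all only: GH_tilde_def M_def[symmetric] lambda_tilde_plus_def lambda_tilde_minus_def tilde.state_class_eq)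
  have sub: "ideal_chains G K \<subseteq> ideal_chains G M"
    using mvar_ideal_mono[OF K] by (auto simp: ideal_chains_def)
  then have cyc: "c \<in> tilde.cycles" if "c \<in> hat.cycles" for c
    using that by (auto simp: hat.cycles_def tilde.cycles_def)
  have add: "c + c' \<in> hat.cycles" if "c \<in> hat.cycles" "c' \<in> hat.cycles" for c c'
    using that by (simp add: hat.cycles_def chains_add hat.d_add hat.add_mem)
  have Fv: "p \<in> carrier (poly_ring {0..gsize G})" if "p \<in> carrier F_v" for p
    using that subset_trans[of _ "{0}" "{0..gsize G}"] by (simp add: poly_ring_def)
  have smult: "(\<lambda>x. p * c x) \<in> hat.cycles" if "p \<in> carrier F_v" "c \<in> hat.cycles" for p c
    using that Fv by (simp add: hat.cycles_def chains_smult hat.d_smult ideal_chains_smult)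
  \<comment> \<open>Left to right is the inclusion of the ideals. The converse is injectivity, from
    \<open>hclass_reflect\<close> applied to the cycle \<open>c + c'\<close>.\<close>
  have iff: "hat.hclass c = hat.hclass c' \<longleftrightarrow> tilde.hclass c = tilde.hclass c'"
    if "c \<in> hat.cycles" "c' \<in> hat.cycles" for c c'
  proof
    show "tilde.hclass c = tilde.hclass c'" if "hat.hclass c = hat.hclass c'"
      using that sub unfolding hat.hclass_eq_iff tilde.hclass_eq_iff by blast
    assume "tilde.hclass c = tilde.hclass c'"
    then obtain b where "b \<in> grid_chains G" "c + c' + boundary G b \<in> ideal_chains G M"
      unfolding tilde.hclass_eq_iff by blast
    moreover have "boundary G (c + c') \<in> ideal_chains G K"
      using add[OF that] by (simp add: hat.cycles_def)
    ultimately show "hat.hclass c = hat.hclass c'"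
      unfolding hat.hclass_eq_iff
      using hclass_reflect[OF K[unfolded M_def] assms(1) components_connected[OF assms(1-3)], folded K_def M_def] by blast
  qed
  \<comment> \<open>By \<open>iff\<close> the value does not depend on the chosen cycle.\<close>
  define f where "f X = tilde.hclass (SOME c. c \<in> hat.cycles \<and> hat.hclass c = X)" for X
  have f: "f (hat.hclass c) = tilde.hclass c" if "c \<in> hat.cycles" for c
  proof -
    have "\<exists>c'. c' \<in> hat.cycles \<and> hat.hclass c' = hat.hclass c" using that by blast
    from someI_ex[OF this] show ?thesis unfolding f_def using iff that by blast
  qed
  have gen: "generator (x_plus G) \<in> hat.cycles" "generator (x_minus G) \<in> hat.cycles"
    using x_plus_state Xs_state[folded x_minus_eq] boundary_generator Rect_noX_x_plus Rect_noX_x_minus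
    by (simp_all add: hat.cycles_def generator_chains hat.zero_mem)
  \<comment> \<open>Comparison with the class of 0 turns \<open>iff\<close> into the two claims
    about vanishing.\<close>
  have zero: "0 \<in> hat.cycles" by (simp add: hat.cycles_def chains_0 hat.d_0 hat.zero_mem)
  have "f \<in> module_homs F_v (GH_mod G K) (GH_mod G M)"
    unfolding module_homs_def mem_Collect_eq hat.GH_carrier tilde.GH_carrier
    using cyc by (auto simp: f hat.GH_add tilde.GH_add hat.GH_smult tilde.GH_smult Fv add smult)
  moreover have "inj_on f (carrier (GH_mod G K))"
    unfolding hat.GH_carrier
  proof (intro inj_onI, elim imageE)
    fix X Y c c'
    assume "f X = f Y" "X = hat.hclass c" "Y = hat.hclass c'" and cc: "c \<in> hat.cycles" "c' \<in> hat.cycles"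
    then show "X = Y" using f[OF cc(1)] f[OF cc(2)] iff[OF cc] by simp
  qed
  ultimately show ?thesis
    unfolding hat tilde hat.GH_zero tilde.GH_zero
    using f[OF gen(1)] f[OF gen(2)] iff[OF gen(1) zero] iff[OF gen(2) zero] by blast
qed

end
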